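(* Let $\mathbb{D}$ be an equipment with a vertical terminal object such that $\mathbf{V}(\mathbb{D})$ is finitely complete. Suppose that $M$ is a stable system on $\mathbf{V}(\mathbb{D})$ and that $\mathbb{D}$ admits a left-sided $M$-comprehension scheme. Then $(\mathrm{Fin}(\mathbb{D}),M)$ is an orthogonal factorisation system on $\mathbf{V}(\mathbb{D})$. Moreover, if $\mathbb{D}$ has Beck-Chevalley pullbacks, then this factorisation system is stable (i.e. its left class $\mathrm{Fin}(\mathbb{D})$ is stable under pullback).
   Context: Double categories. A double category $\mathbb{D}$ is a pseudo double category: a category $\mathbb{D}_0=\mathbf{V}(\mathbb{D})$ of objects and vertical arrows, a category $\mathbb{D}_1$ of horizontal arrows $p\colon A\nrightarrow B$ and cells, functors $\mathrm{src},\mathrm{tgt}\colon\mathbb{D}_1\to\mathbb{D}_0$, $\mathrm{Id}\colon\mathbb{D}_0\to\mathbb{D}_1$, and a horizontal composition $\odot$ (diagrammatic order), associative and unital up to coherent isomorphism. A cell $\alpha\colon p\to q$ is framed by $(f,g)$ if $\mathrm{src}(\alpha)=f$ and $\mathrm{tgt}(\alpha)=g$. Vertical composites are written $f;g$ ($f$ first). Equipments. $\mathbb{D}$ is an equipment if $\langle\mathrm{src},\mathrm{tgt}\rangle\colon\mathbb{D}_1\to\mathbb{D}_0\times\mathbb{D}_0$ is a fibration (it is then also an opfibration); (op)cartesian cells are (op)cartesian arrows for it. For vertical $l\colon X\to A$, $r\colon X\to B$, the extension $l^*r_!\colon A\nrightarrow B$ is the bottom of the opcartesian cell out of $\mathrm{Id}_X$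 framed by $(l,r)$. A vertical terminal object $1$ is a right adjoint to the unique double functor $\mathbb{D}\to\mathbb{1}$ in the 2-category of double categories, pseudo double functors and vertical transformations; thus $1$ is terminal in $\mathbb{D}_0$ and $\mathrm{Id}_1$ is terminal in $\mathbb{D}_1$. Write $!\colon X\to 1$. Beck-Chevalley. Given vertical arrows $g\colon A\to B$, $f\colon A\to C$, $h\colon B\to D$, $k\colon C\to D$ and a cell $\alpha\colon\mathrm{Id}_A\to\mathrm{Id}_D$ framed by $(g;h,\,f;k)$, $\alpha$ satisfies the Beck-Chevalley condition if it factors as an opcartesian cell $\mathrm{Id}_A\to p$ framed by $(g,f)$ followed by a cartesian cell $p\to\mathrm{Id}_D$ framed by $(h,k)$, for some $p\colon B\nrightarrow C$. A pullback square in $\mathbf{V}(\mathbb{D})$ is a Beck-Chevalley pullback square if its identity cell satisfies this condition in both orientations. $\mathbb{D}$ has Beck-Chevalley pullbacks if $\mathbf{V}(\mathbb{D})$ has pullbacks and all pullback squares are Beck-Chevalley. Final arrows. A vertical arrow $f\colon A\to X$ is final if the unique cell $\mathrm{Id}_A\to\mathrm{Id}_1$, viewed with $g:=f\colon A\to X$, $!\colon A\to 1$, $h:=\,!\colon X\to1$, $k:=\mathrm{id}_1$, satisfies the Beck-Chevalley condition. $\mathrm{Fin}(\mathbb{D})$ is the class of final arrows. Stable system: a class $M$ of arrows of a category containing all isomorphisms, closed under composition and stable under pullback. Left-sided tabulators. A tabulator of $p\colon X\nrightarrow 1$ is an object $\top p$ with a cell $\tau\colon\mathrm{Id}_{\top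 p}\to p$ framed by $(l,!)$ such that every cell $\mathrm{Id}_Z\to p$ is $\mathrm{Id}_u$ followed by $\tau$ for a unique vertical $u\colon Z\to\top p$. It is strong if $\tau$ is opcartesian, and an $M$-tabulator if $l\in M$. $\mathbb{D}$ admits a left-sided $M$-comprehension scheme if every horizontal arrow into $1$ has a strong $M$-tabulator and for every $f\colon X\to A$ in $M$ the opcartesian cell $\mathrm{Id}_X\to f^*!_!$ framed by $(f,!)$ exhibits $X$ as a tabulator of $f^*!_!$. *)

theory Defs
  imports Main
begin

section \<open>Categories and functors\<close>

text \<open>
  Composition is written in diagrammatic order throughout: \<open>f \<Zsemi> g\<close> is \<open>f\<close> first, then \<open>g\<close>.
  The operations of a structure are total functions in HOL, but only their values on
  the carriers (and on composable arguments) matter.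
\<close>

record ('o, 'a) cat =
  Obj  :: "'o set"
  Arr  :: "'a set"
  Dom  :: "'a \<Rightarrow> 'o"
  Cod  :: "'a \<Rightarrow> 'o"
  Ide  :: "'o \<Rightarrow> 'a"
  Comp :: "'a \<Rightarrow> 'a \<Rightarrow> 'a"  (infixl "\<Zsemi>\<index>" 70)

definition hom :: "('o, 'a) cat \<Rightarrow> 'o \<Rightarrow> 'o \<Rightarrow> 'a set" where
  "hom C A B = {f \<in> Arr C. Dom C f = A \<and> Cod C f = B}"

locale category =
  fixes C :: "('o, 'a) cat" (structure)
  assumes dom_obj: "f \<in> Arr C \<Longrightarrow> Dom C f \<in> Obj C"
    and cod_obj: "f \<in> Arr C \<Longrightarrow> Cod C f \<in> Obj C"
    and ide_hom: "A \<in> Obj C \<Longrightarrow> Ide C A \<in> hom C A A"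
    and comp_hom: "\<lbrakk>f \<in> hom C X Y; g \<in> hom C Y Z\<rbrakk> \<Longrightarrow> f \<Zsemi> g \<in> hom C X Z"
    and ide_left: "f \<in> hom C X Y \<Longrightarrow> Ide C X \<Zsemi> f = f"
    and ide_right: "f \<in> hom C X Y \<Longrightarrow> f \<Zsemi> Ide C Y = f"
    and comp_assoc: "\<lbrakk>f \<in> hom C W X; g \<in> hom C X Y; h \<in> hom C Y Z\<rbrakk>
      \<Longrightarrow> (f \<Zsemi> g) \<Zsemi> h = f \<Zsemi> (g \<Zsemi> h)"

definition iso :: "('o, 'a) cat \<Rightarrow> 'a \<Rightarrow> bool" where
  "iso C f \<longleftrightarrow> f \<in> Arr C \<and>
     (\<exists>g \<in> hom C (Cod C f) (Dom C f).
        f \<Zsemi>\<^bsub>C\<^esub> g = Ide C (Dom C f) \<and> g \<Zsemi>\<^bsub>C\<^esub> f = Ide C (Cod C f))"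

text \<open>A functor is given by its object part \<open>Fo\<close> and its arrow part \<open>Fa\<close>.\<close>

locale is_functor =
  fixes B :: "('o1, 'a1) cat" and C :: "('o2, 'a2) cat"
    and Fo :: "'o1 \<Rightarrow> 'o2" and Fa :: "'a1 \<Rightarrow> 'a2"
  assumes map_obj: "X \<in> Obj B \<Longrightarrow> Fo X \<in> Obj C"
    and map_hom: "f \<in> hom B X Y \<Longrightarrow> Fa f \<in> hom C (Fo X) (Fo Y)"
    and map_ide: "X \<in> Obj B \<Longrightarrow> Fa (Ide B X) = Ide C (Fo X)"
    and map_comp: "\<lbrakk>f \<in> hom B X Y; g \<in> hom B Y Z\<rbrakk> \<Longrightarrow> Fa (f \<Zsemi>\<^bsub>B\<^esub> g) = Fa f \<Zsemi>\<^bsub>C\<^esub> Fa g"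

definition prod_cat :: "('o1, 'a1) cat \<Rightarrow> ('o2, 'a2) cat \<Rightarrow> ('o1 \<times> 'o2, 'a1 \<times> 'a2) cat" where
  "prod_cat B C = \<lparr>
     Obj = Obj B \<times> Obj C,
     Arr = Arr B \<times> Arr C,
     Dom = (\<lambda>(f, g). (Dom B f, Dom C g)),
     Cod = (\<lambda>(f, g). (Cod B f, Cod C g)),
     Ide = (\<lambda>(X, Y). (Ide B X, Ide C Y)),
     Comp = (\<lambda>(f, g) (f', g'). (f \<Zsemi>\<^bsub>B\<^esub> f', g \<Zsemi>\<^bsub>C\<^esub> g')) \<rparr>"


section \<open>Cartesian and opcartesian arrows\<close>

definition cartesian_arrow ::
    "('o1, 'a1) cat \<Rightarrow> ('o2, 'a2) cat \<Rightarrow> ('o1 \<Rightarrow> 'o2) \<Rightarrow> ('a1 \<Rightarrow> 'a2) \<Rightarrow> 'a1 \<Rightarrow> bool" where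
  "cartesian_arrow E B Po Pa \<phi> \<longleftrightarrow> \<phi> \<in> Arr E \<and>
     (\<forall>\<psi> \<in> Arr E. Cod E \<psi> = Cod E \<phi> \<longrightarrow>
       (\<forall>w \<in> hom B (Po (Dom E \<psi>)) (Po (Dom E \<phi>)). w \<Zsemi>\<^bsub>B\<^esub> Pa \<phi> = Pa \<psi> \<longrightarrow>
         (\<exists>!\<chi>. \<chi> \<in> hom E (Dom E \<psi>) (Dom E \<phi>) \<and> Pa \<chi> = w \<and> \<chi> \<Zsemi>\<^bsub>E\<^esub> \<phi> = \<psi>)))"

definition opcartesian_arrow ::
    "('o1, 'a1) cat \<Rightarrow> ('o2, 'a2) cat \<Rightarrow> ('o1 \<Rightarrow> 'o2) \<Rightarrow> ('a1 \<Rightarrow> 'a2) \<Rightarrow> 'a1 \<Rightarrow> bool" where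
  "opcartesian_arrow E B Po Pa \<phi> \<longleftrightarrow> \<phi> \<in> Arr E \<and>
     (\<forall>\<psi> \<in> Arr E. Dom E \<psi> = Dom E \<phi> \<longrightarrow>
       (\<forall>w \<in> hom B (Po (Cod E \<phi>)) (Po (Cod E \<psi>)). Pa \<phi> \<Zsemi>\<^bsub>B\<^esub> w = Pa \<psi> \<longrightarrow>
         (\<exists>!\<chi>. \<chi> \<in> hom E (Cod E \<phi>) (Cod E \<psi>) \<and> Pa \<chi> = w \<and> \<phi> \<Zsemi>\<^bsub>E\<^esub> \<chi> = \<psi>)))"

definition fibration ::
    "('o1, 'a1) cat \<Rightarrow> ('o2, 'a2) cat \<Rightarrow> ('o1 \<Rightarrow> 'o2) \<Rightarrow> ('a1 \<Rightarrow> 'a2) \<Rightarrow> bool" where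
  "fibration E B Po Pa \<longleftrightarrow> is_functor E B Po Pa \<and>
     (\<forall>e \<in> Obj E. \<forall>w \<in> Arr B. Cod B w = Po e \<longrightarrow>
       (\<exists>\<phi>. cartesian_arrow E B Po Pa \<phi> \<and> Cod E \<phi> = e \<and> Pa \<phi> = w))"


section \<open>Finite limits and pullbacks\<close>

definition is_cone ::
    "('i, 'j) cat \<Rightarrow> ('o, 'a) cat \<Rightarrow> ('i \<Rightarrow> 'o) \<Rightarrow> ('j \<Rightarrow> 'a) \<Rightarrow> 'o \<Rightarrow> ('i \<Rightarrow> 'a) \<Rightarrow> bool" where
  "is_cone J C Fo Fa L \<pi> \<longleftrightarrow> L \<in> Obj C \<and>
     (\<forall>i \<in> Obj J. \<pi> i \<in> hom C L (Fo i)) \<and>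
     (\<forall>u \<in> Arr J. \<pi> (Dom J u) \<Zsemi>\<^bsub>C\<^esub> Fa u = \<pi> (Cod J u))"

definition is_limit ::
    "('i, 'j) cat \<Rightarrow> ('o, 'a) cat \<Rightarrow> ('i \<Rightarrow> 'o) \<Rightarrow> ('j \<Rightarrow> 'a) \<Rightarrow> 'o \<Rightarrow> ('i \<Rightarrow> 'a) \<Rightarrow> bool" where
  "is_limit J C Fo Fa L \<pi> \<longleftrightarrow> is_cone J C Fo Fa L \<pi> \<and>
     (\<forall>Z \<zeta>. is_cone J C Fo Fa Z \<zeta> \<longrightarrow>
       (\<exists>!w. w \<in> hom C Z L \<and> (\<forall>i \<in> Obj J. w \<Zsemi>\<^bsub>C\<^esub> \<pi> i = \<zeta> i)))"

text \<open>
  Every finite category is isomorphic to one whose objects and arrows are natural numbers,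
  so it suffices to let the index category range over those.
\<close>

definition finitely_complete :: "('o, 'a) cat \<Rightarrow> bool" where
  "finitely_complete C \<longleftrightarrow>
     (\<forall>(J :: (nat, nat) cat) Fo Fa.
        category J \<and> finite (Obj J) \<and> finite (Arr J) \<and> is_functor J C Fo Fa \<longrightarrow>
        (\<exists>L \<pi>. is_limit J C Fo Fa L \<pi>))"

text \<open>
  \<open>is_pullback C g f h k\<close>: the square with \<open>g : A \<rightarrow> B\<close>, \<open>f : A \<rightarrow> C'\<close>, \<open>h : B \<rightarrow> D\<close>, \<open>k : C' \<rightarrow> D\<close>
  and \<open>g \<Zsemi> h = f \<Zsemi> k\<close> is a pullback.
\<close>

definition is_pullback :: "('o, 'a) cat \<Rightarrow> 'a \<Rightarrow> 'a \<Rightarrow> 'a \<Rightarrow> 'a \<Rightarrow> bool" where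
  "is_pullback C g f h k \<longleftrightarrow>
     g \<in> Arr C \<and> f \<in> Arr C \<and> h \<in> Arr C \<and> k \<in> Arr C \<and>
     Dom C g = Dom C f \<and> Cod C g = Dom C h \<and> Cod C f = Dom C k \<and> Cod C h = Cod C k \<and>
     g \<Zsemi>\<^bsub>C\<^esub> h = f \<Zsemi>\<^bsub>C\<^esub> k \<and>
     (\<forall>Z. \<forall>u \<in> hom C Z (Dom C h). \<forall>v \<in> hom C Z (Dom C k). u \<Zsemi>\<^bsub>C\<^esub> h = v \<Zsemi>\<^bsub>C\<^esub> k \<longrightarrow>
       (\<exists>!w. w \<in> hom C Z (Dom C g) \<and> w \<Zsemi>\<^bsub>C\<^esub> g = u \<and> w \<Zsemi>\<^bsub>C\<^esub> f = v))"

definition has_pullbacks :: "('o, 'a) cat \<Rightarrow> bool" where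
  "has_pullbacks C \<longleftrightarrow>
     (\<forall>h \<in> Arr C. \<forall>k \<in> Arr C. Cod C h = Cod C k \<longrightarrow> (\<exists>g f. is_pullback C g f h k))"


section \<open>Classes of arrows and orthogonal factorisation systems\<close>

definition stable_under_pullback :: "('o, 'a) cat \<Rightarrow> 'a set \<Rightarrow> bool" where
  "stable_under_pullback C M \<longleftrightarrow> (\<forall>g f h k. is_pullback C g f h k \<and> h \<in> M \<longrightarrow> f \<in> M)"

definition stable_system :: "('o, 'a) cat \<Rightarrow> 'a set \<Rightarrow> bool" where
  "stable_system C M \<longleftrightarrow> M \<subseteq> Arr C \<and>
     (\<forall>f. iso C f \<longrightarrow> f \<in> M) \<and>
     (\<forall>f \<in> M. \<forall>g \<in> M. Cod C f = Dom C g \<longrightarrow> f \<Zsemi>\<^bsub>C\<^esub> g \<in> M) \<and>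
     stable_under_pullback C M"

definition orthogonal :: "('o, 'a) cat \<Rightarrow> 'a \<Rightarrow> 'a \<Rightarrow> bool" where
  "orthogonal C e m \<longleftrightarrow>
     (\<forall>u \<in> hom C (Dom C e) (Dom C m). \<forall>v \<in> hom C (Cod C e) (Cod C m).
       u \<Zsemi>\<^bsub>C\<^esub> m = e \<Zsemi>\<^bsub>C\<^esub> v \<longrightarrow>
       (\<exists>!d. d \<in> hom C (Cod C e) (Dom C m) \<and> e \<Zsemi>\<^bsub>C\<^esub> d = u \<and> d \<Zsemi>\<^bsub>C\<^esub> m = v))"

definition orthogonal_factorisation_system :: "('o, 'a) cat \<Rightarrow> 'a set \<Rightarrow> 'a set \<Rightarrow> bool" where
  "orthogonal_factorisation_system C E M \<longleftrightarrow>
     E = {e \<in> Arr C. \<forall>m \<in> M. orthogonal C e m} \<and>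
     M = {m \<in> Arr C. \<forall>e \<in> E. orthogonal C e m} \<and>
     (\<forall>f \<in> Arr C. \<exists>e \<in> E. \<exists>m \<in> M. Cod C e = Dom C m \<and> e \<Zsemi>\<^bsub>C\<^esub> m = f)"


section \<open>Pseudo double categories\<close>

text \<open>
  \<open>Ver D\<close> is the category of objects and vertical arrows, \<open>Hor D\<close> the category of horizontal
  arrows and cells.  The functors src, tgt, Id and the horizontal composition each have an
  object part (prefix \<open>h\<close>, acting on objects of \<open>Hor D\<close> resp. \<open>Ver D\<close>) and an arrow part
  (prefix \<open>c\<close>, acting on cells resp. vertical arrows).
\<close>

record ('o, 'v, 'h, 'c) dblcat =
  Ver   :: "('o, 'v) cat"
  Hor   :: "('h, 'c) cat"
  hsrc  :: "'h \<Rightarrow> 'o"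
  csrc  :: "'c \<Rightarrow> 'v"
  htgt  :: "'h \<Rightarrow> 'o"
  ctgt  :: "'c \<Rightarrow> 'v"
  hid   :: "'o \<Rightarrow> 'h"
  cid   :: "'v \<Rightarrow> 'c"
  hcomp :: "'h \<Rightarrow> 'h \<Rightarrow> 'h"  (infixl "\<odot>\<index>" 80)
  ccomp :: "'c \<Rightarrow> 'c \<Rightarrow> 'c"  (infixl "\<otimes>\<index>" 80)
  assoc :: "'h \<Rightarrow> 'h \<Rightarrow> 'h \<Rightarrow> 'c"
  lunit :: "'h \<Rightarrow> 'c"
  runit :: "'h \<Rightarrow> 'c"

definition cell :: "('o, 'v, 'h, 'c) dblcat \<Rightarrow> 'c \<Rightarrow> 'h \<Rightarrow> 'h \<Rightarrow> 'v \<Rightarrow> 'v \<Rightarrow> bool" where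
  "cell D \<alpha> p q f g \<longleftrightarrow> \<alpha> \<in> hom (Hor D) p q \<and> csrc D \<alpha> = f \<and> ctgt D \<alpha> = g"

text \<open>The pullback of categories whose objects are the composable pairs of horizontal arrows.\<close>

definition comp_pairs :: "('o, 'v, 'h, 'c) dblcat \<Rightarrow> ('h \<times> 'h, 'c \<times> 'c) cat" where
  "comp_pairs D = (prod_cat (Hor D) (Hor D)) \<lparr>
     Obj := {(p, q). p \<in> Obj (Hor D) \<and> q \<in> Obj (Hor D) \<and> htgt D p = hsrc D q},
     Arr := {(\<alpha>, \<beta>). \<alpha> \<in> Arr (Hor D) \<and> \<beta> \<in> Arr (Hor D) \<and> ctgt D \<alpha> = csrc D \<beta>} \<rparr>"

definition globular_iso :: "('o, 'v, 'h, 'c) dblcat \<Rightarrow> 'c \<Rightarrow> 'h \<Rightarrow> 'h \<Rightarrow> bool" where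
  "globular_iso D \<alpha> p q \<longleftrightarrow>
     iso (Hor D) \<alpha> \<and> cell D \<alpha> p q (Ide (Ver D) (hsrc D p)) (Ide (Ver D) (htgt D p))"

locale double_category =
  fixes D :: "('o, 'v, 'h, 'c) dblcat" (structure)
  assumes category_Ver: "category (Ver D)"
    and category_Hor: "category (Hor D)"
    and functor_src: "is_functor (Hor D) (Ver D) (hsrc D) (csrc D)"
    and functor_tgt: "is_functor (Hor D) (Ver D) (htgt D) (ctgt D)"
    and functor_id: "is_functor (Ver D) (Hor D) (hid D) (cid D)"
    and hsrc_hid: "A \<in> Obj (Ver D) \<Longrightarrow> hsrc D (hid D A) = A"
    and htgt_hid: "A \<in> Obj (Ver D) \<Longrightarrow> htgt D (hid D A) = A"
    and csrc_cid: "f \<in> Arr (Ver D) \<Longrightarrow> csrc D (cid D f) = f"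
    and ctgt_cid: "f \<in> Arr (Ver D) \<Longrightarrow> ctgt D (cid D f) = f"
    and functor_comp: "is_functor (comp_pairs D) (Hor D)
      (\<lambda>(p, q). p \<odot> q) (\<lambda>(\<alpha>, \<beta>). \<alpha> \<otimes> \<beta>)"
    and hsrc_hcomp: "(p, q) \<in> Obj (comp_pairs D) \<Longrightarrow> hsrc D (p \<odot> q) = hsrc D p"
    and htgt_hcomp: "(p, q) \<in> Obj (comp_pairs D) \<Longrightarrow> htgt D (p \<odot> q) = htgt D q"
    and csrc_ccomp: "(\<alpha>, \<beta>) \<in> Arr (comp_pairs D) \<Longrightarrow> csrc D (\<alpha> \<otimes> \<beta>) = csrc D \<alpha>"
    and ctgt_ccomp: "(\<alpha>, \<beta>) \<in> Arr (comp_pairs D) \<Longrightarrow> ctgt D (\<alpha> \<otimes> \<beta>) = ctgt D \<beta>"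
    and assoc_iso: "\<lbrakk>(p, q) \<in> Obj (comp_pairs D); (q, r) \<in> Obj (comp_pairs D)\<rbrakk>
      \<Longrightarrow> globular_iso D (assoc D p q r) ((p \<odot> q) \<odot> r) (p \<odot> (q \<odot> r))"
    and assoc_natural: "\<lbrakk>(\<alpha>, \<beta>) \<in> Arr (comp_pairs D); (\<beta>, \<gamma>) \<in> Arr (comp_pairs D);
        \<alpha> \<in> hom (Hor D) p p'; \<beta> \<in> hom (Hor D) q q'; \<gamma> \<in> hom (Hor D) r r'\<rbrakk>
      \<Longrightarrow> ((\<alpha> \<otimes> \<beta>) \<otimes> \<gamma>) \<Zsemi>\<^bsub>Hor D\<^esub> assoc D p' q' r' = assoc D p q r \<Zsemi>\<^bsub>Hor D\<^esub> (\<alpha> \<otimes> (\<beta> \<otimes> \<gamma>))"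
    and lunit_iso: "p \<in> Obj (Hor D) \<Longrightarrow> globular_iso D (lunit D p) (hid D (hsrc D p) \<odot> p) p"
    and lunit_natural: "\<alpha> \<in> hom (Hor D) p p'
      \<Longrightarrow> (cid D (csrc D \<alpha>) \<otimes> \<alpha>) \<Zsemi>\<^bsub>Hor D\<^esub> lunit D p' = lunit D p \<Zsemi>\<^bsub>Hor D\<^esub> \<alpha>"
    and runit_iso: "p \<in> Obj (Hor D) \<Longrightarrow> globular_iso D (runit D p) (p \<odot> hid D (htgt D p)) p"
    and runit_natural: "\<alpha> \<in> hom (Hor D) p p'
      \<Longrightarrow> (\<alpha> \<otimes> cid D (ctgt D \<alpha>)) \<Zsemi>\<^bsub>Hor D\<^esub> runit D p' = runit D p \<Zsemi>\<^bsub>Hor D\<^esub> \<alpha>"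
    and pentagon: "\<lbrakk>(p, q) \<in> Obj (comp_pairs D); (q, r) \<in> Obj (comp_pairs D);
        (r, s) \<in> Obj (comp_pairs D)\<rbrakk>
      \<Longrightarrow> assoc D (p \<odot> q) r s \<Zsemi>\<^bsub>Hor D\<^esub> assoc D p q (r \<odot> s)
        = (assoc D p q r \<otimes> Ide (Hor D) s) \<Zsemi>\<^bsub>Hor D\<^esub> assoc D p (q \<odot> r) s
            \<Zsemi>\<^bsub>Hor D\<^esub> (Ide (Hor D) p \<otimes> assoc D q r s)"
    and triangle: "(p, q) \<in> Obj (comp_pairs D)
      \<Longrightarrow> assoc D p (hid D (htgt D p)) q \<Zsemi>\<^bsub>Hor D\<^esub> (Ide (Hor D) p \<otimes> lunit D q)
        = runit D p \<otimes> Ide (Hor D) q"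


section \<open>Pseudo double functors, vertical transformations, adjunctions\<close>

text \<open>
  \<open>FComp F p q : F p \<odot> F q \<rightarrow> F (p \<odot> q)\<close> and \<open>FUnit F A : Id (F A) \<rightarrow> F (Id A)\<close> are the
  comparison cells.
\<close>

record ('o1, 'v1, 'h1, 'c1, 'o2, 'v2, 'h2, 'c2) dblfun =
  FObj  :: "'o1 \<Rightarrow> 'o2"
  FVer  :: "'v1 \<Rightarrow> 'v2"
  FHor  :: "'h1 \<Rightarrow> 'h2"
  FCell :: "'c1 \<Rightarrow> 'c2"
  FComp :: "'h1 \<Rightarrow> 'h1 \<Rightarrow> 'c2"
  FUnit :: "'o1 \<Rightarrow> 'c2"

locale pseudo_double_functor =
  fixes D :: "('o1, 'v1, 'h1, 'c1) dblcat" and E :: "('o2, 'v2, 'h2, 'c2) dblcat"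
    and F :: "('o1, 'v1, 'h1, 'c1, 'o2, 'v2, 'h2, 'c2) dblfun"
  assumes functor_Ver: "is_functor (Ver D) (Ver E) (FObj F) (FVer F)"
    and functor_Hor: "is_functor (Hor D) (Hor E) (FHor F) (FCell F)"
    and hsrc_map: "p \<in> Obj (Hor D) \<Longrightarrow> hsrc E (FHor F p) = FObj F (hsrc D p)"
    and htgt_map: "p \<in> Obj (Hor D) \<Longrightarrow> htgt E (FHor F p) = FObj F (htgt D p)"
    and csrc_map: "\<alpha> \<in> Arr (Hor D) \<Longrightarrow> csrc E (FCell F \<alpha>) = FVer F (csrc D \<alpha>)"
    and ctgt_map: "\<alpha> \<in> Arr (Hor D) \<Longrightarrow> ctgt E (FCell F \<alpha>) = FVer F (ctgt D \<alpha>)"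
    and comp_iso: "(p, q) \<in> Obj (comp_pairs D)
      \<Longrightarrow> globular_iso E (FComp F p q) (FHor F p \<odot>\<^bsub>E\<^esub> FHor F q) (FHor F (p \<odot>\<^bsub>D\<^esub> q))"
    and unit_iso: "A \<in> Obj (Ver D)
      \<Longrightarrow> globular_iso E (FUnit F A) (hid E (FObj F A)) (FHor F (hid D A))"
    and comp_natural: "\<lbrakk>(\<alpha>, \<beta>) \<in> Arr (comp_pairs D); \<alpha> \<in> hom (Hor D) p p'; \<beta> \<in> hom (Hor D) q q'\<rbrakk>
      \<Longrightarrow> (FCell F \<alpha> \<otimes>\<^bsub>E\<^esub> FCell F \<beta>) \<Zsemi>\<^bsub>Hor E\<^esub> FComp F p' q'
        = FComp F p q \<Zsemi>\<^bsub>Hor E\<^esub> FCell F (\<alpha> \<otimes>\<^bsub>D\<^esub> \<beta>)"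
    and unit_natural: "f \<in> hom (Ver D) A B
      \<Longrightarrow> cid E (FVer F f) \<Zsemi>\<^bsub>Hor E\<^esub> FUnit F B = FUnit F A \<Zsemi>\<^bsub>Hor E\<^esub> FCell F (cid D f)"
    and assoc_coherence: "\<lbrakk>(p, q) \<in> Obj (comp_pairs D); (q, r) \<in> Obj (comp_pairs D)\<rbrakk>
      \<Longrightarrow> (FComp F p q \<otimes>\<^bsub>E\<^esub> Ide (Hor E) (FHor F r)) \<Zsemi>\<^bsub>Hor E\<^esub> FComp F (p \<odot>\<^bsub>D\<^esub> q) r
            \<Zsemi>\<^bsub>Hor E\<^esub> FCell F (assoc D p q r)
        = assoc E (FHor F p) (FHor F q) (FHor F r)
            \<Zsemi>\<^bsub>Hor E\<^esub> (Ide (Hor E) (FHor F p) \<otimes>\<^bsub>E\<^esub> FComp F q r) \<Zsemi>\<^bsub>Hor E\<^esub> FComp F p (q \<odot>\<^bsub>D\<^esub> r)"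
    and lunit_coherence: "p \<in> Obj (Hor D)
      \<Longrightarrow> (FUnit F (hsrc D p) \<otimes>\<^bsub>E\<^esub> Ide (Hor E) (FHor F p)) \<Zsemi>\<^bsub>Hor E\<^esub> FComp F (hid D (hsrc D p)) p
            \<Zsemi>\<^bsub>Hor E\<^esub> FCell F (lunit D p)
        = lunit E (FHor F p)"
    and runit_coherence: "p \<in> Obj (Hor D)
      \<Longrightarrow> (Ide (Hor E) (FHor F p) \<otimes>\<^bsub>E\<^esub> FUnit F (htgt D p)) \<Zsemi>\<^bsub>Hor E\<^esub> FComp F p (hid D (htgt D p))
            \<Zsemi>\<^bsub>Hor E\<^esub> FCell F (runit D p)
        = runit E (FHor F p)"

definition id_dblfun ::
    "('o, 'v, 'h, 'c) dblcat \<Rightarrow> ('o, 'v, 'h, 'c, 'o, 'v, 'h, 'c) dblfun" where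
  "id_dblfun D = \<lparr>
     FObj = (\<lambda>A. A), FVer = (\<lambda>f. f), FHor = (\<lambda>p. p), FCell = (\<lambda>\<alpha>. \<alpha>),
     FComp = (\<lambda>p q. Ide (Hor D) (p \<odot>\<^bsub>D\<^esub> q)),
     FUnit = (\<lambda>A. Ide (Hor D) (hid D A)) \<rparr>"

text \<open>\<open>comp_dblfun E F G\<close> is the composite of \<open>F : D \<rightarrow> D'\<close> followed by \<open>G : D' \<rightarrow> E\<close>.\<close>

definition comp_dblfun ::
    "('o3, 'v3, 'h3, 'c3) dblcat \<Rightarrow>
     ('o1, 'v1, 'h1, 'c1, 'o2, 'v2, 'h2, 'c2) dblfun \<Rightarrow>
     ('o2, 'v2, 'h2, 'c2, 'o3, 'v3, 'h3, 'c3) dblfun \<Rightarrow>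
     ('o1, 'v1, 'h1, 'c1, 'o3, 'v3, 'h3, 'c3) dblfun" where
  "comp_dblfun E F G = \<lparr>
     FObj = (\<lambda>A. FObj G (FObj F A)), FVer = (\<lambda>f. FVer G (FVer F f)),
     FHor = (\<lambda>p. FHor G (FHor F p)), FCell = (\<lambda>\<alpha>. FCell G (FCell F \<alpha>)),
     FComp = (\<lambda>p q. FComp G (FHor F p) (FHor F q) \<Zsemi>\<^bsub>Hor E\<^esub> FCell G (FComp F p q)),
     FUnit = (\<lambda>A. FUnit G (FObj F A) \<Zsemi>\<^bsub>Hor E\<^esub> FCell G (FUnit F A)) \<rparr>"

record ('o1, 'h1, 'v2, 'c2) vtrans =
  TObj :: "'o1 \<Rightarrow> 'v2"
  THor :: "'h1 \<Rightarrow> 'c2"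

locale vertical_transformation =
  fixes D :: "('o1, 'v1, 'h1, 'c1) dblcat" and E :: "('o2, 'v2, 'h2, 'c2) dblcat"
    and F G :: "('o1, 'v1, 'h1, 'c1, 'o2, 'v2, 'h2, 'c2) dblfun"
    and \<theta> :: "('o1, 'h1, 'v2, 'c2) vtrans"
  assumes obj_component: "A \<in> Obj (Ver D) \<Longrightarrow> TObj \<theta> A \<in> hom (Ver E) (FObj F A) (FObj G A)"
    and hor_component: "p \<in> Obj (Hor D)
      \<Longrightarrow> cell E (THor \<theta> p) (FHor F p) (FHor G p) (TObj \<theta> (hsrc D p)) (TObj \<theta> (htgt D p))"
    and natural_ver: "f \<in> hom (Ver D) A B
      \<Longrightarrow> FVer F f \<Zsemi>\<^bsub>Ver E\<^esub> TObj \<theta> B = TObj \<theta> A \<Zsemi>\<^bsub>Ver E\<^esub> FVer G f"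
    and natural_cell: "\<alpha> \<in> hom (Hor D) p q
      \<Longrightarrow> FCell F \<alpha> \<Zsemi>\<^bsub>Hor E\<^esub> THor \<theta> q = THor \<theta> p \<Zsemi>\<^bsub>Hor E\<^esub> FCell G \<alpha>"
    and compatible_comp: "(p, q) \<in> Obj (comp_pairs D)
      \<Longrightarrow> (THor \<theta> p \<otimes>\<^bsub>E\<^esub> THor \<theta> q) \<Zsemi>\<^bsub>Hor E\<^esub> FComp G p q
        = FComp F p q \<Zsemi>\<^bsub>Hor E\<^esub> THor \<theta> (p \<odot>\<^bsub>D\<^esub> q)"
    and compatible_unit: "A \<in> Obj (Ver D)
      \<Longrightarrow> cid E (TObj \<theta> A) \<Zsemi>\<^bsub>Hor E\<^esub> FUnit G A = FUnit F A \<Zsemi>\<^bsub>Hor E\<^esub> THor \<theta> (hid D A)"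

text \<open>
  Adjunctions in the 2-category of double categories, pseudo double functors and vertical
  transformations, given by unit, counit and the (componentwise) triangle identities.
\<close>

locale double_adjunction =
  fixes D :: "('o1, 'v1, 'h1, 'c1) dblcat" and E :: "('o2, 'v2, 'h2, 'c2) dblcat"
    and L :: "('o1, 'v1, 'h1, 'c1, 'o2, 'v2, 'h2, 'c2) dblfun"
    and R :: "('o2, 'v2, 'h2, 'c2, 'o1, 'v1, 'h1, 'c1) dblfun"
    and \<eta> :: "('o1, 'h1, 'v1, 'c1) vtrans"
    and \<epsilon> :: "('o2, 'h2, 'v2, 'c2) vtrans"
  assumes left_functor: "pseudo_double_functor D E L"
    and right_functor: "pseudo_double_functor E D R"
    and unit: "vertical_transformation D D (id_dblfun D) (comp_dblfun D L R) \<eta>"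
    and counit: "vertical_transformation E E (comp_dblfun E R L) (id_dblfun E) \<epsilon>"
    and triangle_left_obj: "A \<in> Obj (Ver D)
      \<Longrightarrow> FVer L (TObj \<eta> A) \<Zsemi>\<^bsub>Ver E\<^esub> TObj \<epsilon> (FObj L A) = Ide (Ver E) (FObj L A)"
    and triangle_left_hor: "p \<in> Obj (Hor D)
      \<Longrightarrow> FCell L (THor \<eta> p) \<Zsemi>\<^bsub>Hor E\<^esub> THor \<epsilon> (FHor L p) = Ide (Hor E) (FHor L p)"
    and triangle_right_obj: "B \<in> Obj (Ver E)
      \<Longrightarrow> TObj \<eta> (FObj R B) \<Zsemi>\<^bsub>Ver D\<^esub> FVer R (TObj \<epsilon> B) = Ide (Ver D) (FObj R B)"
    and triangle_right_hor: "q \<in> Obj (Hor E)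
      \<Longrightarrow> THor \<eta> (FHor R q) \<Zsemi>\<^bsub>Hor D\<^esub> FCell R (THor \<epsilon> q) = Ide (Hor D) (FHor R q)"


section \<open>Vertical terminal objects\<close>

definition unit_cat :: "(unit, unit) cat" where
  "unit_cat = \<lparr>Obj = UNIV, Arr = UNIV, Dom = (\<lambda>_. ()), Cod = (\<lambda>_. ()),
     Ide = (\<lambda>_. ()), Comp = (\<lambda>_ _. ())\<rparr>"

definition terminal_dblcat :: "(unit, unit, unit, unit) dblcat" where
  "terminal_dblcat = \<lparr>Ver = unit_cat, Hor = unit_cat,
     hsrc = (\<lambda>_. ()), csrc = (\<lambda>_. ()), htgt = (\<lambda>_. ()), ctgt = (\<lambda>_. ()),
     hid = (\<lambda>_. ()), cid = (\<lambda>_. ()), hcomp = (\<lambda>_ _. ()), ccomp = (\<lambda>_ _. ()),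
     assoc = (\<lambda>_ _ _. ()), lunit = (\<lambda>_. ()), runit = (\<lambda>_. ())\<rparr>"

definition to_terminal :: "('o, 'v, 'h, 'c, unit, unit, unit, unit) dblfun" where
  "to_terminal = \<lparr>FObj = (\<lambda>_. ()), FVer = (\<lambda>_. ()), FHor = (\<lambda>_. ()), FCell = (\<lambda>_. ()),
     FComp = (\<lambda>_ _. ()), FUnit = (\<lambda>_. ())\<rparr>"

text \<open>
  \<open>one\<close> is the object picked out by a right adjoint of the unique double functor to the
  terminal double category.
\<close>

definition vertical_terminal :: "('o, 'v, 'h, 'c) dblcat \<Rightarrow> 'o \<Rightarrow> bool" where
  "vertical_terminal D one \<longleftrightarrow>
     (\<exists>R \<eta> \<epsilon>. double_adjunction D terminal_dblcat to_terminal R \<eta> \<epsilon> \<and> FObj R () = one)"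

definition bang :: "('o, 'v, 'h, 'c) dblcat \<Rightarrow> 'o \<Rightarrow> 'o \<Rightarrow> 'v" where
  "bang D one X = (THE f. f \<in> hom (Ver D) X one)"


section \<open>Equipments\<close>

abbreviation frame_cat :: "('o, 'v, 'h, 'c) dblcat \<Rightarrow> ('o \<times> 'o, 'v \<times> 'v) cat" where
  "frame_cat D \<equiv> prod_cat (Ver D) (Ver D)"

abbreviation hframe :: "('o, 'v, 'h, 'c) dblcat \<Rightarrow> 'h \<Rightarrow> 'o \<times> 'o" where
  "hframe D \<equiv> (\<lambda>p. (hsrc D p, htgt D p))"

abbreviation cframe :: "('o, 'v, 'h, 'c) dblcat \<Rightarrow> 'c \<Rightarrow> 'v \<times> 'v" where
  "cframe D \<equiv> (\<lambda>\<alpha>. (csrc D \<alpha>, ctgt D \<alpha>))"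

definition equipment :: "('o, 'v, 'h, 'c) dblcat \<Rightarrow> bool" where
  "equipment D \<longleftrightarrow> double_category D \<and> fibration (Hor D) (frame_cat D) (hframe D) (cframe D)"

definition cartesian_cell :: "('o, 'v, 'h, 'c) dblcat \<Rightarrow> 'c \<Rightarrow> bool" where
  "cartesian_cell D \<alpha> \<longleftrightarrow> cartesian_arrow (Hor D) (frame_cat D) (hframe D) (cframe D) \<alpha>"

definition opcartesian_cell :: "('o, 'v, 'h, 'c) dblcat \<Rightarrow> 'c \<Rightarrow> bool" where
  "opcartesian_cell D \<alpha> \<longleftrightarrow> opcartesian_arrow (Hor D) (frame_cat D) (hframe D) (cframe D) \<alpha>"

text \<open>
  \<open>is_extension D X l r p \<kappa>\<close>: the cell \<open>\<kappa> : Id X \<rightarrow> p\<close> exhibits \<open>p\<close> as the extension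
  \<open>l\<^sup>*r\<^sub>!\<close>, determined up to a unique invertible globular cell.
\<close>

definition is_extension ::
    "('o, 'v, 'h, 'c) dblcat \<Rightarrow> 'o \<Rightarrow> 'v \<Rightarrow> 'v \<Rightarrow> 'h \<Rightarrow> 'c \<Rightarrow> bool" where
  "is_extension D X l r p \<kappa> \<longleftrightarrow> cell D \<kappa> (hid D X) p l r \<and> opcartesian_cell D \<kappa>"


section \<open>The Beck-Chevalley condition and final arrows\<close>

text \<open>
  \<open>beck_chevalley D g f h k \<alpha>\<close> is for a cell \<open>\<alpha> : Id A \<rightarrow> Id B'\<close> framed by
  \<open>(g \<Zsemi> h, f \<Zsemi> k)\<close>, where \<open>A\<close> is the common domain of \<open>g, f\<close> and \<open>B'\<close> the common codomain
  of \<open>h, k\<close>; this framing is forced by the factorisation.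
\<close>

definition beck_chevalley ::
    "('o, 'v, 'h, 'c) dblcat \<Rightarrow> 'v \<Rightarrow> 'v \<Rightarrow> 'v \<Rightarrow> 'v \<Rightarrow> 'c \<Rightarrow> bool" where
  "beck_chevalley D g f h k \<alpha> \<longleftrightarrow>
     (\<exists>p \<beta> \<gamma>.
        cell D \<beta> (hid D (Dom (Ver D) g)) p g f \<and> opcartesian_cell D \<beta> \<and>
        cell D \<gamma> p (hid D (Cod (Ver D) h)) h k \<and> cartesian_cell D \<gamma> \<and>
        \<beta> \<Zsemi>\<^bsub>Hor D\<^esub> \<gamma> = \<alpha>)"

definition beck_chevalley_pullback ::
    "('o, 'v, 'h, 'c) dblcat \<Rightarrow> 'v \<Rightarrow> 'v \<Rightarrow> 'v \<Rightarrow> 'v \<Rightarrow> bool" where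
  "beck_chevalley_pullback D g f h k \<longleftrightarrow>
     is_pullback (Ver D) g f h k \<and>
     beck_chevalley D g f h k (cid D (g \<Zsemi>\<^bsub>Ver D\<^esub> h)) \<and>
     beck_chevalley D f g k h (cid D (f \<Zsemi>\<^bsub>Ver D\<^esub> k))"

definition has_beck_chevalley_pullbacks :: "('o, 'v, 'h, 'c) dblcat \<Rightarrow> bool" where
  "has_beck_chevalley_pullbacks D \<longleftrightarrow> has_pullbacks (Ver D) \<and>
     (\<forall>g f h k. is_pullback (Ver D) g f h k \<longrightarrow> beck_chevalley_pullback D g f h k)"

definition Fin :: "('o, 'v, 'h, 'c) dblcat \<Rightarrow> 'o \<Rightarrow> 'v set" where
  "Fin D one = {f \<in> Arr (Ver D).
     beck_chevalley D f (bang D one (Dom (Ver D) f)) (bang D one (Cod (Ver D) f)) (Ide (Ver D) one)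
       (THE \<alpha>. \<alpha> \<in> hom (Hor D) (hid D (Dom (Ver D) f)) (hid D one))}"


section \<open>Tabulators and left-sided comprehension schemes\<close>

definition is_tabulator ::
    "('o, 'v, 'h, 'c) dblcat \<Rightarrow> 'o \<Rightarrow> 'h \<Rightarrow> 'o \<Rightarrow> 'v \<Rightarrow> 'c \<Rightarrow> bool" where
  "is_tabulator D one p T l \<tau> \<longleftrightarrow>
     T \<in> Obj (Ver D) \<and> p \<in> Obj (Hor D) \<and> htgt D p = one \<and>
     cell D \<tau> (hid D T) p l (bang D one T) \<and>
     (\<forall>Z \<in> Obj (Ver D). \<forall>\<zeta> \<in> hom (Hor D) (hid D Z) p.
        \<exists>!u. u \<in> hom (Ver D) Z T \<and> cid D u \<Zsemi>\<^bsub>Hor D\<^esub> \<tau> = \<zeta>)"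

definition has_strong_tabulator ::
    "('o, 'v, 'h, 'c) dblcat \<Rightarrow> 'o \<Rightarrow> 'v set \<Rightarrow> 'h \<Rightarrow> bool" where
  "has_strong_tabulator D one M p \<longleftrightarrow>
     (\<exists>T l \<tau>. is_tabulator D one p T l \<tau> \<and> opcartesian_cell D \<tau> \<and> l \<in> M)"

definition left_sided_comprehension_scheme ::
    "('o, 'v, 'h, 'c) dblcat \<Rightarrow> 'o \<Rightarrow> 'v set \<Rightarrow> bool" where
  "left_sided_comprehension_scheme D one M \<longleftrightarrow>
     (\<forall>p \<in> Obj (Hor D). htgt D p = one \<longrightarrow> has_strong_tabulator D one M p) \<and>
     (\<forall>f \<in> M. \<forall>p \<kappa>. is_extension D (Dom (Ver D) f) f (bang D one (Dom (Ver D) f)) p \<kappa> \<longrightarrow>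
        is_tabulator D one p (Dom (Ver D) f) f \<kappa>)"

end

theory Submission
  imports Defs
begin

text \<open>
  Write \<open>P\<^sub>X\<close> for the companion of \<open>! : X \<rightarrow> 1\<close>, that is, the restriction of \<open>Id 1\<close> along \<open>(!, id)\<close>; cells
  into \<open>P\<^sub>X\<close> are determined by their frames.  An arrow \<open>f : A \<rightarrow> X\<close> is final iff \<open>Id f\<close> followed by
  the canonical cell \<open>Id X \<rightarrow> P\<^sub>X\<close> is opcartesian.

  Orthogonality: for \<open>m : X \<rightarrow> Y\<close> in \<open>M\<close> with extension \<open>p = m\<^sup>*!\<^sub>!\<close>, lifts of \<open>v : B \<rightarrow> Y\<close> through \<open>m\<close>
  are cells \<open>Id B \<rightarrow> p\<close> over \<open>(v, !)\<close>, hence cells \<open>P\<^sub>B \<rightarrow> p\<close> over \<open>(v, id)\<close>; if \<open>e : A \<rightarrow> B\<close> is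
  final these are also the cells \<open>Id A \<rightarrow> p\<close> over \<open>(e \<Zsemi> v, !)\<close>, i.e. the lifts of \<open>e \<Zsemi> v\<close>.

  Factorisation: \<open>f\<close> factors through the tabulator \<open>m : T \<rightarrow> X\<close> of \<open>f\<^sup>*!\<^sub>!\<close> by some \<open>e\<close>.  If \<open>s\<close>
  tabulates \<open>e\<^sup>*!\<^sub>!\<close>, then \<open>s \<Zsemi> m\<close> and \<open>m\<close> both tabulate \<open>f\<^sup>*!\<^sub>!\<close>, so \<open>s\<close> is invertible and \<open>e\<close> is final.

  Stability: in a pullback square \<open>g \<Zsemi> h = f \<Zsemi> k\<close> with \<open>h : B \<rightarrow> D\<close> final, the Beck-Chevalley condition
  yields an opcartesian cell \<open>Id A \<rightarrow> k\<^sub>! \<odot> h\<^sup>*\<close>; finality of \<open>h\<close> makes \<open>h\<^sup>* \<rightarrow> P\<^sub>D\<close> opcartesian, and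
  \<open>k\<^sub>! \<odot> P\<^sub>D\<close> is again the companion of \<open>!\<close>.
\<close>

section \<open>Isomorphisms\<close>

context category
begin

lemma homD:
  assumes "f \<in> hom C X Y"
  shows "f \<in> Arr C" "Dom C f = X" "Cod C f = Y" "X \<in> Obj C" "Y \<in> Obj C"
  using assms dom_obj cod_obj by (auto simp: hom_def)

lemma homI: "f \<in> Arr C \<Longrightarrow> f \<in> hom C (Dom C f) (Cod C f)"
  by (simp add: hom_def)

lemma isoI:
  assumes "f \<in> hom C X Y" "g \<in> hom C Y X" "f \<Zsemi> g = Ide C X" "g \<Zsemi> f = Ide C Y"
  shows "iso C f"
  using assms by (auto simp: iso_def hom_def)

lemma isoE:
  assumes "iso C f" "f \<in> hom C X Y"
  obtains g where "g \<in> hom C Y X" "f \<Zsemi> g = Ide C X" "g \<Zsemi> f = Ide C Y"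
  using assms by (auto simp: iso_def hom_def)

lemma iso_ide: "X \<in> Obj C \<Longrightarrow> iso C (Ide C X)"
  using ide_hom ide_left isoI by blast

lemma iso_inverse:
  assumes "f \<in> hom C X Y" "g \<in> hom C Y X" "f \<Zsemi> g = Ide C X" "g \<Zsemi> f = Ide C Y"
  shows "iso C g"
  using assms isoI by blast

lemma iso_comp:
  assumes "iso C f" "iso C g" "f \<in> hom C X Y" "g \<in> hom C Y Z"
  shows "iso C (f \<Zsemi> g)"
proof -
  obtain f' where f': "f' \<in> hom C Y X" "f \<Zsemi> f' = Ide C X" "f' \<Zsemi> f = Ide C Y"
    using isoE assms by blast
  obtain g' where g': "g' \<in> hom C Z Y" "g \<Zsemi> g' = Ide C Y" "g' \<Zsemi> g = Ide C Z"
    using isoE assms by blast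
  have "(f \<Zsemi> g) \<Zsemi> (g' \<Zsemi> f') = f \<Zsemi> ((g \<Zsemi> g') \<Zsemi> f')"
    using comp_assoc[OF assms(3,4) comp_hom[OF g'(1) f'(1)]] comp_assoc[OF assms(4) g'(1) f'(1)]
    by simp
  moreover have "(g' \<Zsemi> f') \<Zsemi> (f \<Zsemi> g) = g' \<Zsemi> ((f' \<Zsemi> f) \<Zsemi> g)"
    using comp_assoc[OF g'(1) f'(1) comp_hom[OF assms(3,4)]] comp_assoc[OF f'(1) assms(3,4)]
    by simp
  ultimately show ?thesis
    using assms(3,4) f' g' ide_left comp_hom by (intro isoI[of _ X Z "g' \<Zsemi> f'"]) auto
qed

lemma iso_epi:
  assumes "iso C f" "f \<in> hom C X Y" "g \<in> hom C Y Z" "h \<in> hom C Y Z" "f \<Zsemi> g = f \<Zsemi> h"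
  shows "g = h"
proof -
  obtain f' where f': "f' \<in> hom C Y X" "f' \<Zsemi> f = Ide C Y"
    using isoE assms by blast
  have "g = f' \<Zsemi> (f \<Zsemi> g)" "h = f' \<Zsemi> (f \<Zsemi> h)"
    using comp_assoc[OF f'(1) assms(2,3)] comp_assoc[OF f'(1) assms(2,4)] f'(2)
      ide_left[OF assms(3)] ide_left[OF assms(4)] by simp_all
  then show ?thesis using assms(5) by simp
qed

lemma iso_mono:
  assumes "iso C f" "f \<in> hom C X Y" "g \<in> hom C Z X" "h \<in> hom C Z X" "g \<Zsemi> f = h \<Zsemi> f"
  shows "g = h"
proof -
  obtain f' where f': "f' \<in> hom C Y X" "f \<Zsemi> f' = Ide C X"
    using isoE assms by blast
  have "g = (g \<Zsemi> f) \<Zsemi> f'" "h = (h \<Zsemi> f) \<Zsemi> f'"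
    using comp_assoc[OF assms(3,2) f'(1)] comp_assoc[OF assms(4,2) f'(1)] f'(2)
      ide_right[OF assms(3)] ide_right[OF assms(4)] by simp_all
  then show ?thesis using assms(5) by simp
qed

end

lemma functor_iso:
  assumes "is_functor B C Fo Fa" "category B" "iso B f"
  shows "iso C (Fa f)"
proof -
  interpret F: is_functor B C Fo Fa by fact
  interpret B: category B by fact
  let ?X = "Dom B f" and ?Y = "Cod B f"
  have f: "f \<in> hom B ?X ?Y" using assms(3) by (simp add: iso_def hom_def)
  obtain g where g: "g \<in> hom B ?Y ?X" "f \<Zsemi>\<^bsub>B\<^esub> g = Ide B ?X" "g \<Zsemi>\<^bsub>B\<^esub> f = Ide B ?Y"
    using B.isoE[OF assms(3) f] .
  have "Fa f \<Zsemi>\<^bsub>C\<^esub> Fa g = Ide C (Fo ?X)" "Fa g \<Zsemi>\<^bsub>C\<^esub> Fa f = Ide C (Fo ?Y)"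
    using F.map_comp[OF f g(1)] F.map_comp[OF g(1) f] g F.map_ide B.homD[OF f] by auto
  then show ?thesis
    using F.map_hom[OF f] F.map_hom[OF g(1)] by (auto simp: iso_def hom_def)
qed

section \<open>Cartesian and opcartesian arrows\<close>

locale functor_between = is_functor E B Po Pa + E: category E + B: category B
  for E :: "('o1, 'a1) cat" and B :: "('o2, 'a2) cat" and Po Pa
begin

abbreviation "cart \<equiv> cartesian_arrow E B Po Pa"
abbreviation "opcart \<equiv> opcartesian_arrow E B Po Pa"

lemma opcart_lift:
  assumes "opcart \<phi>" "\<phi> \<in> hom E a b" "\<psi> \<in> hom E a c" "w \<in> hom B (Po b) (Po c)"
    "Pa \<phi> \<Zsemi>\<^bsub>B\<^esub> w = Pa \<psi>"
  shows "\<exists>!\<chi>. \<chi> \<in> hom E b c \<and> Pa \<chi> = w \<and> \<phi> \<Zsemi>\<^bsub>E\<^esub> \<chi> = \<psi>"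
  using assms(1)[unfolded opcartesian_arrow_def, THEN conjunct2, rule_format, of \<psi> w]
    E.homD[OF assms(2)] E.homD[OF assms(3)] assms(4,5) by simp

lemma opcartI:
  assumes "\<phi> \<in> hom E a b"
    and "\<And>c \<psi> w. \<lbrakk>\<psi> \<in> hom E a c; w \<in> hom B (Po b) (Po c); Pa \<phi> \<Zsemi>\<^bsub>B\<^esub> w = Pa \<psi>\<rbrakk>
      \<Longrightarrow> \<exists>!\<chi>. \<chi> \<in> hom E b c \<and> Pa \<chi> = w \<and> \<phi> \<Zsemi>\<^bsub>E\<^esub> \<chi> = \<psi>"
  shows "opcart \<phi>"
  using assms unfolding opcartesian_arrow_def by (auto simp: hom_def)

lemma cart_lift:
  assumes "cart \<phi>" "\<phi> \<in> hom E b c" "\<psi> \<in> hom E a c" "w \<in> hom B (Po a) (Po b)"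
    "w \<Zsemi>\<^bsub>B\<^esub> Pa \<phi> = Pa \<psi>"
  shows "\<exists>!\<chi>. \<chi> \<in> hom E a b \<and> Pa \<chi> = w \<and> \<chi> \<Zsemi>\<^bsub>E\<^esub> \<phi> = \<psi>"
  using assms(1)[unfolded cartesian_arrow_def, THEN conjunct2, rule_format, of \<psi> w]
    E.homD[OF assms(2)] E.homD[OF assms(3)] assms(4,5) by simp

lemma cartI:
  assumes "\<phi> \<in> hom E b c"
    and "\<And>a \<psi> w. \<lbrakk>\<psi> \<in> hom E a c; w \<in> hom B (Po a) (Po b); w \<Zsemi>\<^bsub>B\<^esub> Pa \<phi> = Pa \<psi>\<rbrakk>
      \<Longrightarrow> \<exists>!\<chi>. \<chi> \<in> hom E a b \<and> Pa \<chi> = w \<and> \<chi> \<Zsemi>\<^bsub>E\<^esub> \<phi> = \<psi>"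
  shows "cart \<phi>"
  using assms unfolding cartesian_arrow_def by (auto simp: hom_def)

text \<open>Lifts are taken first through \<phi> and then through \<phi>'. For uniqueness, \<phi>'
  followed by a competitor is itself a lift through \<phi>, hence equal to the first lift, and
  uniqueness for \<phi>' finishes.\<close>

lemma opcart_comp:
  assumes "opcart \<phi>" "opcart \<phi>'" "\<phi> \<in> hom E a b" "\<phi>' \<in> hom E b c"
  shows "opcart (\<phi> \<Zsemi>\<^bsub>E\<^esub> \<phi>')"
proof (rule opcartI)
  show "\<phi> \<Zsemi>\<^bsub>E\<^esub> \<phi>' \<in> hom E a c" using assms E.comp_hom by blast
next
  fix d \<psi> w
  assume *: "\<psi> \<in> hom E a d" "w \<in> hom B (Po c) (Po d)" "Pa (\<phi> \<Zsemi>\<^bsub>E\<^esub> \<phi>') \<Zsemi>\<^bsub>B\<^esub> w = Pa \<psi>"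
  have w': "Pa \<phi>' \<Zsemi>\<^bsub>B\<^esub> w \<in> hom B (Po b) (Po d)"
    using B.comp_hom *(2) map_hom assms(4) by blast
  have eq: "Pa \<phi> \<Zsemi>\<^bsub>B\<^esub> (Pa \<phi>' \<Zsemi>\<^bsub>B\<^esub> w) = Pa \<psi>"
    using B.comp_assoc[OF map_hom[OF assms(3)] map_hom[OF assms(4)] *(2)] *(3) map_comp[OF assms(3,4)]
    by simp
  note l1 = opcart_lift[OF assms(1,3) *(1) w' eq]
  then obtain \<chi> where \<chi>: "\<chi> \<in> hom E b d" "Pa \<chi> = Pa \<phi>' \<Zsemi>\<^bsub>B\<^esub> w" "\<phi> \<Zsemi>\<^bsub>E\<^esub> \<chi> = \<psi>" by blast
  note l2 = opcart_lift[OF assms(2,4) \<chi>(1) *(2) \<chi>(2)[symmetric]]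
  show "\<exists>!\<chi>. \<chi> \<in> hom E c d \<and> Pa \<chi> = w \<and> \<phi> \<Zsemi>\<^bsub>E\<^esub> \<phi>' \<Zsemi>\<^bsub>E\<^esub> \<chi> = \<psi>"
  proof (rule ex_ex1I)
    show "\<exists>\<chi>. \<chi> \<in> hom E c d \<and> Pa \<chi> = w \<and> \<phi> \<Zsemi>\<^bsub>E\<^esub> \<phi>' \<Zsemi>\<^bsub>E\<^esub> \<chi> = \<psi>"
      using l2 \<chi>(3) E.comp_assoc[OF assms(3,4)] by metis
  next
    have "\<phi>' \<Zsemi>\<^bsub>E\<^esub> \<xi> = \<chi>" if "\<xi> \<in> hom E c d" "Pa \<xi> = w" "\<phi> \<Zsemi>\<^bsub>E\<^esub> \<phi>' \<Zsemi>\<^bsub>E\<^esub> \<xi> = \<psi>" for \<xi>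
    proof -
      have "\<phi>' \<Zsemi>\<^bsub>E\<^esub> \<xi> \<in> hom E b d" "Pa (\<phi>' \<Zsemi>\<^bsub>E\<^esub> \<xi>) = Pa \<phi>' \<Zsemi>\<^bsub>B\<^esub> w" "\<phi> \<Zsemi>\<^bsub>E\<^esub> (\<phi>' \<Zsemi>\<^bsub>E\<^esub> \<xi>) = \<psi>"
        using that assms(3,4) E.comp_hom map_comp E.comp_assoc[OF assms(3,4)] by auto
      then show ?thesis using l1 \<chi> by blast
    qed
    then show "\<xi> = \<xi>'" if "\<xi> \<in> hom E c d \<and> Pa \<xi> = w \<and> \<phi> \<Zsemi>\<^bsub>E\<^esub> \<phi>' \<Zsemi>\<^bsub>E\<^esub> \<xi> = \<psi>"
      "\<xi>' \<in> hom E c d \<and> Pa \<xi>' = w \<and> \<phi> \<Zsemi>\<^bsub>E\<^esub> \<phi>' \<Zsemi>\<^bsub>E\<^esub> \<xi>' = \<psi>" for \<xi> \<xi>'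
      using that l2 by metis
  qed
qed

text \<open>The lift is taken through the composite. It solves the problem for \<phi>' because
  precomposition with the opcartesian \<phi> is injective on arrows over a fixed base arrow.\<close>

lemma opcart_cancel:
  assumes "opcart \<phi>" "opcart (\<phi> \<Zsemi>\<^bsub>E\<^esub> \<phi>')" "\<phi> \<in> hom E a b" "\<phi>' \<in> hom E b c"
  shows "opcart \<phi>'"
proof (rule opcartI[OF assms(4)])
  fix d \<psi> w
  assume *: "\<psi> \<in> hom E b d" "w \<in> hom B (Po c) (Po d)" "Pa \<phi>' \<Zsemi>\<^bsub>B\<^esub> w = Pa \<psi>"
  have h: "\<phi> \<Zsemi>\<^bsub>E\<^esub> \<phi>' \<in> hom E a c" "\<phi> \<Zsemi>\<^bsub>E\<^esub> \<psi> \<in> hom E a d"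
    using assms(3,4) *(1) E.comp_hom by auto
  have eq: "Pa (\<phi> \<Zsemi>\<^bsub>E\<^esub> \<phi>') \<Zsemi>\<^bsub>B\<^esub> w = Pa (\<phi> \<Zsemi>\<^bsub>E\<^esub> \<psi>)"
    using B.comp_assoc[OF map_hom[OF assms(3)] map_hom[OF assms(4)] *(2)] *(3)
      map_comp[OF assms(3,4)] map_comp[OF assms(3) *(1)] by simp
  note l1 = opcart_lift[OF assms(2) h *(2) eq]
  have w: "Pa \<psi> \<in> hom B (Po b) (Po d)" using * map_hom by blast
  have "Pa \<phi> \<Zsemi>\<^bsub>B\<^esub> Pa \<psi> = Pa (\<phi> \<Zsemi>\<^bsub>E\<^esub> \<psi>)" using map_comp assms(3) *(1) by simp
  note l2 = opcart_lift[OF assms(1,3) h(2) w this]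
  show "\<exists>!\<chi>. \<chi> \<in> hom E c d \<and> Pa \<chi> = w \<and> \<phi>' \<Zsemi>\<^bsub>E\<^esub> \<chi> = \<psi>"
  proof (rule ex_ex1I)
    obtain \<chi> where \<chi>: "\<chi> \<in> hom E c d" "Pa \<chi> = w" "\<phi> \<Zsemi>\<^bsub>E\<^esub> \<phi>' \<Zsemi>\<^bsub>E\<^esub> \<chi> = \<phi> \<Zsemi>\<^bsub>E\<^esub> \<psi>"
      using l1 by blast
    have "\<phi>' \<Zsemi>\<^bsub>E\<^esub> \<chi> \<in> hom E b d" "Pa (\<phi>' \<Zsemi>\<^bsub>E\<^esub> \<chi>) = Pa \<psi>" "\<phi> \<Zsemi>\<^bsub>E\<^esub> (\<phi>' \<Zsemi>\<^bsub>E\<^esub> \<chi>) = \<phi> \<Zsemi>\<^bsub>E\<^esub> \<psi>"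
      using \<chi> assms(3,4) *(3) E.comp_hom map_comp E.comp_assoc[OF assms(3,4)] by auto
    then have "\<phi>' \<Zsemi>\<^bsub>E\<^esub> \<chi> = \<psi>" using l2 *(1) by blast
    then show "\<exists>\<chi>. \<chi> \<in> hom E c d \<and> Pa \<chi> = w \<and> \<phi>' \<Zsemi>\<^bsub>E\<^esub> \<chi> = \<psi>" using \<chi> by blast
  next
    show "\<xi> = \<xi>'" if "\<xi> \<in> hom E c d \<and> Pa \<xi> = w \<and> \<phi>' \<Zsemi>\<^bsub>E\<^esub> \<xi> = \<psi>"
      "\<xi>' \<in> hom E c d \<and> Pa \<xi>' = w \<and> \<phi>' \<Zsemi>\<^bsub>E\<^esub> \<xi>' = \<psi>" for \<xi> \<xi>'
      using that l1 E.comp_assoc[OF assms(3,4)] by metis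
  qed
qed

lemma opcart_iso:
  assumes "iso E \<phi>"
  shows "opcart \<phi>"
proof -
  define a b where "a = Dom E \<phi>" and "b = Cod E \<phi>"
  have \<phi>: "\<phi> \<in> hom E a b" using assms by (simp add: a_def b_def iso_def hom_def)
  obtain g where g: "g \<in> hom E b a" "\<phi> \<Zsemi>\<^bsub>E\<^esub> g = Ide E a" "g \<Zsemi>\<^bsub>E\<^esub> \<phi> = Ide E b"
    using E.isoE[OF assms \<phi>] .
  have Pg: "Pa g \<Zsemi>\<^bsub>B\<^esub> Pa \<phi> = Ide B (Po b)"
    using map_comp[OF g(1) \<phi>] g(3) map_ide E.homD[OF \<phi>] by metis
  show ?thesis
  proof (rule opcartI[OF \<phi>])
    fix d \<psi> w
    assume *: "\<psi> \<in> hom E a d" "w \<in> hom B (Po b) (Po d)" "Pa \<phi> \<Zsemi>\<^bsub>B\<^esub> w = Pa \<psi>"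
    show "\<exists>!\<chi>. \<chi> \<in> hom E b d \<and> Pa \<chi> = w \<and> \<phi> \<Zsemi>\<^bsub>E\<^esub> \<chi> = \<psi>"
    proof (rule ex1I[of _ "g \<Zsemi>\<^bsub>E\<^esub> \<psi>"], intro conjI)
      show "g \<Zsemi>\<^bsub>E\<^esub> \<psi> \<in> hom E b d" using g(1) *(1) E.comp_hom by blast
      have "Pa (g \<Zsemi>\<^bsub>E\<^esub> \<psi>) = Pa g \<Zsemi>\<^bsub>B\<^esub> (Pa \<phi> \<Zsemi>\<^bsub>B\<^esub> w)" using *(1,3) g(1) map_comp by simp
      also have "\<dots> = w"
        using B.comp_assoc[OF map_hom[OF g(1)] map_hom[OF \<phi>] *(2)] Pg B.ide_left[OF *(2)] by simp
      finally show "Pa (g \<Zsemi>\<^bsub>E\<^esub> \<psi>) = w" .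
      show "\<phi> \<Zsemi>\<^bsub>E\<^esub> (g \<Zsemi>\<^bsub>E\<^esub> \<psi>) = \<psi>"
        using E.comp_assoc[OF \<phi> g(1) *(1)] g(2) E.ide_left[OF *(1)] by simp
      show "\<chi> = g \<Zsemi>\<^bsub>E\<^esub> \<psi>" if "\<chi> \<in> hom E b d \<and> Pa \<chi> = w \<and> \<phi> \<Zsemi>\<^bsub>E\<^esub> \<chi> = \<psi>" for \<chi>
        using that E.comp_assoc[OF g(1) \<phi>] g(3) E.ide_left by metis
    qed
  qed
qed

lemma cart_comp:
  assumes "cart \<phi>" "cart \<phi>'" "\<phi> \<in> hom E a b" "\<phi>' \<in> hom E b c"
  shows "cart (\<phi> \<Zsemi>\<^bsub>E\<^esub> \<phi>')"
proof (rule cartI)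
  show \<phi>\<phi>': "\<phi> \<Zsemi>\<^bsub>E\<^esub> \<phi>' \<in> hom E a c" using assms E.comp_hom by blast
  fix d \<psi> w
  assume *: "\<psi> \<in> hom E d c" "w \<in> hom B (Po d) (Po a)" "w \<Zsemi>\<^bsub>B\<^esub> Pa (\<phi> \<Zsemi>\<^bsub>E\<^esub> \<phi>') = Pa \<psi>"
  have w': "w \<Zsemi>\<^bsub>B\<^esub> Pa \<phi> \<in> hom B (Po d) (Po b)"
    using B.comp_hom *(2) map_hom assms(3) by blast
  have eq: "(w \<Zsemi>\<^bsub>B\<^esub> Pa \<phi>) \<Zsemi>\<^bsub>B\<^esub> Pa \<phi>' = Pa \<psi>"
    using B.comp_assoc[OF *(2) map_hom[OF assms(3)] map_hom[OF assms(4)]] *(3) map_comp[OF assms(3,4)]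
    by simp
  note l1 = cart_lift[OF assms(2,4) *(1) w' eq]
  then obtain \<chi> where \<chi>: "\<chi> \<in> hom E d b" "Pa \<chi> = w \<Zsemi>\<^bsub>B\<^esub> Pa \<phi>" "\<chi> \<Zsemi>\<^bsub>E\<^esub> \<phi>' = \<psi>" by blast
  note l2 = cart_lift[OF assms(1,3) \<chi>(1) *(2) \<chi>(2)[symmetric]]
  show "\<exists>!\<chi>. \<chi> \<in> hom E d a \<and> Pa \<chi> = w \<and> \<chi> \<Zsemi>\<^bsub>E\<^esub> (\<phi> \<Zsemi>\<^bsub>E\<^esub> \<phi>') = \<psi>"
  proof (rule ex_ex1I)
    show "\<exists>\<chi>. \<chi> \<in> hom E d a \<and> Pa \<chi> = w \<and> \<chi> \<Zsemi>\<^bsub>E\<^esub> (\<phi> \<Zsemi>\<^bsub>E\<^esub> \<phi>') = \<psi>"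
      using l2 \<chi>(3) E.comp_assoc[OF _ assms(3,4)] by metis
  next
    have "\<xi> \<Zsemi>\<^bsub>E\<^esub> \<phi> = \<chi>" if "\<xi> \<in> hom E d a" "Pa \<xi> = w" "\<xi> \<Zsemi>\<^bsub>E\<^esub> (\<phi> \<Zsemi>\<^bsub>E\<^esub> \<phi>') = \<psi>" for \<xi>
    proof -
      have "\<xi> \<Zsemi>\<^bsub>E\<^esub> \<phi> \<in> hom E d b" "Pa (\<xi> \<Zsemi>\<^bsub>E\<^esub> \<phi>) = w \<Zsemi>\<^bsub>B\<^esub> Pa \<phi>" "(\<xi> \<Zsemi>\<^bsub>E\<^esub> \<phi>) \<Zsemi>\<^bsub>E\<^esub> \<phi>' = \<psi>"
        using that assms(3,4) E.comp_hom map_comp E.comp_assoc[OF _ assms(3,4)] by auto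
      then show ?thesis using l1 \<chi> by blast
    qed
    then show "\<xi> = \<xi>'" if "\<xi> \<in> hom E d a \<and> Pa \<xi> = w \<and> \<xi> \<Zsemi>\<^bsub>E\<^esub> (\<phi> \<Zsemi>\<^bsub>E\<^esub> \<phi>') = \<psi>"
      "\<xi>' \<in> hom E d a \<and> Pa \<xi>' = w \<and> \<xi>' \<Zsemi>\<^bsub>E\<^esub> (\<phi> \<Zsemi>\<^bsub>E\<^esub> \<phi>') = \<psi>" for \<xi> \<xi>'
      using that l2 by metis
  qed
qed

lemma cart_iso:
  assumes "iso E \<phi>"
  shows "cart \<phi>"
proof -
  define a b where "a = Dom E \<phi>" and "b = Cod E \<phi>"
  have \<phi>: "\<phi> \<in> hom E a b" using assms by (simp add: a_def b_def iso_def hom_def)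
  obtain g where g: "g \<in> hom E b a" "\<phi> \<Zsemi>\<^bsub>E\<^esub> g = Ide E a" "g \<Zsemi>\<^bsub>E\<^esub> \<phi> = Ide E b"
    using E.isoE[OF assms \<phi>] .
  have Pg: "Pa \<phi> \<Zsemi>\<^bsub>B\<^esub> Pa g = Ide B (Po a)"
    using map_comp[OF \<phi> g(1)] g(2) map_ide E.homD[OF \<phi>] by metis
  show ?thesis
  proof (rule cartI[OF \<phi>])
    fix d \<psi> w
    assume *: "\<psi> \<in> hom E d b" "w \<in> hom B (Po d) (Po a)" "w \<Zsemi>\<^bsub>B\<^esub> Pa \<phi> = Pa \<psi>"
    show "\<exists>!\<chi>. \<chi> \<in> hom E d a \<and> Pa \<chi> = w \<and> \<chi> \<Zsemi>\<^bsub>E\<^esub> \<phi> = \<psi>"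
    proof (rule ex1I[of _ "\<psi> \<Zsemi>\<^bsub>E\<^esub> g"], intro conjI)
      show "\<psi> \<Zsemi>\<^bsub>E\<^esub> g \<in> hom E d a" using g(1) *(1) E.comp_hom by blast
      have "Pa (\<psi> \<Zsemi>\<^bsub>E\<^esub> g) = (w \<Zsemi>\<^bsub>B\<^esub> Pa \<phi>) \<Zsemi>\<^bsub>B\<^esub> Pa g" using *(1,3) g(1) map_comp by simp
      also have "\<dots> = w"
        using B.comp_assoc[OF *(2) map_hom[OF \<phi>] map_hom[OF g(1)]] Pg B.ide_right[OF *(2)] by simp
      finally show "Pa (\<psi> \<Zsemi>\<^bsub>E\<^esub> g) = w" .
      show "(\<psi> \<Zsemi>\<^bsub>E\<^esub> g) \<Zsemi>\<^bsub>E\<^esub> \<phi> = \<psi>"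
        using E.comp_assoc[OF *(1) g(1) \<phi>] g(3) E.ide_right[OF *(1)] by simp
      show "\<chi> = \<psi> \<Zsemi>\<^bsub>E\<^esub> g" if "\<chi> \<in> hom E d a \<and> Pa \<chi> = w \<and> \<chi> \<Zsemi>\<^bsub>E\<^esub> \<phi> = \<psi>" for \<chi>
        using that E.comp_assoc[OF _ \<phi> g(1)] g(2) E.ide_right by metis
    qed
  qed
qed

text \<open>Each arrow is lifted through the other over the identity. The two round trips and the
  identities are lifts of the same arrow over the same base arrow, so they coincide. The premise
  \<open>Po a = Po b\<close> lets an identity serve as base arrow between a and b.\<close>

lemma cart_unique_iso:
  assumes "cart \<phi>" "cart \<psi>" "\<phi> \<in> hom E a c" "\<psi> \<in> hom E b c" "Pa \<phi> = Pa \<psi>" "Po a = Po b"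
  shows "\<exists>\<theta> \<in> hom E a b. iso E \<theta> \<and> Pa \<theta> = Ide B (Po a) \<and> \<theta> \<Zsemi>\<^bsub>E\<^esub> \<psi> = \<phi>"
proof -
  have I: "Ide B (Po a) \<in> hom B (Po a) (Po a)"
    using B.ide_hom map_obj E.homD(4)[OF assms(3)] by blast
  have i: "Ide B (Po a) \<Zsemi>\<^bsub>B\<^esub> Pa \<phi> = Pa \<phi>" "Ide B (Po a) \<Zsemi>\<^bsub>B\<^esub> Ide B (Po a) = Ide B (Po a)"
    using B.ide_left map_hom[OF assms(3)] I by auto
  note lift_I = cart_lift[where w = "Ide B (Po a)"]
  obtain \<theta> where \<theta>: "\<theta> \<in> hom E a b" "Pa \<theta> = Ide B (Po a)" "\<theta> \<Zsemi>\<^bsub>E\<^esub> \<psi> = \<phi>"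
    using lift_I[OF assms(2,4,3)] I i assms by auto
  obtain \<theta>' where \<theta>': "\<theta>' \<in> hom E b a" "Pa \<theta>' = Ide B (Po a)" "\<theta>' \<Zsemi>\<^bsub>E\<^esub> \<phi> = \<psi>"
    using lift_I[OF assms(1,3,4)] I i assms by auto
  have id1: "\<theta> \<Zsemi>\<^bsub>E\<^esub> \<theta>' = Ide E a"
  proof -
    have "\<theta> \<Zsemi>\<^bsub>E\<^esub> \<theta>' \<in> hom E a a" "Pa (\<theta> \<Zsemi>\<^bsub>E\<^esub> \<theta>') = Ide B (Po a)" "(\<theta> \<Zsemi>\<^bsub>E\<^esub> \<theta>') \<Zsemi>\<^bsub>E\<^esub> \<phi> = \<phi>"
      using \<theta> \<theta>' E.comp_hom map_comp i E.comp_assoc[OF \<theta>(1) \<theta>'(1) assms(3)] by auto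
    moreover have "Ide E a \<in> hom E a a" "Pa (Ide E a) = Ide B (Po a)" "Ide E a \<Zsemi>\<^bsub>E\<^esub> \<phi> = \<phi>"
      using E.ide_hom map_ide E.ide_left E.homD[OF assms(3)] assms(3) by auto
    ultimately show ?thesis using lift_I[OF assms(1,3,3)] I i by blast
  qed
  have id2: "\<theta>' \<Zsemi>\<^bsub>E\<^esub> \<theta> = Ide E b"
  proof -
    have "\<theta>' \<Zsemi>\<^bsub>E\<^esub> \<theta> \<in> hom E b b" "Pa (\<theta>' \<Zsemi>\<^bsub>E\<^esub> \<theta>) = Ide B (Po a)" "(\<theta>' \<Zsemi>\<^bsub>E\<^esub> \<theta>) \<Zsemi>\<^bsub>E\<^esub> \<psi> = \<psi>"
      using \<theta> \<theta>' E.comp_hom map_comp i E.comp_assoc[OF \<theta>'(1) \<theta>(1) assms(4)] by auto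
    moreover have "Ide E b \<in> hom E b b" "Pa (Ide E b) = Ide B (Po a)" "Ide E b \<Zsemi>\<^bsub>E\<^esub> \<psi> = \<psi>"
      using E.ide_hom map_ide E.ide_left E.homD[OF assms(4)] assms(4,6) by auto
    ultimately show ?thesis using lift_I[OF assms(2,4,4)] I i assms(5,6) by auto
  qed
  show ?thesis using \<theta> \<theta>' id1 id2 E.isoI by blast
qed

lemma opcart_unique_iso:
  assumes "opcart \<phi>" "opcart \<psi>" "\<phi> \<in> hom E a b" "\<psi> \<in> hom E a c" "Pa \<phi> = Pa \<psi>" "Po b = Po c"
  shows "\<exists>\<theta> \<in> hom E b c. iso E \<theta> \<and> Pa \<theta> = Ide B (Po b) \<and> \<phi> \<Zsemi>\<^bsub>E\<^esub> \<theta> = \<psi>"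
proof -
  have I: "Ide B (Po b) \<in> hom B (Po b) (Po b)"
    using B.ide_hom map_obj E.homD(5)[OF assms(3)] by blast
  have i: "Pa \<phi> \<Zsemi>\<^bsub>B\<^esub> Ide B (Po b) = Pa \<phi>" "Ide B (Po b) \<Zsemi>\<^bsub>B\<^esub> Ide B (Po b) = Ide B (Po b)"
    using B.ide_right map_hom[OF assms(3)] I by auto
  note lift_I = opcart_lift[where w = "Ide B (Po b)"]
  obtain \<theta> where \<theta>: "\<theta> \<in> hom E b c" "Pa \<theta> = Ide B (Po b)" "\<phi> \<Zsemi>\<^bsub>E\<^esub> \<theta> = \<psi>"
    using lift_I[OF assms(1,3,4)] I i assms by auto
  obtain \<theta>' where \<theta>': "\<theta>' \<in> hom E c b" "Pa \<theta>' = Ide B (Po b)" "\<psi> \<Zsemi>\<^bsub>E\<^esub> \<theta>' = \<phi>"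
    using lift_I[OF assms(2,4,3)] I i assms by auto
  have id1: "\<theta> \<Zsemi>\<^bsub>E\<^esub> \<theta>' = Ide E b"
  proof -
    have "\<theta> \<Zsemi>\<^bsub>E\<^esub> \<theta>' \<in> hom E b b" "Pa (\<theta> \<Zsemi>\<^bsub>E\<^esub> \<theta>') = Ide B (Po b)" "\<phi> \<Zsemi>\<^bsub>E\<^esub> (\<theta> \<Zsemi>\<^bsub>E\<^esub> \<theta>') = \<phi>"
      using \<theta> \<theta>' E.comp_hom map_comp i E.comp_assoc[OF assms(3) \<theta>(1) \<theta>'(1)] by auto
    moreover have "Ide E b \<in> hom E b b" "Pa (Ide E b) = Ide B (Po b)" "\<phi> \<Zsemi>\<^bsub>E\<^esub> Ide E b = \<phi>"
      using E.ide_hom map_ide E.ide_right E.homD[OF assms(3)] assms(3) by auto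
    ultimately show ?thesis using lift_I[OF assms(1,3,3)] I i by blast
  qed
  have id2: "\<theta>' \<Zsemi>\<^bsub>E\<^esub> \<theta> = Ide E c"
  proof -
    have "\<theta>' \<Zsemi>\<^bsub>E\<^esub> \<theta> \<in> hom E c c" "Pa (\<theta>' \<Zsemi>\<^bsub>E\<^esub> \<theta>) = Ide B (Po b)" "\<psi> \<Zsemi>\<^bsub>E\<^esub> (\<theta>' \<Zsemi>\<^bsub>E\<^esub> \<theta>) = \<psi>"
      using \<theta> \<theta>' E.comp_hom map_comp i E.comp_assoc[OF assms(4) \<theta>'(1) \<theta>(1)] by auto
    moreover have "Ide E c \<in> hom E c c" "Pa (Ide E c) = Ide B (Po b)" "\<psi> \<Zsemi>\<^bsub>E\<^esub> Ide E c = \<psi>"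
      using E.ide_hom map_ide E.ide_right E.homD[OF assms(4)] assms(4,6) by auto
    ultimately show ?thesis using lift_I[OF assms(2,4,4)] I i assms(5,6) by auto
  qed
  show ?thesis using \<theta> \<theta>' id1 id2 E.isoI by blast
qed

end

section \<open>Cells of a double category\<close>

lemma hom_prod_cat:
  "(f, g) \<in> hom (prod_cat B C) (X, X') (Y, Y') \<longleftrightarrow> f \<in> hom B X Y \<and> g \<in> hom C X' Y'"
  by (auto simp: hom_def prod_cat_def)

lemma Comp_prod_cat: "(f, g) \<Zsemi>\<^bsub>prod_cat B C\<^esub> (f', g') = (f \<Zsemi>\<^bsub>B\<^esub> f', g \<Zsemi>\<^bsub>C\<^esub> g')"
  by (simp add: prod_cat_def)

lemma Ide_prod_cat: "Ide (prod_cat B C) (X, Y) = (Ide B X, Ide C Y)"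
  by (simp add: prod_cat_def)

lemma category_prod_cat:
  assumes "category B" "category C"
  shows "category (prod_cat B C)"
proof -
  interpret B: category B by fact
  interpret C: category C by fact
  show ?thesis
    using B.dom_obj B.cod_obj B.ide_hom B.comp_hom B.ide_left B.ide_right B.comp_assoc
      C.dom_obj C.cod_obj C.ide_hom C.comp_hom C.ide_left C.ide_right C.comp_assoc
    by unfold_locales (auto simp: prod_cat_def hom_def)
qed

section \<open>The frame functor of a double category\<close>

context double_category
begin

abbreviation vcomp (infixl "\<cdot>" 70) where "f \<cdot> g \<equiv> f \<Zsemi>\<^bsub>Ver D\<^esub> g"
abbreviation cellcomp (infixl "\<bullet>" 70) where "\<alpha> \<bullet> \<beta> \<equiv> \<alpha> \<Zsemi>\<^bsub>Hor D\<^esub> \<beta>"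
abbreviation "vid \<equiv> Ide (Ver D)"
abbreviation "Hid \<equiv> Ide (Hor D)"
abbreviation "vhom \<equiv> hom (Ver D)"

sublocale V: category "Ver D" by (rule category_Ver)
sublocale H: category "Hor D" by (rule category_Hor)
sublocale src: is_functor "Hor D" "Ver D" "hsrc D" "csrc D" by (rule functor_src)
sublocale tgt: is_functor "Hor D" "Ver D" "htgt D" "ctgt D" by (rule functor_tgt)
sublocale idf: is_functor "Ver D" "Hor D" "hid D" "cid D" by (rule functor_id)
sublocale hcompf: is_functor "comp_pairs D" "Hor D" "\<lambda>(p, q). p \<odot> q" "\<lambda>(\<alpha>, \<beta>). \<alpha> \<otimes> \<beta>"
  by (rule functor_comp)

text \<open>(Op)cartesian cells are by definition the (op)cartesian arrows of this functor, so the
  general lemmas above become available for cells.\<close>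

sublocale fr: functor_between "Hor D" "frame_cat D" "hframe D" "cframe D"
proof -
  interpret F: category "frame_cat D" using category_prod_cat category_Ver by blast
  show "functor_between (Hor D) (frame_cat D) (hframe D) (cframe D)"
    by unfold_locales
      (auto simp: hom_prod_cat Comp_prod_cat Ide_prod_cat src.map_obj tgt.map_obj src.map_hom
        tgt.map_hom src.map_ide tgt.map_ide src.map_comp tgt.map_comp,
       auto simp: prod_cat_def src.map_obj tgt.map_obj)
qed

end

section \<open>Calculus of framed cells\<close>

context double_category
begin

lemma cellD:
  assumes "cell D \<alpha> p q f g"
  shows "\<alpha> \<in> hom (Hor D) p q" "csrc D \<alpha> = f" "ctgt D \<alpha> = g" "\<alpha> \<in> Arr (Hor D)"
    "p \<in> Obj (Hor D)" "q \<in> Obj (Hor D)"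
    "f \<in> vhom (hsrc D p) (hsrc D q)" "g \<in> vhom (htgt D p) (htgt D q)"
  using assms src.map_hom tgt.map_hom H.homD unfolding cell_def by auto

lemma cellI: "\<alpha> \<in> hom (Hor D) p q \<Longrightarrow> cell D \<alpha> p q (csrc D \<alpha>) (ctgt D \<alpha>)"
  by (simp add: cell_def)

lemma cframe_hom: "\<alpha> \<in> hom (Hor D) p q \<Longrightarrow> cframe D \<alpha> = (f, g) \<Longrightarrow> cell D \<alpha> p q f g"
  by (simp add: cell_def)

lemma cell_comp:
  assumes "cell D \<alpha> p q f g" "cell D \<beta> q r f' g'" "f \<cdot> f' = f''" "g \<cdot> g' = g''"
  shows "cell D (\<alpha> \<bullet> \<beta>) p r f'' g''"
  using assms H.comp_hom src.map_comp tgt.map_comp unfolding cell_def by auto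

lemma cell_Hid:
  assumes "p \<in> Obj (Hor D)"
  shows "cell D (Hid p) p p (vid (hsrc D p)) (vid (htgt D p))"
  using assms H.ide_hom src.map_ide tgt.map_ide unfolding cell_def by auto

lemma cell_cid:
  assumes "f \<in> vhom A B"
  shows "cell D (cid D f) (hid D A) (hid D B) f f"
  using assms idf.map_hom csrc_cid ctgt_cid V.homD unfolding cell_def by auto

lemma cid_vid: "A \<in> Obj (Ver D) \<Longrightarrow> cid D (vid A) = Hid (hid D A)"
  by (rule idf.map_ide)

lemma hid_obj: "A \<in> Obj (Ver D) \<Longrightarrow> hid D A \<in> Obj (Hor D)"
  by (rule idf.map_obj)

lemma cell_comp_assoc:
  assumes "cell D \<alpha> p q f g" "cell D \<beta> q r f' g'" "cell D \<gamma> r s f'' g''"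
  shows "(\<alpha> \<bullet> \<beta>) \<bullet> \<gamma> = \<alpha> \<bullet> (\<beta> \<bullet> \<gamma>)"
  using assms H.comp_assoc unfolding cell_def by blast

lemma cell_Hid_left: "cell D \<alpha> p q f g \<Longrightarrow> Hid p \<bullet> \<alpha> = \<alpha>"
  using H.ide_left unfolding cell_def by blast

lemma cell_Hid_right: "cell D \<alpha> p q f g \<Longrightarrow> \<alpha> \<bullet> Hid q = \<alpha>"
  using H.ide_right unfolding cell_def by blast

lemma vid_left_src: "cell D \<alpha> p q f g \<Longrightarrow> vid (hsrc D p) \<cdot> f = f"
  using V.ide_left cellD(7) by blast

lemma vid_left_tgt: "cell D \<alpha> p q f g \<Longrightarrow> vid (htgt D p) \<cdot> g = g"
  using V.ide_left cellD(8) by blast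

lemma vid_right_src: "cell D \<alpha> p q f g \<Longrightarrow> f \<cdot> vid (hsrc D q) = f"
  using V.ide_right cellD(7) by blast

lemma vid_right_tgt: "cell D \<alpha> p q f g \<Longrightarrow> g \<cdot> vid (htgt D q) = g"
  using V.ide_right cellD(8) by blast

lemma comp_pairs_Obj:
  "(p, q) \<in> Obj (comp_pairs D) \<longleftrightarrow> p \<in> Obj (Hor D) \<and> q \<in> Obj (Hor D) \<and> htgt D p = hsrc D q"
  by (simp add: comp_pairs_def)

lemma comp_pairs_Arr:
  "(\<alpha>, \<beta>) \<in> Arr (comp_pairs D) \<longleftrightarrow> \<alpha> \<in> Arr (Hor D) \<and> \<beta> \<in> Arr (Hor D) \<and> ctgt D \<alpha> = csrc D \<beta>"
  by (simp add: comp_pairs_def)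

lemma comp_pairs_hom:
  assumes "cell D \<alpha> p q f g" "cell D \<beta> p' q' g h"
  shows "(\<alpha>, \<beta>) \<in> hom (comp_pairs D) (p, p') (q, q')"
  using assms by (auto simp: comp_pairs_def cell_def hom_def prod_cat_def)

lemma cell_comp_pairs_Obj:
  assumes "cell D \<alpha> p q f g" "cell D \<beta> p' q' g h"
  shows "(p, p') \<in> Obj (comp_pairs D)" "(q, q') \<in> Obj (comp_pairs D)"
  using cellD[OF assms(1)] cellD[OF assms(2)] V.homD(2,3) comp_pairs_Obj by metis+

lemma hcomp_obj:
  assumes "(p, q) \<in> Obj (comp_pairs D)"
  shows "p \<odot> q \<in> Obj (Hor D)" "hsrc D (p \<odot> q) = hsrc D p" "htgt D (p \<odot> q) = htgt D q"
  using hcompf.map_obj[OF assms] hsrc_hcomp[OF assms] htgt_hcomp[OF assms] by auto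

lemma cell_hcomp:
  assumes "cell D \<alpha> p q f g" "cell D \<beta> p' q' g h"
  shows "cell D (\<alpha> \<otimes> \<beta>) (p \<odot> p') (q \<odot> q') f h"
proof -
  have "(\<alpha>, \<beta>) \<in> Arr (comp_pairs D)" using assms by (auto simp: comp_pairs_Arr cell_def hom_def)
  then show ?thesis
    using hcompf.map_hom[OF comp_pairs_hom[OF assms]] csrc_ccomp ctgt_ccomp assms
    by (auto simp: cell_def)
qed

lemma interchange:
  assumes "cell D \<alpha> p q f g" "cell D \<beta> p' q' g h" "cell D \<gamma> q r f' g'" "cell D \<delta> q' r' g' h'"
  shows "(\<alpha> \<bullet> \<gamma>) \<otimes> (\<beta> \<bullet> \<delta>) = (\<alpha> \<otimes> \<beta>) \<bullet> (\<gamma> \<otimes> \<delta>)"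
  using hcompf.map_comp[OF comp_pairs_hom[OF assms(1,2)] comp_pairs_hom[OF assms(3,4)]]
  by (simp add: comp_pairs_def prod_cat_def)

lemma hcomp_Hid:
  assumes "(p, q) \<in> Obj (comp_pairs D)"
  shows "Hid p \<otimes> Hid q = Hid (p \<odot> q)"
  using hcompf.map_ide[OF assms] by (simp add: comp_pairs_def prod_cat_def)

subsection \<open>Globular isomorphisms\<close>

text \<open>The definition fixes the frame through p alone. As the frame arrows are identities,
  their typing forces p and q to have equal source and equal target.\<close>

lemma globular_isoD:
  assumes "globular_iso D \<alpha> p q"
  shows "iso (Hor D) \<alpha>" "cell D \<alpha> p q (vid (hsrc D p)) (vid (htgt D p))"
    "hsrc D p = hsrc D q" "htgt D p = htgt D q" "p \<in> Obj (Hor D)" "q \<in> Obj (Hor D)"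
proof -
  show *: "iso (Hor D) \<alpha>" "cell D \<alpha> p q (vid (hsrc D p)) (vid (htgt D p))"
    using assms by (auto simp: globular_iso_def)
  note c = cellD[OF *(2)]
  show "p \<in> Obj (Hor D)" "q \<in> Obj (Hor D)" using c by auto
  then have "vid (hsrc D p) \<in> vhom (hsrc D p) (hsrc D p)" "vid (htgt D p) \<in> vhom (htgt D p) (htgt D p)"
    using V.ide_hom src.map_obj tgt.map_obj by auto
  then show "hsrc D p = hsrc D q" "htgt D p = htgt D q" using c(7,8) V.homD(3) by metis+
qed

lemma globular_iso_Hid: "p \<in> Obj (Hor D) \<Longrightarrow> globular_iso D (Hid p) p p"
  using cell_Hid H.iso_ide by (simp add: globular_iso_def)

lemma globular_iso_comp:
  assumes "globular_iso D \<alpha> p q" "globular_iso D \<beta> q r"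
  shows "globular_iso D (\<alpha> \<bullet> \<beta>) p r"
proof -
  note a = globular_isoD[OF assms(1)] and b = globular_isoD[OF assms(2)]
  have "cell D (\<alpha> \<bullet> \<beta>) p r (vid (hsrc D p)) (vid (htgt D p))"
    using cell_comp[OF a(2) b(2)] vid_right_src[OF a(2)] vid_right_tgt[OF a(2)] by simp
  then show ?thesis
    using H.iso_comp[OF a(1) b(1)] cellD(1)[OF a(2)] cellD(1)[OF b(2)] by (simp add: globular_iso_def)
qed

text \<open>The inverse taken in \<open>Hor D\<close> has identity frames: composing its frame with
  identities leaves it unchanged, and the composite is the frame of \<open>Hid p\<close>.\<close>

lemma globular_iso_inverse:
  assumes "globular_iso D \<alpha> p q"
  obtains \<beta> where "globular_iso D \<beta> q p" "\<alpha> \<bullet> \<beta> = Hid p" "\<beta> \<bullet> \<alpha> = Hid q"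
proof -
  note a = globular_isoD[OF assms(1)]
  obtain \<beta> where \<beta>: "\<beta> \<in> hom (Hor D) q p" "\<alpha> \<bullet> \<beta> = Hid p" "\<beta> \<bullet> \<alpha> = Hid q"
    using H.isoE[OF a(1) cellD(1)[OF a(2)]] .
  note b = cellI[OF \<beta>(1)]
  have "cell D (\<alpha> \<bullet> \<beta>) p p (vid (hsrc D p) \<cdot> csrc D \<beta>) (vid (htgt D p) \<cdot> ctgt D \<beta>)"
    using cell_comp[OF a(2) b] by simp
  then have "vid (hsrc D p) \<cdot> csrc D \<beta> = vid (hsrc D p)" "vid (htgt D p) \<cdot> ctgt D \<beta> = vid (htgt D p)"
    using cell_Hid[OF a(5)] \<beta>(2) by (simp_all add: cell_def)
  then have "csrc D \<beta> = vid (hsrc D p)" "ctgt D \<beta> = vid (htgt D p)"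
    using vid_left_src[OF b] vid_left_tgt[OF b] a(3,4) by auto
  then have "globular_iso D \<beta> q p"
    using b a(3,4) H.iso_inverse[OF cellD(1)[OF a(2)] \<beta>] by (simp add: globular_iso_def)
  then show ?thesis using that \<beta> by blast
qed

lemma globular_iso_hcomp:
  assumes "globular_iso D \<alpha> p q" "globular_iso D \<beta> p' q'" "htgt D p = hsrc D p'"
  shows "globular_iso D (\<alpha> \<otimes> \<beta>) (p \<odot> p') (q \<odot> q')"
proof -
  obtain \<alpha>' where a': "globular_iso D \<alpha>' q p" "\<alpha> \<bullet> \<alpha>' = Hid p" "\<alpha>' \<bullet> \<alpha> = Hid q"
    using globular_iso_inverse[OF assms(1)] .
  obtain \<beta>' where b': "globular_iso D \<beta>' q' p'" "\<beta> \<bullet> \<beta>' = Hid p'" "\<beta>' \<bullet> \<beta> = Hid q'"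
    using globular_iso_inverse[OF assms(2)] .
  note a = globular_isoD[OF assms(1)] globular_isoD[OF a'(1)]
    and b = globular_isoD[OF assms(2)] globular_isoD[OF b'(1)]
  have c: "cell D \<alpha> p q (vid (hsrc D p)) (vid (hsrc D p'))"
    "cell D \<alpha>' q p (vid (hsrc D q)) (vid (hsrc D q'))"
    using a b assms(3) by metis+
  have o: "(p, p') \<in> Obj (comp_pairs D)" "(q, q') \<in> Obj (comp_pairs D)"
    using cell_comp_pairs_Obj[OF c(1) b(2)] by auto
  have "(\<alpha> \<otimes> \<beta>) \<bullet> (\<alpha>' \<otimes> \<beta>') = Hid (p \<odot> p')" "(\<alpha>' \<otimes> \<beta>') \<bullet> (\<alpha> \<otimes> \<beta>) = Hid (q \<odot> q')"
    using interchange[OF c(1) b(2) c(2) b(8)] interchange[OF c(2) b(8) c(1) b(2)] a' b'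
      hcomp_Hid[OF o(1)] hcomp_Hid[OF o(2)] by simp_all
  moreover note h = cell_hcomp[OF c(1) b(2)] cell_hcomp[OF c(2) b(8)]
  ultimately have "iso (Hor D) (\<alpha> \<otimes> \<beta>)" using cellD(1) H.isoI by blast
  then show ?thesis using h(1) hcomp_obj[OF o(1)] by (simp add: globular_iso_def)
qed

text \<open>One half of two-out-of-three. Below, a cell is often shown invertible by composing it
  with a unitor or an associator first.\<close>

lemma globular_iso_cancel_left:
  assumes "globular_iso D \<alpha> p q" "globular_iso D (\<alpha> \<bullet> \<beta>) p r" "\<beta> \<in> hom (Hor D) q r"
  shows "globular_iso D \<beta> q r"
proof -
  obtain \<alpha>' where a': "globular_iso D \<alpha>' q p" "\<alpha>' \<bullet> \<alpha> = Hid q"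
    using globular_iso_inverse[OF assms(1)] .
  have "\<alpha>' \<bullet> (\<alpha> \<bullet> \<beta>) = \<beta>"
    using H.comp_assoc[OF _ _ assms(3), of \<alpha>' q p \<alpha>] a'(2) H.ide_left[OF assms(3)]
      cellD(1)[OF globular_isoD(2)[OF a'(1)]] cellD(1)[OF globular_isoD(2)[OF assms(1)]] by simp
  then show ?thesis using globular_iso_comp[OF a'(1) assms(2)] by simp
qed

lemma globular_iso_cancel_right:
  assumes "globular_iso D \<beta> q r" "globular_iso D (\<alpha> \<bullet> \<beta>) p r" "\<alpha> \<in> hom (Hor D) p q"
  shows "globular_iso D \<alpha> p q"
proof -
  obtain \<beta>' where b': "globular_iso D \<beta>' r q" "\<beta> \<bullet> \<beta>' = Hid q"
    using globular_iso_inverse[OF assms(1)] .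
  have "(\<alpha> \<bullet> \<beta>) \<bullet> \<beta>' = \<alpha>"
    using H.comp_assoc[OF assms(3), of \<beta> r \<beta>' q] b'(2) H.ide_right[OF assms(3)]
      cellD(1)[OF globular_isoD(2)[OF b'(1)]] cellD(1)[OF globular_isoD(2)[OF assms(1)]] by simp
  then show ?thesis using globular_iso_comp[OF assms(2) b'(1)] by simp
qed

subsection \<open>Cartesian and opcartesian cells\<close>

text \<open>The universal property in terms of framed cells. The equations
  \<open>f' = f \<cdot> u\<close> and \<open>g' = g \<cdot> v\<close> are separate premises, so that
  \<psi> may be supplied with an already simplified frame.\<close>

lemma opcart_cell_lift:
  assumes "opcartesian_cell D \<kappa>" "cell D \<kappa> p q f g" "cell D \<psi> p r f' g'"
    "u \<in> vhom (hsrc D q) (hsrc D r)" "v \<in> vhom (htgt D q) (htgt D r)" "f' = f \<cdot> u" "g' = g \<cdot> v"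
  obtains \<chi> where "cell D \<chi> q r u v" "\<kappa> \<bullet> \<chi> = \<psi>"
proof -
  have "\<exists>!\<chi>. \<chi> \<in> hom (Hor D) q r \<and> cframe D \<chi> = (u, v) \<and> \<kappa> \<bullet> \<chi> = \<psi>"
    using assms by (intro fr.opcart_lift[where a = p])
      (auto simp: opcartesian_cell_def cell_def hom_prod_cat Comp_prod_cat)
  then show ?thesis using that cframe_hom by blast
qed

lemma opcart_cell_unique:
  assumes "opcartesian_cell D \<kappa>" "cell D \<kappa> p q f g" "cell D \<chi> q r u v" "cell D \<chi>' q r u v"
    "\<kappa> \<bullet> \<chi> = \<kappa> \<bullet> \<chi>'"
  shows "\<chi> = \<chi>'"
proof -
  have "cell D (\<kappa> \<bullet> \<chi>) p r (f \<cdot> u) (g \<cdot> v)" using cell_comp[OF assms(2,3)] by simp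
  then have "\<exists>!\<xi>. \<xi> \<in> hom (Hor D) q r \<and> cframe D \<xi> = (u, v) \<and> \<kappa> \<bullet> \<xi> = \<kappa> \<bullet> \<chi>"
    using assms(1,2) cellD(7,8)[OF assms(3)] by (intro fr.opcart_lift[where a = p])
      (auto simp: opcartesian_cell_def cell_def hom_prod_cat Comp_prod_cat)
  then show ?thesis using assms(3-5) unfolding cell_def by auto
qed

lemma opcart_cellI:
  assumes "cell D \<kappa> p q f g"
    and "\<And>r \<psi> u v. \<lbrakk>cell D \<psi> p r (f \<cdot> u) (g \<cdot> v); u \<in> vhom (hsrc D q) (hsrc D r);
      v \<in> vhom (htgt D q) (htgt D r)\<rbrakk> \<Longrightarrow> \<exists>\<chi>. cell D \<chi> q r u v \<and> \<kappa> \<bullet> \<chi> = \<psi>"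
    and "\<And>r \<chi> \<chi>' u v. \<lbrakk>cell D \<chi> q r u v; cell D \<chi>' q r u v; \<kappa> \<bullet> \<chi> = \<kappa> \<bullet> \<chi>'\<rbrakk> \<Longrightarrow> \<chi> = \<chi>'"
  shows "opcartesian_cell D \<kappa>"
  unfolding opcartesian_cell_def
proof (rule fr.opcartI)
  show "\<kappa> \<in> hom (Hor D) p q" using assms(1) by (simp add: cell_def)
  fix r \<psi> w
  assume *: "\<psi> \<in> hom (Hor D) p r" "w \<in> hom (frame_cat D) (hframe D q) (hframe D r)"
    "cframe D \<kappa> \<Zsemi>\<^bsub>frame_cat D\<^esub> w = cframe D \<psi>"
  obtain u v where w: "w = (u, v)" by fastforce
  have "cell D \<psi> p r (f \<cdot> u) (g \<cdot> v)" "u \<in> vhom (hsrc D q) (hsrc D r)" "v \<in> vhom (htgt D q) (htgt D r)"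
    using * w assms(1) by (auto simp: hom_prod_cat Comp_prod_cat cell_def)
  then obtain \<chi> where "cell D \<chi> q r u v" "\<kappa> \<bullet> \<chi> = \<psi>" using assms(2) by blast
  then show "\<exists>!\<chi>. \<chi> \<in> hom (Hor D) q r \<and> cframe D \<chi> = w \<and> \<kappa> \<bullet> \<chi> = \<psi>"
    using assms(3) w unfolding cell_def by (intro ex_ex1I) auto
qed

lemma cart_cell_lift:
  assumes "cartesian_cell D \<kappa>" "cell D \<kappa> q r f g" "cell D \<psi> p r f' g'"
    "u \<in> vhom (hsrc D p) (hsrc D q)" "v \<in> vhom (htgt D p) (htgt D q)" "f' = u \<cdot> f" "g' = v \<cdot> g"
  obtains \<chi> where "cell D \<chi> p q u v" "\<chi> \<bullet> \<kappa> = \<psi>"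
proof -
  have "\<exists>!\<chi>. \<chi> \<in> hom (Hor D) p q \<and> cframe D \<chi> = (u, v) \<and> \<chi> \<bullet> \<kappa> = \<psi>"
    using assms by (intro fr.cart_lift[where c = r])
      (auto simp: cartesian_cell_def cell_def hom_prod_cat Comp_prod_cat)
  then show ?thesis using that cframe_hom by blast
qed

lemma cart_cell_unique:
  assumes "cartesian_cell D \<kappa>" "cell D \<kappa> q r f g" "cell D \<chi> p q u v" "cell D \<chi>' p q u v"
    "\<chi> \<bullet> \<kappa> = \<chi>' \<bullet> \<kappa>"
  shows "\<chi> = \<chi>'"
proof -
  have "cell D (\<chi> \<bullet> \<kappa>) p r (u \<cdot> f) (v \<cdot> g)" using cell_comp[OF assms(3,2)] by simp
  then have "\<exists>!\<xi>. \<xi> \<in> hom (Hor D) p q \<and> cframe D \<xi> = (u, v) \<and> \<xi> \<bullet> \<kappa> = \<chi> \<bullet> \<kappa>"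
    using assms(1,2) cellD(7,8)[OF assms(3)] by (intro fr.cart_lift[where c = r])
      (auto simp: cartesian_cell_def cell_def hom_prod_cat Comp_prod_cat)
  then show ?thesis using assms(3-5) unfolding cell_def by auto
qed

lemma cart_cellI:
  assumes "cell D \<kappa> q r f g"
    and "\<And>p \<psi> u v. \<lbrakk>cell D \<psi> p r (u \<cdot> f) (v \<cdot> g); u \<in> vhom (hsrc D p) (hsrc D q);
      v \<in> vhom (htgt D p) (htgt D q)\<rbrakk> \<Longrightarrow> \<exists>\<chi>. cell D \<chi> p q u v \<and> \<chi> \<bullet> \<kappa> = \<psi>"
    and "\<And>p \<chi> \<chi>' u v. \<lbrakk>cell D \<chi> p q u v; cell D \<chi>' p q u v; \<chi> \<bullet> \<kappa> = \<chi>' \<bullet> \<kappa>\<rbrakk> \<Longrightarrow> \<chi> = \<chi>'"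
  shows "cartesian_cell D \<kappa>"
  unfolding cartesian_cell_def
proof (rule fr.cartI)
  show "\<kappa> \<in> hom (Hor D) q r" using assms(1) by (simp add: cell_def)
  fix p \<psi> w
  assume *: "\<psi> \<in> hom (Hor D) p r" "w \<in> hom (frame_cat D) (hframe D p) (hframe D q)"
    "w \<Zsemi>\<^bsub>frame_cat D\<^esub> cframe D \<kappa> = cframe D \<psi>"
  obtain u v where w: "w = (u, v)" by fastforce
  have "cell D \<psi> p r (u \<cdot> f) (v \<cdot> g)" "u \<in> vhom (hsrc D p) (hsrc D q)" "v \<in> vhom (htgt D p) (htgt D q)"
    using * w assms(1) by (auto simp: hom_prod_cat Comp_prod_cat cell_def)
  then obtain \<chi> where "cell D \<chi> p q u v" "\<chi> \<bullet> \<kappa> = \<psi>" using assms(2) by blast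
  then show "\<exists>!\<chi>. \<chi> \<in> hom (Hor D) p q \<and> cframe D \<chi> = w \<and> \<chi> \<bullet> \<kappa> = \<psi>"
    using assms(3) w unfolding cell_def by (intro ex_ex1I) auto
qed

lemma opcart_cell_comp:
  assumes "opcartesian_cell D \<alpha>" "opcartesian_cell D \<beta>" "cell D \<alpha> p q f g" "cell D \<beta> q r f' g'"
  shows "opcartesian_cell D (\<alpha> \<bullet> \<beta>)"
  using assms fr.opcart_comp unfolding opcartesian_cell_def cell_def by blast

lemma opcart_cell_cancel:
  assumes "opcartesian_cell D \<alpha>" "opcartesian_cell D (\<alpha> \<bullet> \<beta>)" "cell D \<alpha> p q f g" "cell D \<beta> q r f' g'"
  shows "opcartesian_cell D \<beta>"
  using assms fr.opcart_cancel unfolding opcartesian_cell_def cell_def by blast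

lemma opcart_cell_iso: "iso (Hor D) \<alpha> \<Longrightarrow> opcartesian_cell D \<alpha>"
  using fr.opcart_iso unfolding opcartesian_cell_def .

lemma cart_cell_comp:
  assumes "cartesian_cell D \<alpha>" "cartesian_cell D \<beta>" "cell D \<alpha> p q f g" "cell D \<beta> q r f' g'"
  shows "cartesian_cell D (\<alpha> \<bullet> \<beta>)"
  using assms fr.cart_comp unfolding cartesian_cell_def cell_def by blast

lemma cart_cell_iso: "iso (Hor D) \<alpha> \<Longrightarrow> cartesian_cell D \<alpha>"
  using fr.cart_iso unfolding cartesian_cell_def .

lemma cart_cell_unique_iso:
  assumes "cartesian_cell D \<alpha>" "cartesian_cell D \<beta>" "cell D \<alpha> p r f g" "cell D \<beta> q r f g"
  obtains \<theta> where "globular_iso D \<theta> p q" "\<theta> \<bullet> \<beta> = \<alpha>"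
proof -
  have "hframe D p = hframe D q"
    using cellD(7,8)[OF assms(3)] cellD(7,8)[OF assms(4)] V.homD(2) by (metis prod.inject)
  then have "\<exists>\<theta> \<in> hom (Hor D) p q. iso (Hor D) \<theta> \<and> cframe D \<theta> = Ide (frame_cat D) (hframe D p)
      \<and> \<theta> \<bullet> \<beta> = \<alpha>"
    using assms by (intro fr.cart_unique_iso[where c = r]) (auto simp: cartesian_cell_def cell_def)
  then show ?thesis using that by (auto simp: globular_iso_def cell_def Ide_prod_cat)
qed

lemma opcart_cell_unique_iso:
  assumes "opcartesian_cell D \<alpha>" "opcartesian_cell D \<beta>" "cell D \<alpha> p q f g" "cell D \<beta> p r f g"
  obtains \<theta> where "globular_iso D \<theta> q r" "\<alpha> \<bullet> \<theta> = \<beta>"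
proof -
  have "hframe D q = hframe D r"
    using cellD(7,8)[OF assms(3)] cellD(7,8)[OF assms(4)] V.homD(3) by (metis prod.inject)
  then have "\<exists>\<theta> \<in> hom (Hor D) q r. iso (Hor D) \<theta> \<and> cframe D \<theta> = Ide (frame_cat D) (hframe D q)
      \<and> \<alpha> \<bullet> \<theta> = \<beta>"
    using assms by (intro fr.opcart_unique_iso[where a = p]) (auto simp: opcartesian_cell_def cell_def)
  then show ?thesis using that by (auto simp: globular_iso_def cell_def Ide_prod_cat)
qed

end

section \<open>Companions and conjoints\<close>

context double_category
begin

lemma lunit_inverse:
  assumes "p \<in> Obj (Hor D)"
  obtains \<mu> where "globular_iso D \<mu> p (hid D (hsrc D p) \<odot> p)" "\<mu> \<bullet> lunit D p = Hid p"
    "lunit D p \<bullet> \<mu> = Hid (hid D (hsrc D p) \<odot> p)"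
  using globular_iso_inverse[OF lunit_iso[OF assms]] by blast

lemma runit_inverse:
  assumes "p \<in> Obj (Hor D)"
  obtains \<mu> where "globular_iso D \<mu> p (p \<odot> hid D (htgt D p))" "\<mu> \<bullet> runit D p = Hid p"
    "runit D p \<bullet> \<mu> = Hid (p \<odot> hid D (htgt D p))"
  using globular_iso_inverse[OF runit_iso[OF assms]] by blast

text \<open>Both \<open>c \<bullet> k\<close> and c are cartesian over the same frame; s is their
  comparison. An automorphism of the codomain is thereby moved to the domain.\<close>

lemma cart_cell_transport:
  assumes "cartesian_cell D c" "cell D c p q f g" "globular_iso D k q q"
  obtains s where "globular_iso D s p p" "s \<bullet> c = c \<bullet> k"
proof -
  note k = globular_isoD[OF assms(3)]
  have "cell D (c \<bullet> k) p q f g"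
    using cell_comp[OF assms(2) k(2)] vid_right_src[OF assms(2)] vid_right_tgt[OF assms(2)] by simp
  moreover have "cartesian_cell D (c \<bullet> k)"
    using cart_cell_comp[OF assms(1) cart_cell_iso[OF k(1)] assms(2) k(2)] .
  ultimately show ?thesis using cart_cell_unique_iso assms(1,2) that by metis
qed

text \<open>The companion is presented as the restriction of \<open>hid D B\<close> along g and an
  identity, with \<eta> the lift of \<open>cid D g\<close> through it. Cartesianness of c stands in
  for the zig-zag identity that involves horizontal composition.\<close>

definition companion where
  "companion g A B G \<eta> c \<longleftrightarrow> g \<in> vhom A B \<and> cell D \<eta> (hid D A) G (vid A) g \<and>
     cell D c G (hid D B) g (vid B) \<and> cartesian_cell D c \<and> \<eta> \<bullet> c = cid D g"

definition conjoint where
  "conjoint f X A F \<eta> c \<longleftrightarrow> f \<in> vhom X A \<and> cell D \<eta> (hid D X) F f (vid X) \<and>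
     cell D c F (hid D A) (vid A) f \<and> cartesian_cell D c \<and> \<eta> \<bullet> c = cid D f"

text \<open>
  The strict zig-zag identities would equate this cell, and its dual for conjoints, with a composite
  of unitors, which needs the coincidence of the two unitors on an identity.  Invertibility is all
  that the universal properties require, and holds without any coherence law.
\<close>

lemma companion_unit_counit_iso:
  assumes "companion g A B G \<eta> c"
  shows "globular_iso D (\<eta> \<otimes> c) (hid D A \<odot> G) (G \<odot> hid D B)"
proof -
  have g: "g \<in> vhom A B" and \<eta>: "cell D \<eta> (hid D A) G (vid A) g"
    and c: "cell D c G (hid D B) g (vid B)" "cartesian_cell D c" and \<eta>c: "\<eta> \<bullet> c = cid D g"
    using assms by (auto simp: companion_def)
  have AB: "A \<in> Obj (Ver D)" "B \<in> Obj (Ver D)" using V.homD[OF g] by auto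
  have G: "G \<in> Obj (Hor D)" "hsrc D G = A" "htgt D G = B"
    using cellD[OF c(1)] V.homD(2) AB g cellD(7)[OF \<eta>] cellD(8)[OF \<eta>] hsrc_hid htgt_hid V.homD(3)
    by metis+
  have I: "hsrc D (hid D B) = B" "htgt D (hid D B) = B" "hid D B \<in> Obj (Hor D)"
    using AB hsrc_hid htgt_hid hid_obj by auto
  obtain \<mu> where \<mu>: "globular_iso D \<mu> (hid D B) (hid D B \<odot> hid D B)"
    "lunit D (hid D B) \<bullet> \<mu> = Hid (hid D B \<odot> hid D B)"
    using lunit_inverse[OF I(3)] unfolding I(1) by blast
  \<comment> \<open>\<open>k\<close> measures the discrepancy between the two unitors on
    \<open>hid D B\<close>; s below is the same discrepancy moved along c to an automorphism of
    G.\<close>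
  define k where "k = \<mu> \<bullet> runit D (hid D B)"
  have ru: "globular_iso D (runit D (hid D B)) (hid D B \<odot> hid D B) (hid D B)"
    and lu: "globular_iso D (lunit D (hid D B)) (hid D B \<odot> hid D B) (hid D B)"
    using runit_iso[OF I(3)] lunit_iso[OF I(3)] I by auto
  have k: "globular_iso D k (hid D B) (hid D B)"
    unfolding k_def using globular_iso_comp[OF \<mu>(1) ru] .
  obtain s where s: "globular_iso D s G G" "s \<bullet> c = c \<bullet> k"
    using cart_cell_transport[OF c(2,1) k] .
  have lG: "globular_iso D (lunit D G) (hid D A \<odot> G) G"
    and rG: "globular_iso D (runit D G) (G \<odot> hid D B) G"
    using lunit_iso[OF G(1)] runit_iso[OF G(1)] G by auto
  note cells = globular_isoD(2)[OF ru] globular_isoD(2)[OF lu] globular_isoD(2)[OF \<mu>(1)]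
    globular_isoD(2)[OF lG] globular_isoD(2)[OF rG] globular_isoD(2)[OF s(1)]
  have IB: "cell D (cid D (vid B)) (hid D B) (hid D B) (vid B) (vid B)"
    using cell_cid V.ide_hom AB by blast
  have \<eta>_c: "cell D (\<eta> \<otimes> c) (hid D A \<odot> G) (G \<odot> hid D B) (vid A) (vid B)"
    using cell_hcomp[OF \<eta> c(1)] .
  have c_I: "cell D (c \<otimes> cid D (vid B)) (G \<odot> hid D B) (hid D B \<odot> hid D B) g (vid B)"
    using cell_hcomp[OF c(1) IB] .
  have g_c: "cell D (cid D g \<otimes> c) (hid D A \<odot> G) (hid D B \<odot> hid D B) g (vid B)"
    using cell_hcomp[OF cell_cid[OF g] c(1)] .
  \<comment> \<open>The two cells are compared after the cartesian cell c. Naturality of the right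
    unitor, interchange with \<open>\<eta> \<bullet> c = cid D g\<close>, and naturality of the left
    unitor turn one into the other, with k accounting for the change of unitor.\<close>
  have "((\<eta> \<otimes> c) \<bullet> runit D G) \<bullet> c = (\<eta> \<otimes> c) \<bullet> (runit D G \<bullet> c)"
    using cell_comp_assoc[OF \<eta>_c cells(5) c(1)] .
  also have "runit D G \<bullet> c = (c \<otimes> cid D (vid B)) \<bullet> runit D (hid D B)"
    using runit_natural[OF cellD(1)[OF c(1)]] cellD(3)[OF c(1)] by simp
  also have "(\<eta> \<otimes> c) \<bullet> \<dots> = ((\<eta> \<otimes> c) \<bullet> (c \<otimes> cid D (vid B))) \<bullet> runit D (hid D B)"
    using cell_comp_assoc[OF \<eta>_c c_I cells(1)] by simp
  also have "(\<eta> \<otimes> c) \<bullet> (c \<otimes> cid D (vid B)) = cid D g \<otimes> c"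
    using interchange[OF \<eta> c(1) c(1) IB] \<eta>c cell_Hid_right[OF c(1)] cid_vid[OF AB(2)] by simp
  also have "runit D (hid D B) = lunit D (hid D B) \<bullet> k"
    unfolding k_def using cell_comp_assoc[OF cells(2,3,1)] \<mu>(2) cell_Hid_left[OF cells(1)] by simp
  also have "(cid D g \<otimes> c) \<bullet> \<dots> = ((cid D g \<otimes> c) \<bullet> lunit D (hid D B)) \<bullet> k"
    using cell_comp_assoc[OF g_c cells(2) globular_isoD(2)[OF k]] by simp
  also have "(cid D g \<otimes> c) \<bullet> lunit D (hid D B) = lunit D G \<bullet> c"
    using lunit_natural[OF cellD(1)[OF c(1)]] cellD(2)[OF c(1)] by simp
  also have "\<dots> \<bullet> k = (lunit D G \<bullet> s) \<bullet> c"
    using cell_comp_assoc[OF cells(4) c(1) globular_isoD(2)[OF k]] s(2)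
      cell_comp_assoc[OF cells(4,6) c(1)] by simp
  finally have eq: "((\<eta> \<otimes> c) \<bullet> runit D G) \<bullet> c = (lunit D G \<bullet> s) \<bullet> c" .
  have ls: "globular_iso D (lunit D G \<bullet> s) (hid D A \<odot> G) G"
    using globular_iso_comp[OF lG s(1)] .
  have hs: "hsrc D (hid D A \<odot> G) = A" "htgt D (hid D A \<odot> G) = B"
    "hsrc D (G \<odot> hid D B) = A" "htgt D (G \<odot> hid D B) = B"
    using globular_isoD(3,4)[OF lG] globular_isoD(3,4)[OF rG] G by auto
  have ii: "vid A \<cdot> vid A = vid A" "vid B \<cdot> vid B = vid B"
    using V.ide_left V.ide_hom AB by auto
  have "cell D ((\<eta> \<otimes> c) \<bullet> runit D G) (hid D A \<odot> G) G (vid A) (vid B)"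
    using cell_comp[OF \<eta>_c cells(5)[unfolded hs] ii] .
  then have "(\<eta> \<otimes> c) \<bullet> runit D G = lunit D G \<bullet> s"
    using cart_cell_unique[OF c(2,1) _ globular_isoD(2)[OF ls, unfolded hs] eq] by blast
  then show ?thesis
    using globular_iso_cancel_right[OF rG _ cellD(1)[OF \<eta>_c]] ls by simp
qed

lemma conjoint_counit_unit_iso:
  assumes "conjoint f X A F \<eta> c"
  shows "globular_iso D (c \<otimes> \<eta>) (F \<odot> hid D X) (hid D A \<odot> F)"
proof -
  have f: "f \<in> vhom X A" and \<eta>: "cell D \<eta> (hid D X) F f (vid X)"
    and c: "cell D c F (hid D A) (vid A) f" "cartesian_cell D c" and \<eta>c: "\<eta> \<bullet> c = cid D f"
    using assms by (auto simp: conjoint_def)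
  have AX: "A \<in> Obj (Ver D)" "X \<in> Obj (Ver D)" using V.homD[OF f] by auto
  have F: "F \<in> Obj (Hor D)" "hsrc D F = A" "htgt D F = X"
    using cellD[OF c(1)] V.homD(2) AX f cellD(7)[OF \<eta>] cellD(8)[OF \<eta>] hsrc_hid htgt_hid V.homD(3)
    by metis+
  have I: "hsrc D (hid D A) = A" "htgt D (hid D A) = A" "hid D A \<in> Obj (Hor D)"
    using AX hsrc_hid htgt_hid hid_obj by auto
  obtain \<mu> where \<mu>: "globular_iso D \<mu> (hid D A) (hid D A \<odot> hid D A)"
    "runit D (hid D A) \<bullet> \<mu> = Hid (hid D A \<odot> hid D A)"
    using runit_inverse[OF I(3)] unfolding I(2) by blast
  \<comment> \<open>The roles of the unitors are exchanged here: \<open>k\<close> carries the right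
    unitor on \<open>hid D A\<close> to the left one.\<close>
  define k where "k = \<mu> \<bullet> lunit D (hid D A)"
  have ru: "globular_iso D (runit D (hid D A)) (hid D A \<odot> hid D A) (hid D A)"
    and lu: "globular_iso D (lunit D (hid D A)) (hid D A \<odot> hid D A) (hid D A)"
    using runit_iso[OF I(3)] lunit_iso[OF I(3)] I by auto
  have k: "globular_iso D k (hid D A) (hid D A)"
    unfolding k_def using globular_iso_comp[OF \<mu>(1) lu] .
  obtain s where s: "globular_iso D s F F" "s \<bullet> c = c \<bullet> k"
    using cart_cell_transport[OF c(2,1) k] .
  have lF: "globular_iso D (lunit D F) (hid D A \<odot> F) F"
    and rF: "globular_iso D (runit D F) (F \<odot> hid D X) F"
    using lunit_iso[OF F(1)] runit_iso[OF F(1)] F by auto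
  note cells = globular_isoD(2)[OF ru] globular_isoD(2)[OF lu] globular_isoD(2)[OF \<mu>(1)]
    globular_isoD(2)[OF lF] globular_isoD(2)[OF rF] globular_isoD(2)[OF s(1)]
  have IA: "cell D (cid D (vid A)) (hid D A) (hid D A) (vid A) (vid A)"
    using cell_cid V.ide_hom AX by blast
  have c_\<eta>: "cell D (c \<otimes> \<eta>) (F \<odot> hid D X) (hid D A \<odot> F) (vid A) (vid X)"
    using cell_hcomp[OF c(1) \<eta>] .
  have I_c: "cell D (cid D (vid A) \<otimes> c) (hid D A \<odot> F) (hid D A \<odot> hid D A) (vid A) f"
    using cell_hcomp[OF IA c(1)] .
  have c_f: "cell D (c \<otimes> cid D f) (F \<odot> hid D X) (hid D A \<odot> hid D A) (vid A) f"
    using cell_hcomp[OF c(1) cell_cid[OF f]] .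
  have "((c \<otimes> \<eta>) \<bullet> lunit D F) \<bullet> c = (c \<otimes> \<eta>) \<bullet> (lunit D F \<bullet> c)"
    using cell_comp_assoc[OF c_\<eta> cells(4) c(1)] .
  also have "lunit D F \<bullet> c = (cid D (vid A) \<otimes> c) \<bullet> lunit D (hid D A)"
    using lunit_natural[OF cellD(1)[OF c(1)]] cellD(2)[OF c(1)] by simp
  also have "(c \<otimes> \<eta>) \<bullet> \<dots> = ((c \<otimes> \<eta>) \<bullet> (cid D (vid A) \<otimes> c)) \<bullet> lunit D (hid D A)"
    using cell_comp_assoc[OF c_\<eta> I_c cells(2)] by simp
  also have "(c \<otimes> \<eta>) \<bullet> (cid D (vid A) \<otimes> c) = c \<otimes> cid D f"
    using interchange[OF c(1) \<eta> IA c(1)] \<eta>c cell_Hid_right[OF c(1)] cid_vid[OF AX(1)] by simp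
  also have "lunit D (hid D A) = runit D (hid D A) \<bullet> k"
    unfolding k_def using cell_comp_assoc[OF cells(1,3,2)] \<mu>(2) cell_Hid_left[OF cells(2)] by simp
  also have "(c \<otimes> cid D f) \<bullet> \<dots> = ((c \<otimes> cid D f) \<bullet> runit D (hid D A)) \<bullet> k"
    using cell_comp_assoc[OF c_f cells(1) globular_isoD(2)[OF k]] by simp
  also have "(c \<otimes> cid D f) \<bullet> runit D (hid D A) = runit D F \<bullet> c"
    using runit_natural[OF cellD(1)[OF c(1)]] cellD(3)[OF c(1)] by simp
  also have "\<dots> \<bullet> k = (runit D F \<bullet> s) \<bullet> c"
    using cell_comp_assoc[OF cells(5) c(1) globular_isoD(2)[OF k]] s(2)
      cell_comp_assoc[OF cells(5,6) c(1)] by simp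
  finally have eq: "((c \<otimes> \<eta>) \<bullet> lunit D F) \<bullet> c = (runit D F \<bullet> s) \<bullet> c" .
  have rs: "globular_iso D (runit D F \<bullet> s) (F \<odot> hid D X) F"
    using globular_iso_comp[OF rF s(1)] .
  have hs: "hsrc D (hid D A \<odot> F) = A" "htgt D (hid D A \<odot> F) = X"
    "hsrc D (F \<odot> hid D X) = A" "htgt D (F \<odot> hid D X) = X"
    using globular_isoD(3,4)[OF lF] globular_isoD(3,4)[OF rF] F by auto
  have ii: "vid A \<cdot> vid A = vid A" "vid X \<cdot> vid X = vid X"
    using V.ide_left V.ide_hom AX by auto
  have "cell D ((c \<otimes> \<eta>) \<bullet> lunit D F) (F \<odot> hid D X) F (vid A) (vid X)"
    using cell_comp[OF c_\<eta> cells(4)[unfolded hs] ii] .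
  then have "(c \<otimes> \<eta>) \<bullet> lunit D F = runit D F \<bullet> s"
    using cart_cell_unique[OF c(2,1) _ globular_isoD(2)[OF rs, unfolded hs] eq] by blast
  then show ?thesis
    using globular_iso_cancel_right[OF lF _ cellD(1)[OF c_\<eta>]] rs by simp
qed

end

section \<open>Composition with companions and conjoints as pushforward and restriction\<close>

context double_category
begin

lemma lunit_cell:
  assumes "p \<in> Obj (Hor D)"
  shows "cell D (lunit D p) (hid D (hsrc D p) \<odot> p) p (vid (hsrc D p)) (vid (htgt D p))"
proof -
  note i = globular_isoD[OF lunit_iso[OF assms]]
  show ?thesis using i(2) by (simp only: i(3,4))
qed

lemma runit_cell:
  assumes "p \<in> Obj (Hor D)"
  shows "cell D (runit D p) (p \<odot> hid D (htgt D p)) p (vid (hsrc D p)) (vid (htgt D p))"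
proof -
  note i = globular_isoD[OF runit_iso[OF assms]]
  show ?thesis using i(2) by (simp only: i(3,4))
qed

lemma companionD:
  assumes "companion g A B G \<eta> c"
  shows "g \<in> vhom A B" "cell D \<eta> (hid D A) G (vid A) g" "cell D c G (hid D B) g (vid B)"
    "cartesian_cell D c" "\<eta> \<bullet> c = cid D g" "A \<in> Obj (Ver D)" "B \<in> Obj (Ver D)"
    "G \<in> Obj (Hor D)" "hsrc D G = A" "htgt D G = B"
proof -
  show *: "g \<in> vhom A B" "cell D \<eta> (hid D A) G (vid A) g" "cell D c G (hid D B) g (vid B)"
    "cartesian_cell D c" "\<eta> \<bullet> c = cid D g"
    using assms by (auto simp: companion_def)
  show AB: "A \<in> Obj (Ver D)" "B \<in> Obj (Ver D)" using V.homD[OF *(1)] by auto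
  show "G \<in> Obj (Hor D)" "hsrc D G = A" "htgt D G = B"
    using cellD[OF *(3)] V.homD(2,3) *(1) cellD(8)[OF *(2)] by metis+
qed

lemma conjointD:
  assumes "conjoint f X A F \<eta> c"
  shows "f \<in> vhom X A" "cell D \<eta> (hid D X) F f (vid X)" "cell D c F (hid D A) (vid A) f"
    "cartesian_cell D c" "\<eta> \<bullet> c = cid D f" "A \<in> Obj (Ver D)" "X \<in> Obj (Ver D)"
    "F \<in> Obj (Hor D)" "hsrc D F = A" "htgt D F = X"
proof -
  show *: "f \<in> vhom X A" "cell D \<eta> (hid D X) F f (vid X)" "cell D c F (hid D A) (vid A) f"
    "cartesian_cell D c" "\<eta> \<bullet> c = cid D f"
    using assms by (auto simp: conjoint_def)
  show AX: "A \<in> Obj (Ver D)" "X \<in> Obj (Ver D)" using V.homD[OF *(1)] by auto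
  show "F \<in> Obj (Hor D)" "hsrc D F = A" "htgt D F = X"
    using cellD[OF *(3)] V.homD(2,3) *(1) cellD(7)[OF *(2)] by metis+
qed

text \<open>Composing with the conjoint of f is pushforward along f on the source side. Lifts are
  built by placing the counit c beside the given cell. They are unique because, for an automorphism
  e of \<open>F \<odot> q\<close>, the cell \<open>e \<bullet> \<xi>\<close> can be written in terms
  of \<open>\<kappa> \<bullet> \<xi>\<close>.\<close>

lemma conjoint_opcart:
  assumes "conjoint f X A F \<eta> c" "q \<in> Obj (Hor D)" "hsrc D q = X"
    and \<mu>: "globular_iso D \<mu> q (hid D X \<odot> q)" "\<mu> \<bullet> lunit D q = Hid q"
  shows "cell D (\<mu> \<bullet> (\<eta> \<otimes> Hid q)) q (F \<odot> q) f (vid (htgt D q))"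
    "opcartesian_cell D (\<mu> \<bullet> (\<eta> \<otimes> Hid q))"
proof -
  note F = conjointD[OF assms(1)]
  note \<eta> = F(2) and c = F(3)
  define \<kappa> where "\<kappa> = \<mu> \<bullet> (\<eta> \<otimes> Hid q)"
  note \<mu>c = globular_isoD(2)[OF \<mu>(1), unfolded assms(3)]
  have q: "cell D (Hid q) q q (vid X) (vid (htgt D q))" using cell_Hid[OF assms(2)] assms(3) by simp
  have lu: "cell D (lunit D q) (hid D X \<odot> q) q (vid X) (vid (htgt D q))"
    using lunit_cell[OF assms(2)] assms(3) by simp
  have v: "vid (htgt D q) \<in> vhom (htgt D q) (htgt D q)" using V.ide_hom tgt.map_obj assms(2) by blast
  have \<eta>q: "cell D (\<eta> \<otimes> Hid q) (hid D X \<odot> q) (F \<odot> q) f (vid (htgt D q))"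
    using cell_hcomp[OF \<eta> q] .
  have \<kappa>: "cell D \<kappa> q (F \<odot> q) f (vid (htgt D q))"
    unfolding \<kappa>_def using cell_comp[OF \<mu>c \<eta>q] V.ide_left[OF F(1)] V.ide_left[OF v] by simp
  then show "cell D (\<mu> \<bullet> (\<eta> \<otimes> Hid q)) q (F \<odot> q) f (vid (htgt D q))" unfolding \<kappa>_def .
  have o: "(F, q) \<in> Obj (comp_pairs D)" "(hid D X, q) \<in> Obj (comp_pairs D)"
    "(F, hid D X) \<in> Obj (comp_pairs D)"
    using F assms comp_pairs_Obj hid_obj hsrc_hid htgt_hid by auto
  note Fq = hcomp_obj[OF o(1), unfolded F(9)]
  have fq: "cell D (Hid F) F F (vid A) (vid X)" using cell_Hid[OF F(8)] F(9,10) by simp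
  \<comment> \<open>Invertibility of \<open>e\<close> takes the place of a zig-zag equation for
    \<open>F \<odot> q\<close>.\<close>
  define e where "e = (c \<otimes> \<kappa>) \<bullet> lunit D (F \<odot> q)"
  have c\<kappa>: "cell D (c \<otimes> \<kappa>) (F \<odot> q) (hid D A \<odot> (F \<odot> q)) (vid A) (vid (htgt D q))"
    using cell_hcomp[OF c \<kappa>] .
  have lFq: "globular_iso D (lunit D (F \<odot> q)) (hid D A \<odot> (F \<odot> q)) (F \<odot> q)"
    using lunit_iso[OF Fq(1)] Fq(2) by simp
  have "c \<otimes> \<kappa> = (Hid F \<otimes> \<mu>) \<bullet> (c \<otimes> (\<eta> \<otimes> Hid q))"
    unfolding \<kappa>_def using interchange[OF fq \<mu>c c \<eta>q] cell_Hid_left[OF c] by simp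
  moreover have "globular_iso D (Hid F \<otimes> \<mu>) (F \<odot> q) (F \<odot> (hid D X \<odot> q))"
    using globular_iso_hcomp[OF globular_iso_Hid[OF F(8)] \<mu>(1)] F(10) assms(3) by simp
  \<comment> \<open>Naturality of the associator relates this cell to
    \<open>(c \<otimes> \<eta>) \<otimes> Hid q\<close>, which is invertible by
    \<open>conjoint_counit_unit_iso\<close>.\<close>
  moreover have "globular_iso D (c \<otimes> (\<eta> \<otimes> Hid q)) (F \<odot> (hid D X \<odot> q)) (hid D A \<odot> (F \<odot> q))"
  proof (rule globular_iso_cancel_left)
    show a: "globular_iso D (assoc D F (hid D X) q) ((F \<odot> hid D X) \<odot> q) (F \<odot> (hid D X \<odot> q))"
      using assoc_iso[OF o(3,2)] .
    show "c \<otimes> (\<eta> \<otimes> Hid q) \<in> hom (Hor D) (F \<odot> (hid D X \<odot> q)) (hid D A \<odot> (F \<odot> q))"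
      using cellD(1)[OF cell_hcomp[OF c \<eta>q]] .
    have i: "globular_iso D (c \<otimes> \<eta>) (F \<odot> hid D X) (hid D A \<odot> F)"
      using conjoint_counit_unit_iso[OF assms(1)] .
    have "globular_iso D ((c \<otimes> \<eta>) \<otimes> Hid q) ((F \<odot> hid D X) \<odot> q) ((hid D A \<odot> F) \<odot> q)"
      using globular_iso_hcomp[OF i globular_iso_Hid[OF assms(2)]] hcomp_obj[OF o(3)] htgt_hid F(7)
        assms(3) by simp
    moreover have "globular_iso D (assoc D (hid D A) F q) ((hid D A \<odot> F) \<odot> q) (hid D A \<odot> (F \<odot> q))"
      using assoc_iso o(1) F hid_obj htgt_hid comp_pairs_Obj by simp
    moreover have "((c \<otimes> \<eta>) \<otimes> Hid q) \<bullet> assoc D (hid D A) F q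
        = assoc D F (hid D X) q \<bullet> (c \<otimes> (\<eta> \<otimes> Hid q))"
      using assoc_natural[of c \<eta> "Hid q"] cellD(1-4)[OF c] cellD(1-4)[OF \<eta>] cellD(1-4)[OF q]
      by (simp add: comp_pairs_Arr)
    ultimately show "globular_iso D (assoc D F (hid D X) q \<bullet> (c \<otimes> (\<eta> \<otimes> Hid q)))
        ((F \<odot> hid D X) \<odot> q) (hid D A \<odot> (F \<odot> q))"
      using globular_iso_comp by metis
  qed
  ultimately have e: "globular_iso D e (F \<odot> q) (F \<odot> q)"
    unfolding e_def using globular_iso_comp lFq by metis
  have "opcartesian_cell D \<kappa>"
  proof (rule opcart_cellI[OF \<kappa>])
    fix r \<psi> u v
    assume \<psi>: "cell D \<psi> q r (f \<cdot> u) (vid (htgt D q) \<cdot> v)"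
      and u: "u \<in> vhom (hsrc D (F \<odot> q)) (hsrc D r)" and v: "v \<in> vhom (htgt D (F \<odot> q)) (htgt D r)"
    have u: "u \<in> vhom A (hsrc D r)" and v: "v \<in> vhom (htgt D q) (htgt D r)" using u v Fq by auto
    have \<psi>: "cell D \<psi> q r (f \<cdot> u) v" using \<psi> V.ide_left[OF v] by simp
    note r = cellD(6)[OF \<psi>]
    have lr: "cell D (lunit D r) (hid D (hsrc D r) \<odot> r) r (vid (hsrc D r)) (vid (htgt D r))"
      using lunit_cell[OF r] .
    have cu: "cell D (c \<bullet> cid D u) F (hid D (hsrc D r)) u (f \<cdot> u)"
      using cell_comp[OF c cell_cid[OF u]] V.ide_left[OF u] by simp
    note cu\<psi> = cell_hcomp[OF cu \<psi>]
    \<comment> \<open>The counit pushed along u stands beside \<psi>. After \<kappa> it becomes the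
      identity cell \<open>cid D (f \<cdot> u)\<close>, which the left unitor absorbs.\<close>
    define \<chi> where "\<chi> = ((c \<bullet> cid D u) \<otimes> \<psi>) \<bullet> lunit D r"
    have \<chi>: "cell D \<chi> (F \<odot> q) r u v"
      unfolding \<chi>_def using cell_comp[OF cu\<psi> lr] V.ide_right[OF u] V.ide_right[OF v] by simp
    have "\<kappa> \<bullet> \<chi> = \<mu> \<bullet> (((\<eta> \<otimes> Hid q) \<bullet> ((c \<bullet> cid D u) \<otimes> \<psi>)) \<bullet> lunit D r)"
      unfolding \<kappa>_def \<chi>_def
      using cell_comp_assoc[OF \<mu>c \<eta>q \<chi>[unfolded \<chi>_def]] cell_comp_assoc[OF \<eta>q cu\<psi> lr] by simp
    also have "(\<eta> \<otimes> Hid q) \<bullet> ((c \<bullet> cid D u) \<otimes> \<psi>) = (\<eta> \<bullet> (c \<bullet> cid D u)) \<otimes> \<psi>"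
      using interchange[OF \<eta> q cu \<psi>] cell_Hid_left[OF \<psi>] by simp
    also have "\<eta> \<bullet> (c \<bullet> cid D u) = cid D (f \<cdot> u)"
      using cell_comp_assoc[OF \<eta> c cell_cid[OF u]] F(5) idf.map_comp[OF F(1) u] by simp
    also have "(cid D (f \<cdot> u) \<otimes> \<psi>) \<bullet> lunit D r = lunit D q \<bullet> \<psi>"
      using lunit_natural[OF cellD(1)[OF \<psi>]] cellD(2)[OF \<psi>] by simp
    also have "\<mu> \<bullet> \<dots> = \<psi>"
      using cell_comp_assoc[OF \<mu>c lu \<psi>] \<mu>(2) cell_Hid_left[OF \<psi>] by simp
    finally show "\<exists>\<chi>. cell D \<chi> (F \<odot> q) r u v \<and> \<kappa> \<bullet> \<chi> = \<psi>" using \<chi> by blast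
  next
    fix r \<chi> \<chi>' u v
    assume \<chi>: "cell D \<chi> (F \<odot> q) r u v" "cell D \<chi>' (F \<odot> q) r u v" and eq: "\<kappa> \<bullet> \<chi> = \<kappa> \<bullet> \<chi>'"
    have u: "u \<in> vhom A (hsrc D r)" and v: "v \<in> vhom (htgt D q) (htgt D r)"
      using cellD(7,8)[OF \<chi>(1)] Fq by auto
    note r = cellD(6)[OF \<chi>(1)]
    have lr: "cell D (lunit D r) (hid D (hsrc D r) \<odot> r) r (vid (hsrc D r)) (vid (htgt D r))"
      using lunit_cell[OF r] .
    \<comment> \<open>The right-hand side contains \<xi> only through
      \<open>\<kappa> \<bullet> \<xi>\<close>, so cells that agree after \<kappa> agree after the
      isomorphism e.\<close>
    have "e \<bullet> \<xi> = ((c \<bullet> cid D u) \<otimes> (\<kappa> \<bullet> \<xi>)) \<bullet> lunit D r" if \<xi>: "cell D \<xi> (F \<odot> q) r u v" for \<xi>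
    proof -
      note l = globular_isoD(2)[OF lFq] and u\<xi> = cell_hcomp[OF cell_cid[OF u] \<xi>]
      have "e \<bullet> \<xi> = (c \<otimes> \<kappa>) \<bullet> (lunit D (F \<odot> q) \<bullet> \<xi>)"
        unfolding e_def using cell_comp_assoc[OF c\<kappa> l \<xi>] .
      also have "lunit D (F \<odot> q) \<bullet> \<xi> = (cid D u \<otimes> \<xi>) \<bullet> lunit D r"
        using lunit_natural[OF cellD(1)[OF \<xi>]] cellD(2)[OF \<xi>] by simp
      also have "(c \<otimes> \<kappa>) \<bullet> \<dots> = ((c \<otimes> \<kappa>) \<bullet> (cid D u \<otimes> \<xi>)) \<bullet> lunit D r"
        using cell_comp_assoc[OF c\<kappa> u\<xi> lr] by simp
      also have "(c \<otimes> \<kappa>) \<bullet> (cid D u \<otimes> \<xi>) = (c \<bullet> cid D u) \<otimes> (\<kappa> \<bullet> \<xi>)"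
        using interchange[OF c \<kappa> cell_cid[OF u] \<xi>] by simp
      finally show ?thesis .
    qed
    then have "e \<bullet> \<chi> = e \<bullet> \<chi>'" using \<chi> eq by metis
    then show "\<chi> = \<chi>'"
      using H.iso_epi[OF globular_isoD(1)[OF e]] cellD(1) globular_isoD(2)[OF e] \<chi> by blast
  qed
  then show "opcartesian_cell D (\<mu> \<bullet> (\<eta> \<otimes> Hid q))" unfolding \<kappa>_def .
qed

text \<open>Mirror image of \<open>conjoint_opcart\<close>: composing with the companion of g is
  pushforward along g on the target side. The counit now stands to the right of the given cell and
  is absorbed by the right unitor.\<close>

lemma companion_opcart:
  assumes "companion g A B G \<eta> c" "q \<in> Obj (Hor D)" "htgt D q = A"
    and \<mu>: "globular_iso D \<mu> q (q \<odot> hid D A)" "\<mu> \<bullet> runit D q = Hid q"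
  shows "cell D (\<mu> \<bullet> (Hid q \<otimes> \<eta>)) q (q \<odot> G) (vid (hsrc D q)) g"
    "opcartesian_cell D (\<mu> \<bullet> (Hid q \<otimes> \<eta>))"
proof -
  note G = companionD[OF assms(1)]
  note \<eta> = G(2) and c = G(3)
  define \<kappa> where "\<kappa> = \<mu> \<bullet> (Hid q \<otimes> \<eta>)"
  note \<mu>c = globular_isoD(2)[OF \<mu>(1), unfolded assms(3)]
  have q: "cell D (Hid q) q q (vid (hsrc D q)) (vid A)" using cell_Hid[OF assms(2)] assms(3) by simp
  have ru: "cell D (runit D q) (q \<odot> hid D A) q (vid (hsrc D q)) (vid A)"
    using runit_cell[OF assms(2)] assms(3) by simp
  have v: "vid (hsrc D q) \<in> vhom (hsrc D q) (hsrc D q)" using V.ide_hom src.map_obj assms(2) by blast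
  have q\<eta>: "cell D (Hid q \<otimes> \<eta>) (q \<odot> hid D A) (q \<odot> G) (vid (hsrc D q)) g"
    using cell_hcomp[OF q \<eta>] .
  have \<kappa>: "cell D \<kappa> q (q \<odot> G) (vid (hsrc D q)) g"
    unfolding \<kappa>_def using cell_comp[OF \<mu>c q\<eta>] V.ide_left[OF G(1)] V.ide_left[OF v] by simp
  then show "cell D (\<mu> \<bullet> (Hid q \<otimes> \<eta>)) q (q \<odot> G) (vid (hsrc D q)) g" unfolding \<kappa>_def .
  have o: "(q, G) \<in> Obj (comp_pairs D)" "(q, hid D A) \<in> Obj (comp_pairs D)"
    "(hid D A, G) \<in> Obj (comp_pairs D)" "(G, hid D B) \<in> Obj (comp_pairs D)"
    using G assms comp_pairs_Obj hid_obj hsrc_hid htgt_hid by auto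
  note qG = hcomp_obj[OF o(1), unfolded G(10)]
  have gq: "cell D (Hid G) G G (vid A) (vid B)" using cell_Hid[OF G(8)] G(9,10) by simp
  define e where "e = (\<kappa> \<otimes> c) \<bullet> runit D (q \<odot> G)"
  have \<kappa>_c: "cell D (\<kappa> \<otimes> c) (q \<odot> G) ((q \<odot> G) \<odot> hid D B) (vid (hsrc D q)) (vid B)"
    using cell_hcomp[OF \<kappa> c] .
  have rqG: "globular_iso D (runit D (q \<odot> G)) ((q \<odot> G) \<odot> hid D B) (q \<odot> G)"
    using runit_iso[OF qG(1)] qG(3) by simp
  have "\<kappa> \<otimes> c = (\<mu> \<otimes> Hid G) \<bullet> ((Hid q \<otimes> \<eta>) \<otimes> c)"
    unfolding \<kappa>_def using interchange[OF \<mu>c gq q\<eta> c] cell_Hid_left[OF c] by simp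
  moreover have "globular_iso D (\<mu> \<otimes> Hid G) (q \<odot> G) ((q \<odot> hid D A) \<odot> G)"
    using globular_iso_hcomp[OF \<mu>(1) globular_iso_Hid[OF G(8)]] G(9) assms(3) by simp
  \<comment> \<open>Here the associator follows the cell, and \<open>\<eta> \<otimes> c\<close> is
    invertible by \<open>companion_unit_counit_iso\<close>.\<close>
  moreover have "globular_iso D ((Hid q \<otimes> \<eta>) \<otimes> c) ((q \<odot> hid D A) \<odot> G) ((q \<odot> G) \<odot> hid D B)"
  proof (rule globular_iso_cancel_right)
    show "globular_iso D (assoc D q G (hid D B)) ((q \<odot> G) \<odot> hid D B) (q \<odot> (G \<odot> hid D B))"
      using assoc_iso[OF o(1,4)] .
    show "(Hid q \<otimes> \<eta>) \<otimes> c \<in> hom (Hor D) ((q \<odot> hid D A) \<odot> G) ((q \<odot> G) \<odot> hid D B)"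
      using cellD(1)[OF cell_hcomp[OF q\<eta> c]] .
    have i: "globular_iso D (\<eta> \<otimes> c) (hid D A \<odot> G) (G \<odot> hid D B)"
      using companion_unit_counit_iso[OF assms(1)] .
    have "globular_iso D (Hid q \<otimes> (\<eta> \<otimes> c)) (q \<odot> (hid D A \<odot> G)) (q \<odot> (G \<odot> hid D B))"
      using globular_iso_hcomp[OF globular_iso_Hid[OF assms(2)] i] hcomp_obj[OF o(3)] hsrc_hid G(6)
        assms(3) by simp
    moreover have "globular_iso D (assoc D q (hid D A) G) ((q \<odot> hid D A) \<odot> G) (q \<odot> (hid D A \<odot> G))"
      using assoc_iso[OF o(2,3)] .
    moreover have "((Hid q \<otimes> \<eta>) \<otimes> c) \<bullet> assoc D q G (hid D B)
        = assoc D q (hid D A) G \<bullet> (Hid q \<otimes> (\<eta> \<otimes> c))"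
      using assoc_natural[of "Hid q" \<eta> c] cellD(1-4)[OF c] cellD(1-4)[OF \<eta>] cellD(1-4)[OF q]
      by (simp add: comp_pairs_Arr)
    ultimately show "globular_iso D (((Hid q \<otimes> \<eta>) \<otimes> c) \<bullet> assoc D q G (hid D B))
        ((q \<odot> hid D A) \<odot> G) (q \<odot> (G \<odot> hid D B))"
      using globular_iso_comp by metis
  qed
  ultimately have e: "globular_iso D e (q \<odot> G) (q \<odot> G)"
    unfolding e_def using globular_iso_comp rqG by metis
  have "opcartesian_cell D \<kappa>"
  proof (rule opcart_cellI[OF \<kappa>])
    fix r \<psi> u v
    assume \<psi>: "cell D \<psi> q r (vid (hsrc D q) \<cdot> u) (g \<cdot> v)"
      and u: "u \<in> vhom (hsrc D (q \<odot> G)) (hsrc D r)" and v: "v \<in> vhom (htgt D (q \<odot> G)) (htgt D r)"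
    have u: "u \<in> vhom (hsrc D q) (hsrc D r)" and v: "v \<in> vhom B (htgt D r)" using u v qG by auto
    have \<psi>: "cell D \<psi> q r u (g \<cdot> v)" using \<psi> V.ide_left[OF u] by simp
    note r = cellD(6)[OF \<psi>]
    have rr: "cell D (runit D r) (r \<odot> hid D (htgt D r)) r (vid (hsrc D r)) (vid (htgt D r))"
      using runit_cell[OF r] .
    have cv: "cell D (c \<bullet> cid D v) G (hid D (htgt D r)) (g \<cdot> v) v"
      using cell_comp[OF c cell_cid[OF v]] V.ide_left[OF v] by simp
    note \<psi>cv = cell_hcomp[OF \<psi> cv]
    define \<chi> where "\<chi> = (\<psi> \<otimes> (c \<bullet> cid D v)) \<bullet> runit D r"
    have \<chi>: "cell D \<chi> (q \<odot> G) r u v"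
      unfolding \<chi>_def using cell_comp[OF \<psi>cv rr] V.ide_right[OF u] V.ide_right[OF v] by simp
    have "\<kappa> \<bullet> \<chi> = \<mu> \<bullet> (((Hid q \<otimes> \<eta>) \<bullet> (\<psi> \<otimes> (c \<bullet> cid D v))) \<bullet> runit D r)"
      unfolding \<kappa>_def \<chi>_def
      using cell_comp_assoc[OF \<mu>c q\<eta> \<chi>[unfolded \<chi>_def]] cell_comp_assoc[OF q\<eta> \<psi>cv rr] by simp
    also have "(Hid q \<otimes> \<eta>) \<bullet> (\<psi> \<otimes> (c \<bullet> cid D v)) = \<psi> \<otimes> (\<eta> \<bullet> (c \<bullet> cid D v))"
      using interchange[OF q \<eta> \<psi> cv] cell_Hid_left[OF \<psi>] by simp
    also have "\<eta> \<bullet> (c \<bullet> cid D v) = cid D (g \<cdot> v)"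
      using cell_comp_assoc[OF \<eta> c cell_cid[OF v]] G(5) idf.map_comp[OF G(1) v] by simp
    also have "(\<psi> \<otimes> cid D (g \<cdot> v)) \<bullet> runit D r = runit D q \<bullet> \<psi>"
      using runit_natural[OF cellD(1)[OF \<psi>]] cellD(3)[OF \<psi>] by simp
    also have "\<mu> \<bullet> \<dots> = \<psi>"
      using cell_comp_assoc[OF \<mu>c ru \<psi>] \<mu>(2) cell_Hid_left[OF \<psi>] by simp
    finally show "\<exists>\<chi>. cell D \<chi> (q \<odot> G) r u v \<and> \<kappa> \<bullet> \<chi> = \<psi>" using \<chi> by blast
  next
    fix r \<chi> \<chi>' u v
    assume \<chi>: "cell D \<chi> (q \<odot> G) r u v" "cell D \<chi>' (q \<odot> G) r u v" and eq: "\<kappa> \<bullet> \<chi> = \<kappa> \<bullet> \<chi>'"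
    have u: "u \<in> vhom (hsrc D q) (hsrc D r)" and v: "v \<in> vhom B (htgt D r)"
      using cellD(7,8)[OF \<chi>(1)] qG by auto
    note r = cellD(6)[OF \<chi>(1)]
    have rr: "cell D (runit D r) (r \<odot> hid D (htgt D r)) r (vid (hsrc D r)) (vid (htgt D r))"
      using runit_cell[OF r] .
    have "e \<bullet> \<xi> = ((\<kappa> \<bullet> \<xi>) \<otimes> (c \<bullet> cid D v)) \<bullet> runit D r" if \<xi>: "cell D \<xi> (q \<odot> G) r u v" for \<xi>
    proof -
      note l = globular_isoD(2)[OF rqG] and \<xi>v = cell_hcomp[OF \<xi> cell_cid[OF v]]
      have "e \<bullet> \<xi> = (\<kappa> \<otimes> c) \<bullet> (runit D (q \<odot> G) \<bullet> \<xi>)"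
        unfolding e_def using cell_comp_assoc[OF \<kappa>_c l \<xi>] .
      also have "runit D (q \<odot> G) \<bullet> \<xi> = (\<xi> \<otimes> cid D v) \<bullet> runit D r"
        using runit_natural[OF cellD(1)[OF \<xi>]] cellD(3)[OF \<xi>] by simp
      also have "(\<kappa> \<otimes> c) \<bullet> \<dots> = ((\<kappa> \<otimes> c) \<bullet> (\<xi> \<otimes> cid D v)) \<bullet> runit D r"
        using cell_comp_assoc[OF \<kappa>_c \<xi>v rr] by simp
      also have "(\<kappa> \<otimes> c) \<bullet> (\<xi> \<otimes> cid D v) = (\<kappa> \<bullet> \<xi>) \<otimes> (c \<bullet> cid D v)"
        using interchange[OF \<kappa> c \<xi> cell_cid[OF v]] by simp
      finally show ?thesis .
    qed
    then have "e \<bullet> \<chi> = e \<bullet> \<chi>'" using \<chi> eq by metis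
    then show "\<chi> = \<chi>'"
      using H.iso_epi[OF globular_isoD(1)[OF e]] cellD(1) globular_isoD(2)[OF e] \<chi> by blast
  qed
  then show "opcartesian_cell D (\<mu> \<bullet> (Hid q \<otimes> \<eta>))" unfolding \<kappa>_def .
qed

text \<open>Composing with the companion of g on the left is also restriction along g on the source
  side. This time the unit \<eta> builds the lifts and the counit c forms the universal
  cell.\<close>

lemma companion_cart:
  assumes "companion g A B G \<eta> c" "q \<in> Obj (Hor D)" "hsrc D q = B"
  shows "cell D ((c \<otimes> Hid q) \<bullet> lunit D q) (G \<odot> q) q g (vid (htgt D q))"
    "cartesian_cell D ((c \<otimes> Hid q) \<bullet> lunit D q)"
proof -
  note G = companionD[OF assms(1)]
  note \<eta> = G(2) and c = G(3)
  define \<kappa> where "\<kappa> = (c \<otimes> Hid q) \<bullet> lunit D q"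
  have q: "cell D (Hid q) q q (vid B) (vid (htgt D q))" using cell_Hid[OF assms(2)] assms(3) by simp
  have lu_iso: "globular_iso D (lunit D q) (hid D B \<odot> q) q"
    using lunit_iso[OF assms(2)] assms(3) by simp
  have lu: "cell D (lunit D q) (hid D B \<odot> q) q (vid B) (vid (htgt D q))"
    using lunit_cell[OF assms(2)] assms(3) by simp
  have v: "vid (htgt D q) \<in> vhom (htgt D q) (htgt D q)" using V.ide_hom tgt.map_obj assms(2) by blast
  have cq: "cell D (c \<otimes> Hid q) (G \<odot> q) (hid D B \<odot> q) g (vid (htgt D q))"
    using cell_hcomp[OF c q] .
  have \<kappa>: "cell D \<kappa> (G \<odot> q) q g (vid (htgt D q))"
    unfolding \<kappa>_def using cell_comp[OF cq lu] V.ide_right[OF G(1)] V.ide_left[OF v] by simp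
  then show "cell D ((c \<otimes> Hid q) \<bullet> lunit D q) (G \<odot> q) q g (vid (htgt D q))" unfolding \<kappa>_def .
  have o: "(G, q) \<in> Obj (comp_pairs D)" "(hid D B, q) \<in> Obj (comp_pairs D)"
    "(G, hid D B) \<in> Obj (comp_pairs D)" "(hid D A, G) \<in> Obj (comp_pairs D)"
    using G assms comp_pairs_Obj hid_obj hsrc_hid htgt_hid by auto
  note Gq = hcomp_obj[OF o(1), unfolded G(9)]
  obtain \<mu> where \<mu>: "globular_iso D \<mu> (G \<odot> q) (hid D A \<odot> (G \<odot> q))"
    "lunit D (G \<odot> q) \<bullet> \<mu> = Hid (hid D A \<odot> (G \<odot> q))"
    using lunit_inverse[OF Gq(1)] Gq(2) by metis
  \<comment> \<open>As the competing cells now end in \<open>G \<odot> q\<close>, this automorphism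
    is composed after them.\<close>
  define e where "e = \<mu> \<bullet> (\<eta> \<otimes> \<kappa>)"
  have \<eta>\<kappa>: "cell D (\<eta> \<otimes> \<kappa>) (hid D A \<odot> (G \<odot> q)) (G \<odot> q) (vid A) (vid (htgt D q))"
    using cell_hcomp[OF \<eta> \<kappa>] .
  have fG: "cell D (Hid G) G G (vid A) (vid B)" using cell_Hid[OF G(8)] G(9,10) by simp
  have "\<eta> \<otimes> \<kappa> = (\<eta> \<otimes> (c \<otimes> Hid q)) \<bullet> (Hid G \<otimes> lunit D q)"
    unfolding \<kappa>_def using interchange[OF \<eta> cq fG lu] cell_Hid_right[OF \<eta>] by simp
  moreover have "globular_iso D (Hid G \<otimes> lunit D q) (G \<odot> (hid D B \<odot> q)) (G \<odot> q)"
    using globular_iso_hcomp[OF globular_iso_Hid[OF G(8)] lu_iso] G hcomp_obj[OF o(2)] hsrc_hid by simp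
  moreover have "globular_iso D (\<eta> \<otimes> (c \<otimes> Hid q)) (hid D A \<odot> (G \<odot> q)) (G \<odot> (hid D B \<odot> q))"
  proof (rule globular_iso_cancel_left)
    show "globular_iso D (assoc D (hid D A) G q) ((hid D A \<odot> G) \<odot> q) (hid D A \<odot> (G \<odot> q))"
      using assoc_iso[OF o(4,1)] .
    show "\<eta> \<otimes> (c \<otimes> Hid q) \<in> hom (Hor D) (hid D A \<odot> (G \<odot> q)) (G \<odot> (hid D B \<odot> q))"
      using cellD(1)[OF cell_hcomp[OF \<eta> cq]] .
    have i: "globular_iso D (\<eta> \<otimes> c) (hid D A \<odot> G) (G \<odot> hid D B)"
      using companion_unit_counit_iso[OF assms(1)] .
    have "globular_iso D ((\<eta> \<otimes> c) \<otimes> Hid q) ((hid D A \<odot> G) \<odot> q) ((G \<odot> hid D B) \<odot> q)"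
      using globular_iso_hcomp[OF i globular_iso_Hid[OF assms(2)]] hcomp_obj[OF o(4)] G(10)
        assms(3) by simp
    moreover have "globular_iso D (assoc D G (hid D B) q) ((G \<odot> hid D B) \<odot> q) (G \<odot> (hid D B \<odot> q))"
      using assoc_iso[OF o(3,2)] .
    moreover have "((\<eta> \<otimes> c) \<otimes> Hid q) \<bullet> assoc D G (hid D B) q
        = assoc D (hid D A) G q \<bullet> (\<eta> \<otimes> (c \<otimes> Hid q))"
      using assoc_natural[of \<eta> c "Hid q"] cellD(1-4)[OF c] cellD(1-4)[OF \<eta>] cellD(1-4)[OF q]
      by (simp add: comp_pairs_Arr)
    ultimately show "globular_iso D (assoc D (hid D A) G q \<bullet> (\<eta> \<otimes> (c \<otimes> Hid q)))
        ((hid D A \<odot> G) \<odot> q) (G \<odot> (hid D B \<odot> q))"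
      using globular_iso_comp by metis
  qed
  ultimately have e: "globular_iso D e (G \<odot> q) (G \<odot> q)"
    unfolding e_def using globular_iso_comp \<mu>(1) by metis
  have "cartesian_cell D \<kappa>"
  proof (rule cart_cellI[OF \<kappa>])
    fix r \<psi> u v
    assume \<psi>: "cell D \<psi> r q (u \<cdot> g) (v \<cdot> vid (htgt D q))"
      and u: "u \<in> vhom (hsrc D r) (hsrc D (G \<odot> q))" and v: "v \<in> vhom (htgt D r) (htgt D (G \<odot> q))"
    have u: "u \<in> vhom (hsrc D r) A" and v: "v \<in> vhom (htgt D r) (htgt D q)" using u v Gq by auto
    have \<psi>: "cell D \<psi> r q (u \<cdot> g) v" using \<psi> V.ide_right[OF v] by simp
    note r = cellD(5)[OF \<psi>]
    obtain \<nu> where \<nu>: "globular_iso D \<nu> r (hid D (hsrc D r) \<odot> r)" "\<nu> \<bullet> lunit D r = Hid r"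
      using lunit_inverse[OF r] by metis
    note \<nu>c = globular_isoD(2)[OF \<nu>(1)]
    have lr: "cell D (lunit D r) (hid D (hsrc D r) \<odot> r) r (vid (hsrc D r)) (vid (htgt D r))"
      using lunit_cell[OF r] .
    have u\<eta>: "cell D (cid D u \<bullet> \<eta>) (hid D (hsrc D r)) G u (u \<cdot> g)"
      using cell_comp[OF cell_cid[OF u] \<eta>] V.ide_right[OF u] by simp
    note u\<eta>\<psi> = cell_hcomp[OF u\<eta> \<psi>]
    \<comment> \<open>The inverse unitor inserts an identity beside r to make room for
      \<open>cid D u \<bullet> \<eta>\<close>; following it by c gives
      \<open>cid D (u \<cdot> g)\<close>, which the left unitor removes.\<close>
    define \<chi> where "\<chi> = \<nu> \<bullet> ((cid D u \<bullet> \<eta>) \<otimes> \<psi>)"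
    have \<chi>: "cell D \<chi> r (G \<odot> q) u v"
      unfolding \<chi>_def using cell_comp[OF \<nu>c u\<eta>\<psi>] V.ide_left[OF u] V.ide_left[OF v] by simp
    have "\<chi> \<bullet> \<kappa> = \<nu> \<bullet> ((((cid D u \<bullet> \<eta>) \<otimes> \<psi>) \<bullet> (c \<otimes> Hid q)) \<bullet> lunit D q)"
      unfolding \<chi>_def \<kappa>_def
      using cell_comp_assoc[OF \<nu>c u\<eta>\<psi> \<kappa>[unfolded \<kappa>_def]] cell_comp_assoc[OF u\<eta>\<psi> cq lu] by simp
    also have "((cid D u \<bullet> \<eta>) \<otimes> \<psi>) \<bullet> (c \<otimes> Hid q) = ((cid D u \<bullet> \<eta>) \<bullet> c) \<otimes> \<psi>"
      using interchange[OF u\<eta> \<psi> c q] cell_Hid_right[OF \<psi>] by simp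
    also have "(cid D u \<bullet> \<eta>) \<bullet> c = cid D (u \<cdot> g)"
      using cell_comp_assoc[OF cell_cid[OF u] \<eta> c] G(5) idf.map_comp[OF u G(1)] by simp
    also have "(cid D (u \<cdot> g) \<otimes> \<psi>) \<bullet> lunit D q = lunit D r \<bullet> \<psi>"
      using lunit_natural[OF cellD(1)[OF \<psi>]] cellD(2)[OF \<psi>] by simp
    also have "\<nu> \<bullet> \<dots> = \<psi>"
      using cell_comp_assoc[OF \<nu>c lr \<psi>] \<nu>(2) cell_Hid_left[OF \<psi>] by simp
    finally show "\<exists>\<chi>. cell D \<chi> r (G \<odot> q) u v \<and> \<chi> \<bullet> \<kappa> = \<psi>" using \<chi> by blast
  next
    fix r \<chi> \<chi>' u v
    assume \<chi>: "cell D \<chi> r (G \<odot> q) u v" "cell D \<chi>' r (G \<odot> q) u v" and eq: "\<chi> \<bullet> \<kappa> = \<chi>' \<bullet> \<kappa>"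
    have u: "u \<in> vhom (hsrc D r) A" and v: "v \<in> vhom (htgt D r) (htgt D q)"
      using cellD(7,8)[OF \<chi>(1)] Gq by auto
    note r = cellD(5)[OF \<chi>(1)]
    note lr = lunit_cell[OF r]
    have l: "cell D (lunit D (G \<odot> q)) (hid D A \<odot> (G \<odot> q)) (G \<odot> q) (vid A) (vid (htgt D q))"
      using lunit_cell[OF Gq(1)] Gq by simp
    note \<mu>c = globular_isoD(2)[OF \<mu>(1)] and ec = globular_isoD(2)[OF e]
    \<comment> \<open>\<xi> enters the right-hand side only through
      \<open>\<xi> \<bullet> \<kappa>\<close>. The invertible unitor and the invertible e are then
      cancelled from the two ends.\<close>
    have "lunit D r \<bullet> (\<xi> \<bullet> e) = (cid D u \<bullet> \<eta>) \<otimes> (\<xi> \<bullet> \<kappa>)" if \<xi>: "cell D \<xi> r (G \<odot> q) u v" for \<xi>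
    proof -
      note u\<xi> = cell_hcomp[OF cell_cid[OF u] \<xi>]
      have "lunit D r \<bullet> (\<xi> \<bullet> e) = (lunit D r \<bullet> \<xi>) \<bullet> e"
        using cell_comp_assoc[OF lr \<xi> ec] by simp
      also have "lunit D r \<bullet> \<xi> = (cid D u \<otimes> \<xi>) \<bullet> lunit D (G \<odot> q)"
        using lunit_natural[OF cellD(1)[OF \<xi>]] cellD(2)[OF \<xi>] by simp
      also have "\<dots> \<bullet> e = (cid D u \<otimes> \<xi>) \<bullet> (lunit D (G \<odot> q) \<bullet> e)"
        using cell_comp_assoc[OF u\<xi> l ec] .
      also have "lunit D (G \<odot> q) \<bullet> e = \<eta> \<otimes> \<kappa>"
        unfolding e_def using cell_comp_assoc[OF l \<mu>c \<eta>\<kappa>] \<mu>(2) cell_Hid_left[OF \<eta>\<kappa>] by simp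
      also have "(cid D u \<otimes> \<xi>) \<bullet> (\<eta> \<otimes> \<kappa>) = (cid D u \<bullet> \<eta>) \<otimes> (\<xi> \<bullet> \<kappa>)"
        using interchange[OF cell_cid[OF u] \<xi> \<eta> \<kappa>] by simp
      finally show ?thesis .
    qed
    then have "lunit D r \<bullet> (\<chi> \<bullet> e) = lunit D r \<bullet> (\<chi>' \<bullet> e)" using \<chi> eq by metis
    then have "\<chi> \<bullet> e = \<chi>' \<bullet> e"
      using H.iso_epi[OF globular_isoD(1)[OF lunit_iso[OF r]] cellD(1)[OF lr]] \<chi>
        cellD(1)[OF cell_comp[OF _ ec refl refl]] by blast
    then show "\<chi> = \<chi>'"
      using H.iso_mono[OF globular_isoD(1)[OF e] cellD(1)[OF ec]] cellD(1) \<chi> by blast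
  qed
  then show "cartesian_cell D ((c \<otimes> Hid q) \<bullet> lunit D q)" unfolding \<kappa>_def .
qed

end

section \<open>Opcartesian units and whiskering\<close>

context double_category
begin

lemma opcart_cell_cancel_iso:
  assumes "opcartesian_cell D (\<alpha> \<bullet> \<beta>)" "cell D \<alpha> p q f g" "globular_iso D \<beta> q r"
  shows "opcartesian_cell D \<alpha>"
proof -
  obtain \<beta>' where b': "globular_iso D \<beta>' r q" "\<beta> \<bullet> \<beta>' = Hid q"
    using globular_iso_inverse[OF assms(3)] .
  note b = globular_isoD[OF assms(3)] and c = globular_isoD[OF b'(1)]
  have "\<alpha> = (\<alpha> \<bullet> \<beta>) \<bullet> \<beta>'"
    using cell_comp_assoc[OF assms(2) b(2) c(2)] b'(2) cell_Hid_right[OF assms(2)] by simp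
  then show ?thesis
    using opcart_cell_comp[OF assms(1) opcart_cell_iso[OF c(1)] cell_comp[OF assms(2) b(2) refl refl] c(2)]
    by simp
qed

text \<open>The case \<open>q = hid D A\<close> of \<open>companion_opcart\<close>: naturality of
  the left unitor identifies the cell obtained there with \<eta> up to invertible cells.\<close>

lemma companion_unit_opcart:
  assumes "companion g A B G \<eta> c"
  shows "opcartesian_cell D \<eta>"
proof -
  note G = companionD[OF assms]
  note \<eta> = G(2)
  have I: "hid D A \<in> Obj (Hor D)" "hsrc D (hid D A) = A" "htgt D (hid D A) = A"
    using G hid_obj hsrc_hid htgt_hid by auto
  obtain \<mu> where \<mu>: "globular_iso D \<mu> (hid D A) (hid D A \<odot> hid D A)" "\<mu> \<bullet> runit D (hid D A) = Hid (hid D A)"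
    using runit_inverse[OF I(1)] I(3) by metis
  note \<kappa> = companion_opcart[OF assms I(1,3) \<mu>]
  have IA: "cell D (cid D (vid A)) (hid D A) (hid D A) (vid A) (vid A)"
    using cell_cid V.ide_hom G by blast
  note I\<eta> = cell_hcomp[OF IA \<eta>]
  note \<mu>c = globular_isoD[OF \<mu>(1)]
  have "opcartesian_cell D (\<mu> \<bullet> (cid D (vid A) \<otimes> \<eta>))" using \<kappa>(2) cid_vid G(6) by simp
  then have "opcartesian_cell D (cid D (vid A) \<otimes> \<eta>)"
    using opcart_cell_cancel[OF opcart_cell_iso[OF \<mu>c(1)] _ \<mu>c(2) I\<eta>] by blast
  moreover have lG: "globular_iso D (lunit D G) (hid D A \<odot> G) G"
    using lunit_iso[OF G(8)] G(9) by simp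
  ultimately have "opcartesian_cell D ((cid D (vid A) \<otimes> \<eta>) \<bullet> lunit D G)"
    using opcart_cell_comp opcart_cell_iso globular_isoD(1,2) I\<eta> by blast
  then have "opcartesian_cell D (lunit D (hid D A) \<bullet> \<eta>)"
    using lunit_natural[OF cellD(1)[OF \<eta>]] cellD(2)[OF \<eta>] by simp
  moreover have "globular_iso D (lunit D (hid D A)) (hid D A \<odot> hid D A) (hid D A)"
    using lunit_iso[OF I(1)] I(2) by simp
  ultimately show ?thesis using opcart_cell_cancel opcart_cell_iso globular_isoD(1,2) \<eta> by blast
qed

text \<open>Likewise from \<open>conjoint_opcart\<close> with \<open>q = hid D X\<close>, using the
  right unitor.\<close>

lemma conjoint_unit_opcart:
  assumes "conjoint f X A F \<eta> c"
  shows "opcartesian_cell D \<eta>"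
proof -
  note F = conjointD[OF assms]
  note \<eta> = F(2)
  have I: "hid D X \<in> Obj (Hor D)" "hsrc D (hid D X) = X" "htgt D (hid D X) = X"
    using F hid_obj hsrc_hid htgt_hid by auto
  obtain \<mu> where \<mu>: "globular_iso D \<mu> (hid D X) (hid D X \<odot> hid D X)" "\<mu> \<bullet> lunit D (hid D X) = Hid (hid D X)"
    using lunit_inverse[OF I(1)] I(2) by metis
  note \<kappa> = conjoint_opcart[OF assms I(1,2) \<mu>]
  have IX: "cell D (cid D (vid X)) (hid D X) (hid D X) (vid X) (vid X)"
    using cell_cid V.ide_hom F by blast
  note \<eta>I = cell_hcomp[OF \<eta> IX]
  note \<mu>c = globular_isoD[OF \<mu>(1)]
  have "opcartesian_cell D (\<mu> \<bullet> (\<eta> \<otimes> cid D (vid X)))" using \<kappa>(2) cid_vid F(7) by simp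
  then have "opcartesian_cell D (\<eta> \<otimes> cid D (vid X))"
    using opcart_cell_cancel[OF opcart_cell_iso[OF \<mu>c(1)] _ \<mu>c(2) \<eta>I] by blast
  moreover have rF: "globular_iso D (runit D F) (F \<odot> hid D X) F"
    using runit_iso[OF F(8)] F(10) by simp
  ultimately have "opcartesian_cell D ((\<eta> \<otimes> cid D (vid X)) \<bullet> runit D F)"
    using opcart_cell_comp opcart_cell_iso globular_isoD(1,2) \<eta>I by blast
  then have "opcartesian_cell D (runit D (hid D X) \<bullet> \<eta>)"
    using runit_natural[OF cellD(1)[OF \<eta>]] cellD(3)[OF \<eta>] by simp
  moreover have "globular_iso D (runit D (hid D X)) (hid D X \<odot> hid D X) (hid D X)"
    using runit_iso[OF I(1)] I(3) by simp
  ultimately show ?thesis using opcart_cell_cancel opcart_cell_iso globular_isoD(1,2) \<eta> by blast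
qed

text \<open>Pushforward along g on the target is composition with the companion G on the right, and
  this commutes with composition by z on the left through the associator.\<close>

lemma whisker_opcart:
  assumes "companion g A B G \<eta> c" "cell D \<epsilon> x y (vid (hsrc D x)) g" "opcartesian_cell D \<epsilon>"
    "z \<in> Obj (Hor D)" "htgt D z = hsrc D x"
  shows "cell D (Hid z \<otimes> \<epsilon>) (z \<odot> x) (z \<odot> y) (vid (hsrc D z)) g"
    "opcartesian_cell D (Hid z \<otimes> \<epsilon>)"
proof -
  note G = companionD[OF assms(1)]
  note \<eta> = G(2) and \<epsilon> = assms(2)
  have x: "x \<in> Obj (Hor D)" "htgt D x = A" using cellD[OF \<epsilon>] V.homD(2) G(1) by metis+
  have z: "cell D (Hid z) z z (vid (hsrc D z)) (vid (hsrc D x))"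
    using cell_Hid[OF assms(4)] assms(5) by simp
  show z\<epsilon>: "cell D (Hid z \<otimes> \<epsilon>) (z \<odot> x) (z \<odot> y) (vid (hsrc D z)) g" using cell_hcomp[OF z \<epsilon>] .
  obtain \<mu> where \<mu>: "globular_iso D \<mu> x (x \<odot> hid D A)" "\<mu> \<bullet> runit D x = Hid x"
    using runit_inverse[OF x(1)] x(2) by metis
  note \<kappa> = companion_opcart[OF assms(1) x \<mu>]
  \<comment> \<open>Opcartesian cells with a common source and frame differ by an isomorphism, so
    \<epsilon> is compared with the model cell from x to \<open>x \<odot> G\<close>.\<close>
  obtain \<sigma> where \<sigma>: "globular_iso D \<sigma> y (x \<odot> G)" "\<epsilon> \<bullet> \<sigma> = \<mu> \<bullet> (Hid x \<otimes> \<eta>)"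
    using opcart_cell_unique_iso[OF assms(3) \<kappa>(2) \<epsilon> \<kappa>(1)] .
  have o: "(z, x) \<in> Obj (comp_pairs D)" "(x, G) \<in> Obj (comp_pairs D)" "(x, hid D A) \<in> Obj (comp_pairs D)"
    using assms(4,5) x G hid_obj hsrc_hid comp_pairs_Obj by auto
  note zx = hcomp_obj[OF o(1), unfolded x(2)]
  obtain \<nu> where \<nu>: "globular_iso D \<nu> (z \<odot> x) ((z \<odot> x) \<odot> hid D A)" "\<nu> \<bullet> runit D (z \<odot> x) = Hid (z \<odot> x)"
    using runit_inverse[OF zx(1)] zx(3) by metis
  note \<kappa>' = companion_opcart[OF assms(1) zx(1,3) \<nu>]
  have xc: "cell D (Hid x) x x (vid (hsrc D x)) (vid A)" using cell_Hid[OF x(1)] x(2) by simp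
  have zxc: "cell D (Hid (z \<odot> x)) (z \<odot> x) (z \<odot> x) (vid (hsrc D z)) (vid A)"
    using cell_Hid[OF zx(1)] zx by simp
  note x\<eta> = cell_hcomp[OF xc \<eta>] and zx\<eta> = cell_hcomp[OF zxc \<eta>]
  note zx\<eta>' = cell_hcomp[OF z x\<eta>]
  note a = assoc_iso[OF o(1,2)] and a' = assoc_iso[OF o(1,3)]
  have "opcartesian_cell D (Hid (z \<odot> x) \<otimes> \<eta>)"
    using opcart_cell_cancel[OF opcart_cell_iso \<kappa>'(2) _ zx\<eta>] globular_isoD(1,2)[OF \<nu>(1)] by blast
  then have "opcartesian_cell D ((Hid (z \<odot> x) \<otimes> \<eta>) \<bullet> assoc D z x G)"
    using opcart_cell_comp[OF _ opcart_cell_iso zx\<eta>] globular_isoD(1,2)[OF a] by blast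
  \<comment> \<open>Associativity carries opcartesianness from the model cell of
    \<open>z \<odot> x\<close> to z whiskered with the model cell of x.\<close>
  moreover have "((Hid z \<otimes> Hid x) \<otimes> \<eta>) \<bullet> assoc D z x G = assoc D z x (hid D A) \<bullet> (Hid z \<otimes> (Hid x \<otimes> \<eta>))"
    using assoc_natural[of "Hid z" "Hid x" \<eta>] cellD(1-4)[OF z] cellD(1-4)[OF xc] cellD(1-4)[OF \<eta>]
    by (simp add: comp_pairs_Arr)
  ultimately have "opcartesian_cell D (assoc D z x (hid D A) \<bullet> (Hid z \<otimes> (Hid x \<otimes> \<eta>)))"
    using hcomp_Hid[OF o(1)] by simp
  then have *: "opcartesian_cell D (Hid z \<otimes> (Hid x \<otimes> \<eta>))"
    using opcart_cell_cancel[OF opcart_cell_iso _ _ zx\<eta>'] globular_isoD(1,2)[OF a'] by blast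
  have \<mu>c: "cell D \<mu> x (x \<odot> hid D A) (vid (hsrc D x)) (vid A)"
    using globular_isoD(2)[OF \<mu>(1)] x by simp
  have z\<mu>: "globular_iso D (Hid z \<otimes> \<mu>) (z \<odot> x) (z \<odot> (x \<odot> hid D A))"
    using globular_iso_hcomp[OF globular_iso_Hid[OF assms(4)] \<mu>(1) assms(5)] .
  have "opcartesian_cell D ((Hid z \<otimes> \<mu>) \<bullet> (Hid z \<otimes> (Hid x \<otimes> \<eta>)))"
    using opcart_cell_comp[OF opcart_cell_iso * _ zx\<eta>'] globular_isoD(1,2)[OF z\<mu>] by blast
  moreover have "(Hid z \<otimes> \<mu>) \<bullet> (Hid z \<otimes> (Hid x \<otimes> \<eta>)) = Hid z \<otimes> (\<epsilon> \<bullet> \<sigma>)"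
    using interchange[OF z \<mu>c z x\<eta>] cell_Hid_left[OF z] \<sigma>(2) by simp
  moreover have "y \<in> Obj (Hor D)" "hsrc D y = hsrc D x"
    using cellD(6,7)[OF \<epsilon>] V.homD(3) V.ide_hom src.map_obj[OF x(1)] by metis+
  moreover then have \<sigma>c: "cell D \<sigma> y (x \<odot> G) (vid (hsrc D x)) (vid (htgt D y))"
    using globular_isoD(2)[OF \<sigma>(1)] by simp
  \<comment> \<open>Interchange splits off the invertible factor
    \<open>Hid z \<otimes> \<sigma>\<close>, leaving the whiskering of \<epsilon>.\<close>
  moreover have "Hid z \<otimes> (\<epsilon> \<bullet> \<sigma>) = (Hid z \<otimes> \<epsilon>) \<bullet> (Hid z \<otimes> \<sigma>)"
    using interchange[OF z \<epsilon> z \<sigma>c] cell_Hid_left[OF z] by simp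
  moreover have "globular_iso D (Hid z \<otimes> \<sigma>) (z \<odot> y) (z \<odot> (x \<odot> G))"
    using globular_iso_hcomp[OF globular_iso_Hid[OF assms(4)] \<sigma>(1)] assms(5) calculation by simp
  ultimately show "opcartesian_cell D (Hid z \<otimes> \<epsilon>)"
    using opcart_cell_cancel_iso[OF _ z\<epsilon>] by metis
qed

end

section \<open>Existence of restrictions, companions and conjoints\<close>

locale double_fibration = double_category +
  assumes fib: "fibration (Hor D) (frame_cat D) (hframe D) (cframe D)"
begin

lemma restriction:
  assumes "r \<in> Obj (Hor D)" "u \<in> vhom A (hsrc D r)" "v \<in> vhom B (htgt D r)"
  obtains p \<gamma> where "cell D \<gamma> p r u v" "cartesian_cell D \<gamma>" "p \<in> Obj (Hor D)" "hsrc D p = A" "htgt D p = B"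
proof -
  have "(u, v) \<in> Arr (frame_cat D)" "Cod (frame_cat D) (u, v) = hframe D r"
    using assms by (auto simp: prod_cat_def hom_def)
  then obtain \<gamma> where \<gamma>: "cartesian_cell D \<gamma>" "Cod (Hor D) \<gamma> = r" "cframe D \<gamma> = (u, v)"
    using fib assms(1) unfolding fibration_def cartesian_cell_def by blast
  have "\<gamma> \<in> Arr (Hor D)" using \<gamma>(1) by (simp add: cartesian_cell_def cartesian_arrow_def)
  then have c: "cell D \<gamma> (Dom (Hor D) \<gamma>) r u v" using \<gamma> by (simp add: cell_def hom_def)
  then show ?thesis
    using that \<gamma>(1) cellD(5,7,8)[OF c] V.homD(2) assms(2,3) by metis
qed

lemma companion_exists:
  assumes "g \<in> vhom A B"
  obtains G \<eta> c where "companion g A B G \<eta> c"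
proof -
  have AB: "A \<in> Obj (Ver D)" "B \<in> Obj (Ver D)" using V.homD[OF assms] by auto
  have "g \<in> vhom A (hsrc D (hid D B))" "vid B \<in> vhom B (htgt D (hid D B))"
    using assms hsrc_hid htgt_hid V.ide_hom AB by auto
  then obtain G c where c: "cell D c G (hid D B) g (vid B)" "cartesian_cell D c" "G \<in> Obj (Hor D)"
    "hsrc D G = A" "htgt D G = B"
    using restriction[OF hid_obj[OF AB(2)]] by blast
  have "vid A \<in> vhom (hsrc D (hid D A)) (hsrc D G)" "g \<in> vhom (htgt D (hid D A)) (htgt D G)"
    using assms hsrc_hid htgt_hid V.ide_hom AB c by auto
  then obtain \<eta> where "cell D \<eta> (hid D A) G (vid A) g" "\<eta> \<bullet> c = cid D g"
    using cart_cell_lift[OF c(2,1) cell_cid[OF assms]] V.ide_left[OF assms] V.ide_right[OF assms]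
    by metis
  then show ?thesis using that assms c by (auto simp: companion_def)
qed

lemma conjoint_exists:
  assumes "f \<in> vhom X A"
  obtains F \<eta> c where "conjoint f X A F \<eta> c"
proof -
  have XA: "X \<in> Obj (Ver D)" "A \<in> Obj (Ver D)" using V.homD[OF assms] by auto
  have "vid A \<in> vhom A (hsrc D (hid D A))" "f \<in> vhom X (htgt D (hid D A))"
    using assms hsrc_hid htgt_hid V.ide_hom XA by auto
  then obtain F c where c: "cell D c F (hid D A) (vid A) f" "cartesian_cell D c" "F \<in> Obj (Hor D)"
    "hsrc D F = A" "htgt D F = X"
    using restriction[OF hid_obj[OF XA(2)]] by blast
  have "f \<in> vhom (hsrc D (hid D X)) (hsrc D F)" "vid X \<in> vhom (htgt D (hid D X)) (htgt D F)"
    using assms hsrc_hid htgt_hid V.ide_hom XA c by auto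
  then obtain \<eta> where "cell D \<eta> (hid D X) F f (vid X)" "\<eta> \<bullet> c = cid D f"
    using cart_cell_lift[OF c(2,1) cell_cid[OF assms]] V.ide_left[OF assms] V.ide_right[OF assms]
    by metis
  then show ?thesis using that assms c by (auto simp: conjoint_def)
qed

end

section \<open>Vertical terminal objects\<close>

text \<open>The unit of the adjunction supplies the arrows and cells. A triangle identity makes its
  component at the terminal object an identity, and naturality then gives uniqueness.\<close>

lemma (in double_category) vertical_terminal_universal:
  assumes "vertical_terminal D one"
  shows "one \<in> Obj (Ver D)"
    and "A \<in> Obj (Ver D) \<Longrightarrow> \<exists>!f. f \<in> vhom A one"
    and "p \<in> Obj (Hor D) \<Longrightarrow> \<exists>!\<alpha>. \<alpha> \<in> hom (Hor D) p (hid D one)"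
proof -
  obtain R \<eta> \<epsilon> where adj: "double_adjunction D terminal_dblcat to_terminal R \<eta> \<epsilon>" and R: "FObj R () = one"
    using assms by (auto simp: vertical_terminal_def)
  interpret adj: double_adjunction D terminal_dblcat to_terminal R \<eta> \<epsilon> by fact
  interpret R: pseudo_double_functor terminal_dblcat D R by (rule adj.right_functor)
  interpret RV: is_functor "Ver terminal_dblcat" "Ver D" "FObj R" "FVer R" by (rule R.functor_Ver)
  interpret RH: is_functor "Hor terminal_dblcat" "Hor D" "FHor R" "FCell R" by (rule R.functor_Hor)
  interpret \<eta>: vertical_transformation D D "id_dblfun D" "comp_dblfun D to_terminal R" \<eta>
    by (rule adj.unit)
  \<comment> \<open>R is a pseudo functor, so the horizontal arrow it picks out is only isomorphic
    to \<open>hid D one\<close>. Terminality is proved for t and transported along the comparison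
    cell \<open>FUnit R ()\<close>.\<close>
  define t where "t = FHor R ()"
  have T: "() \<in> Obj (Ver terminal_dblcat)" "() \<in> Obj (Hor terminal_dblcat)"
    "Ide (Ver terminal_dblcat) () = ()" "Ide (Hor terminal_dblcat) () = ()"
    by (simp_all add: terminal_dblcat_def unit_cat_def)
  show one: "one \<in> Obj (Ver D)" using RV.map_obj[OF T(1)] R by simp
  have t: "t \<in> Obj (Hor D)" using RH.map_obj[OF T(2)] t_def by simp
  have RI: "FVer R () = vid one" "FCell R () = Hid t"
    using RV.map_ide[OF T(1)] RH.map_ide[OF T(2)] R T t_def by simp_all
  have \<eta>o: "TObj \<eta> A \<in> vhom A one" if "A \<in> Obj (Ver D)" for A
    using \<eta>.obj_component[OF that] R by (simp add: id_dblfun_def comp_dblfun_def to_terminal_def)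
  have \<eta>h: "THor \<eta> p \<in> hom (Hor D) p t" if "p \<in> Obj (Hor D)" for p
    using \<eta>.hor_component[OF that]
    by (simp add: id_dblfun_def comp_dblfun_def to_terminal_def cell_def t_def)
  \<comment> \<open>In the right triangle identities the counit factor is the image under R of an
    identity.\<close>
  have "TObj \<eta> one \<cdot> vid one = vid one" "THor \<eta> t \<bullet> Hid t = Hid t"
    using adj.triangle_right_obj[OF T(1)] adj.triangle_right_hor[OF T(2)] R RI t_def by simp_all
  then have \<eta>I: "TObj \<eta> one = vid one" "THor \<eta> t = Hid t"
    using V.ide_right[OF \<eta>o[OF one]] H.ide_right[OF \<eta>h[OF t]] by simp_all
  show "\<exists>!f. f \<in> vhom A one" if A: "A \<in> Obj (Ver D)"
  proof (rule ex1I)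
    show "TObj \<eta> A \<in> vhom A one" using \<eta>o[OF A] .
    show "f = TObj \<eta> A" if f: "f \<in> vhom A one" for f
      using \<eta>.natural_ver[OF f] V.ide_right[OF f] V.ide_right[OF \<eta>o[OF A]] \<eta>I RI
      by (simp add: id_dblfun_def comp_dblfun_def to_terminal_def)
  qed
  have t_unique: "\<alpha> = THor \<eta> p" if \<alpha>: "\<alpha> \<in> hom (Hor D) p t" for \<alpha> p
    using \<eta>.natural_cell[OF \<alpha>] H.ide_right[OF \<alpha>] H.ide_right[OF \<eta>h] H.homD[OF \<alpha>] \<eta>I RI
    by (simp add: id_dblfun_def comp_dblfun_def to_terminal_def)
  have "globular_iso D (FUnit R ()) (hid D one) (FHor R (hid terminal_dblcat ()))"
    using R.unit_iso[OF T(1)] R by simp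
  then have unit: "globular_iso D (FUnit R ()) (hid D one) t" by (simp add: t_def)
  note u = globular_isoD[OF unit]
  show "\<exists>!\<alpha>. \<alpha> \<in> hom (Hor D) p (hid D one)" if p: "p \<in> Obj (Hor D)"
  proof (rule ex_ex1I)
    obtain \<nu> where "globular_iso D \<nu> t (hid D one)" using globular_iso_inverse[OF unit] .
    then show "\<exists>\<alpha>. \<alpha> \<in> hom (Hor D) p (hid D one)"
      using H.comp_hom[OF \<eta>h[OF p]] cellD(1)[OF globular_isoD(2)] by blast
  next
    \<comment> \<open>Followed by the comparison cell both end in t, hence agree; the comparison
      cell is invertible and cancels.\<close>
    show "\<alpha> = \<beta>" if "\<alpha> \<in> hom (Hor D) p (hid D one)" "\<beta> \<in> hom (Hor D) p (hid D one)" for \<alpha> \<beta>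
      using H.iso_mono[OF u(1) cellD(1)[OF u(2)] that] t_unique H.comp_hom[OF _ cellD(1)[OF u(2)]] that
      by metis
  qed
qed

section \<open>Companions of the arrows into the terminal object\<close>

locale terminal_equipment = double_fibration +
  fixes one
  assumes one_obj: "one \<in> Obj (Ver D)"
    and ver_terminal: "A \<in> Obj (Ver D) \<Longrightarrow> \<exists>!f. f \<in> vhom A one"
    and hor_terminal: "p \<in> Obj (Hor D) \<Longrightarrow> \<exists>!\<alpha>. \<alpha> \<in> hom (Hor D) p (hid D one)"
begin

abbreviation bng where "bng A \<equiv> bang D one A"

lemma bang_hom: "A \<in> Obj (Ver D) \<Longrightarrow> bng A \<in> vhom A one"
  unfolding bang_def using ver_terminal by (rule theI')

lemma bang_unique: "f \<in> vhom A one \<Longrightarrow> f = bng A"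
  using ver_terminal bang_hom V.homD(4) by blast

lemma comp_bang: "f \<in> vhom A B \<Longrightarrow> f \<cdot> bng B = bng A"
  using bang_unique V.comp_hom bang_hom V.homD(5) by blast

lemma cell_into_one:
  assumes "\<alpha> \<in> hom (Hor D) p (hid D one)"
  shows "cell D \<alpha> p (hid D one) (bng (hsrc D p)) (bng (htgt D p))"
  using src.map_hom[OF assms] tgt.map_hom[OF assms] assms bang_unique hsrc_hid htgt_hid one_obj
  by (simp add: cell_def)

lemma one_cell_unique:
  "\<lbrakk>\<alpha> \<in> hom (Hor D) p (hid D one); \<beta> \<in> hom (Hor D) p (hid D one)\<rbrakk> \<Longrightarrow> \<alpha> = \<beta>"
  using hor_terminal H.homD(4) by blast

text \<open>\<open>p\<close> is a companion of \<open>! : X \<rightarrow> 1\<close>; the unit cell is recovered from terminality of \<open>Id 1\<close>.\<close>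

definition bang_companion where
  "bang_companion X p \<longleftrightarrow> X \<in> Obj (Ver D) \<and> p \<in> Obj (Hor D) \<and> hsrc D p = X \<and> htgt D p = one \<and>
     (\<exists>\<gamma>. cell D \<gamma> p (hid D one) (bng X) (vid one) \<and> cartesian_cell D \<gamma>)"

lemma bang_companion_exists:
  assumes "X \<in> Obj (Ver D)"
  obtains p where "bang_companion X p"
proof -
  have "bng X \<in> vhom X (hsrc D (hid D one))" "vid one \<in> vhom one (htgt D (hid D one))"
    using bang_hom assms hsrc_hid htgt_hid one_obj V.ide_hom by auto
  then show ?thesis
    using restriction[OF hid_obj[OF one_obj]] that assms unfolding bang_companion_def by metis
qed

text \<open>Terminality of \<open>hid D one\<close> supplies a cell out of q and forces its frame,
  so the cartesian cell of p lifts it over any prescribed u and v. With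
  \<open>bang_companion_unique\<close>, giving a cell into p amounts to giving its frame.\<close>

lemma bang_companion_lift:
  assumes "bang_companion X p" "q \<in> Obj (Hor D)" "u \<in> vhom (hsrc D q) X" "v \<in> vhom (htgt D q) one"
  obtains \<chi> where "cell D \<chi> q p u v"
proof -
  obtain \<gamma> where p: "hsrc D p = X" "htgt D p = one" "X \<in> Obj (Ver D)"
    and \<gamma>: "cell D \<gamma> p (hid D one) (bng X) (vid one)" "cartesian_cell D \<gamma>"
    using assms(1) by (auto simp: bang_companion_def)
  obtain \<psi> where "\<psi> \<in> hom (Hor D) q (hid D one)" using hor_terminal assms(2) by blast
  then have \<psi>: "cell D \<psi> q (hid D one) (u \<cdot> bng X) (v \<cdot> vid one)"
    using cell_into_one comp_bang[OF assms(3)] V.ide_right[OF assms(4)] bang_unique[OF assms(4)] by simp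
  then show ?thesis
    using cart_cell_lift[OF \<gamma>(2,1) \<psi>, of u v] assms p that by auto
qed

lemma bang_companion_unique:
  assumes "bang_companion X p" "cell D \<chi> q p u v" "cell D \<chi>' q p u v"
  shows "\<chi> = \<chi>'"
proof -
  obtain \<gamma> where \<gamma>: "cell D \<gamma> p (hid D one) (bng X) (vid one)" "cartesian_cell D \<gamma>"
    using assms(1) by (auto simp: bang_companion_def)
  have "\<chi> \<bullet> \<gamma> = \<chi>' \<bullet> \<gamma>"
    using one_cell_unique cellD(1)[OF cell_comp[OF assms(2) \<gamma>(1) refl refl]]
      cellD(1)[OF cell_comp[OF assms(3) \<gamma>(1) refl refl]] by blast
  then show ?thesis using cart_cell_unique[OF \<gamma>(2,1) assms(2,3)] by blast
qed

text \<open>The cell with frame (id, !) is a companion unit: the required equation holds because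
  both sides end in the terminal \<open>hid D one\<close>. Hence
  \<open>companion_unit_opcart\<close> applies.\<close>

lemma bang_companion_unit:
  assumes "bang_companion X p"
  obtains \<kappa> where "cell D \<kappa> (hid D X) p (vid X) (bng X)" "opcartesian_cell D \<kappa>"
proof -
  obtain \<gamma> where p: "p \<in> Obj (Hor D)" "hsrc D p = X" "htgt D p = one" "X \<in> Obj (Ver D)"
    and \<gamma>: "cell D \<gamma> p (hid D one) (bng X) (vid one)" "cartesian_cell D \<gamma>"
    using assms by (auto simp: bang_companion_def)
  note X = hid_obj[OF p(4)] hsrc_hid[OF p(4)] htgt_hid[OF p(4)]
  obtain \<kappa> where \<kappa>: "cell D \<kappa> (hid D X) p (vid X) (bng X)"
    using bang_companion_lift[OF assms X(1), of "vid X" "bng X"] X V.ide_hom[OF p(4)] bang_hom[OF p(4)]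
    by auto
  have "\<kappa> \<bullet> \<gamma> = cid D (bng X)"
    using one_cell_unique cellD(1)[OF cell_comp[OF \<kappa> \<gamma>(1) refl refl]]
      cellD(1)[OF cell_cid[OF bang_hom[OF p(4)]]] by blast
  then have "companion (bng X) X one p \<kappa> \<gamma>"
    using \<kappa> \<gamma> bang_hom[OF p(4)] by (simp add: companion_def)
  then show ?thesis using companion_unit_opcart that \<kappa> by blast
qed

text \<open>The definition of an equipment provides cartesian lifts; this opcartesian lift is
  assembled in two stages. The unit into the companion q of ! pushes along (id, !), and composing q
  with the conjoint of f pushes along (f, id).\<close>

lemma bang_extension:
  assumes "f \<in> vhom X A"
  obtains p \<kappa> where "cell D \<kappa> (hid D X) p f (bng X)" "opcartesian_cell D \<kappa>" "p \<in> Obj (Hor D)"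
    "hsrc D p = A" "htgt D p = one"
proof -
  note XA = V.homD(4,5)[OF assms]
  obtain F \<eta> c where F: "conjoint f X A F \<eta> c" using conjoint_exists[OF assms] .
  obtain q where q: "bang_companion X q" using bang_companion_exists[OF XA(1)] .
  then have q': "q \<in> Obj (Hor D)" "hsrc D q = X" "htgt D q = one" by (auto simp: bang_companion_def)
  obtain \<kappa> where \<kappa>: "cell D \<kappa> (hid D X) q (vid X) (bng X)" "opcartesian_cell D \<kappa>"
    using bang_companion_unit[OF q] .
  obtain \<mu> where \<mu>: "globular_iso D \<mu> q (hid D X \<odot> q)" "\<mu> \<bullet> lunit D q = Hid q"
    using lunit_inverse[OF q'(1)] q'(2) by metis
  note \<omega> = conjoint_opcart[OF F q'(1,2) \<mu>]
  have "cell D (\<kappa> \<bullet> (\<mu> \<bullet> (\<eta> \<otimes> Hid q))) (hid D X) (F \<odot> q) f (bng X)"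
    using cell_comp[OF \<kappa>(1) \<omega>(1)] V.ide_left[OF assms] V.ide_right[OF bang_hom[OF XA(1)]] q'(3) by simp
  moreover have "opcartesian_cell D (\<kappa> \<bullet> (\<mu> \<bullet> (\<eta> \<otimes> Hid q)))"
    using opcart_cell_comp[OF \<kappa>(2) \<omega>(2) \<kappa>(1) \<omega>(1)] .
  moreover have "F \<odot> q \<in> Obj (Hor D)" "hsrc D (F \<odot> q) = A" "htgt D (F \<odot> q) = one"
    using hcomp_obj[of F q] conjointD(8-10)[OF F] q' comp_pairs_Obj by auto
  ultimately show ?thesis using that by blast
qed

subsection \<open>Final arrows\<close>

text \<open>The cartesian factor in the Beck-Chevalley condition is the datum of
  \<open>bang_companion\<close>, and the equation between composites is automatic, both sides being
  cells into the terminal \<open>hid D one\<close>.\<close>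

lemma Fin_iff:
  assumes "f \<in> vhom A X"
  shows "f \<in> Fin D one \<longleftrightarrow>
    (\<exists>p \<beta>. bang_companion X p \<and> cell D \<beta> (hid D A) p f (bng A) \<and> opcartesian_cell D \<beta>)"
proof -
  note AX = V.homD[OF assms]
  note bX = V.homD[OF bang_hom[OF AX(5)]]
  define \<iota> where "\<iota> = (THE \<alpha>. \<alpha> \<in> hom (Hor D) (hid D A) (hid D one))"
  have \<iota>: "\<iota> \<in> hom (Hor D) (hid D A) (hid D one)"
    unfolding \<iota>_def using hor_terminal[OF hid_obj[OF AX(4)]] by (rule theI')
  have "f \<in> Fin D one \<longleftrightarrow> (\<exists>p \<beta> \<gamma>. cell D \<beta> (hid D A) p f (bng A) \<and> opcartesian_cell D \<beta> \<and>
        cell D \<gamma> p (hid D one) (bng X) (vid one) \<and> cartesian_cell D \<gamma> \<and> \<beta> \<bullet> \<gamma> = \<iota>)"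
    using AX bX by (simp add: Fin_def beck_chevalley_def \<iota>_def)
  also have "\<dots> \<longleftrightarrow> (\<exists>p \<beta>. bang_companion X p \<and> cell D \<beta> (hid D A) p f (bng A) \<and> opcartesian_cell D \<beta>)"
  proof (intro iffI; elim exE conjE)
    fix p \<beta> \<gamma>
    assume *: "cell D \<beta> (hid D A) p f (bng A)" "opcartesian_cell D \<beta>"
      "cell D \<gamma> p (hid D one) (bng X) (vid one)" "cartesian_cell D \<gamma>"
    have "hsrc D p = X" using V.homD(2)[OF cellD(7)[OF *(3)]] bX(2) by simp
    moreover have "htgt D p = one"
      using V.homD(2)[OF cellD(8)[OF *(3)]] V.homD(2)[OF V.ide_hom[OF one_obj]] by simp
    ultimately show "\<exists>p \<beta>. bang_companion X p \<and> cell D \<beta> (hid D A) p f (bng A) \<and> opcartesian_cell D \<beta>"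
      using * cellD(5)[OF *(3)] AX(5) unfolding bang_companion_def by blast
  next
    fix p \<beta>
    assume *: "bang_companion X p" "cell D \<beta> (hid D A) p f (bng A)" "opcartesian_cell D \<beta>"
    then obtain \<gamma> where \<gamma>: "cell D \<gamma> p (hid D one) (bng X) (vid one)" "cartesian_cell D \<gamma>"
      by (auto simp: bang_companion_def)
    have "\<beta> \<bullet> \<gamma> = \<iota>"
      using one_cell_unique \<iota> cellD(1)[OF cell_comp[OF *(2) \<gamma>(1) refl refl]] by blast
    then show "\<exists>p \<beta> \<gamma>. cell D \<beta> (hid D A) p f (bng A) \<and> opcartesian_cell D \<beta> \<and>
        cell D \<gamma> p (hid D one) (bng X) (vid one) \<and> cartesian_cell D \<gamma> \<and> \<beta> \<bullet> \<gamma> = \<iota>"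
      using * \<gamma> by blast
  qed
  finally show ?thesis .
qed

lemma FinI:
  assumes "bang_companion X p" "cell D \<beta> (hid D A) p f (bng A)" "opcartesian_cell D \<beta>" "f \<in> vhom A X"
  shows "f \<in> Fin D one"
  using assms Fin_iff by blast

text \<open>Finality does not depend on the chosen companion or cell. Two companions of ! are
  isomorphic, and since cells into p are determined by their frames, the transported cell is
  \<chi>.\<close>

lemma Fin_opcart:
  assumes "f \<in> Fin D one" "f \<in> vhom A X" "bang_companion X p" "cell D \<chi> (hid D A) p f (bng A)"
  shows "opcartesian_cell D \<chi>"
proof -
  obtain q \<beta> where q: "bang_companion X q" and \<beta>: "cell D \<beta> (hid D A) q f (bng A)" "opcartesian_cell D \<beta>"
    using assms(1,2) Fin_iff by blast
  obtain \<gamma> \<gamma>' where \<gamma>: "cell D \<gamma> p (hid D one) (bng X) (vid one)" "cartesian_cell D \<gamma>"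
    and \<gamma>': "cell D \<gamma>' q (hid D one) (bng X) (vid one)" "cartesian_cell D \<gamma>'"
    using assms(3) q by (auto simp: bang_companion_def)
  obtain \<theta> where \<theta>: "globular_iso D \<theta> q p"
    using cart_cell_unique_iso[OF \<gamma>'(2) \<gamma>(2) \<gamma>'(1) \<gamma>(1)] .
  note t = globular_isoD[OF \<theta>]
  have "cell D (\<beta> \<bullet> \<theta>) (hid D A) p f (bng A)"
    using cell_comp[OF \<beta>(1) t(2)] vid_right_src[OF \<beta>(1)] vid_right_tgt[OF \<beta>(1)] by simp
  then have "\<beta> \<bullet> \<theta> = \<chi>" using bang_companion_unique assms(3,4) by blast
  then show ?thesis using opcart_cell_comp[OF \<beta>(2) opcart_cell_iso[OF t(1)] \<beta>(1) t(2)] by simp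
qed

lemma cell_unit_restrict:
  assumes "cell D \<kappa> (hid D B) p v (bng B)" "e \<in> vhom A B"
  shows "cell D (cid D e \<bullet> \<kappa>) (hid D A) p (e \<cdot> v) (bng A)"
  using cell_comp[OF cell_cid[OF assms(2)] assms(1)] comp_bang[OF assms(2)] by simp

text \<open>Supplies the closure property of the left class for the factorisation criterion below.
  The comparison of companions over the invertible m is opcartesian, and it is composed with the
  cell expressing finality of e.\<close>

lemma Fin_comp_iso:
  assumes "e \<in> Fin D one" "e \<in> vhom A T" "m \<in> vhom T X" "iso (Ver D) m"
  shows "e \<cdot> m \<in> Fin D one"
proof -
  note TX = V.homD(4,5)[OF assms(3)]
  obtain p q where p: "bang_companion T p" and q: "bang_companion X q"
    using bang_companion_exists TX by metis
  obtain \<kappa> where \<kappa>: "cell D \<kappa> (hid D T) p (vid T) (bng T)" "opcartesian_cell D \<kappa>"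
    using bang_companion_unit[OF p] .
  obtain \<omega> where \<omega>: "cell D \<omega> (hid D X) q (vid X) (bng X)" "opcartesian_cell D \<omega>"
    using bang_companion_unit[OF q] .
  have e\<kappa>: "cell D (cid D e \<bullet> \<kappa>) (hid D A) p e (bng A)"
    using cell_unit_restrict[OF \<kappa>(1) assms(2)] V.ide_right[OF assms(2)] by simp
  have m\<omega>: "cell D (cid D m \<bullet> \<omega>) (hid D T) q m (bng T)"
    using cell_unit_restrict[OF \<omega>(1) assms(3)] V.ide_right[OF assms(3)] by simp
  have p': "p \<in> Obj (Hor D)" "hsrc D p = T" "htgt D p = one" using p by (auto simp: bang_companion_def)
  obtain \<chi> where \<chi>: "cell D \<chi> p q m (vid one)"
    using bang_companion_lift[OF q p'(1)] p' assms(3) V.ide_hom[OF one_obj] by metis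
  have "cell D (\<kappa> \<bullet> \<chi>) (hid D T) q m (bng T)"
    using cell_comp[OF \<kappa>(1) \<chi>] V.ide_left[OF assms(3)] V.ide_right[OF bang_hom[OF TX(1)]] by simp
  \<comment> \<open>The right-hand side is an isomorphism followed by an opcartesian cell, so
    cancelling \<kappa> will make \<chi> opcartesian.\<close>
  then have "\<kappa> \<bullet> \<chi> = cid D m \<bullet> \<omega>" using bang_companion_unique q m\<omega> by blast
  moreover have "iso (Hor D) (cid D m)"
    using functor_iso[OF functor_id category_Ver assms(4)] .
  then have "opcartesian_cell D (cid D m \<bullet> \<omega>)"
    using opcart_cell_comp[OF opcart_cell_iso \<omega>(2) cell_cid[OF assms(3)] \<omega>(1)] by blast
  ultimately have "opcartesian_cell D \<chi>" using opcart_cell_cancel[OF \<kappa>(2) _ \<kappa>(1) \<chi>] by simp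
  then have "opcartesian_cell D ((cid D e \<bullet> \<kappa>) \<bullet> \<chi>)"
    using opcart_cell_comp[OF Fin_opcart[OF assms(1,2) p e\<kappa>] _ e\<kappa> \<chi>] by blast
  moreover have "cell D ((cid D e \<bullet> \<kappa>) \<bullet> \<chi>) (hid D A) q (e \<cdot> m) (bng A)"
    using cell_comp[OF e\<kappa> \<chi>] V.ide_right[OF bang_hom[OF V.homD(4)[OF assms(2)]]] by simp
  ultimately show ?thesis using FinI[OF q] V.comp_hom[OF assms(2,3)] by blast
qed

lemma Fin_pullback:
  assumes "has_beck_chevalley_pullbacks D" "is_pullback (Ver D) g f h k" "h \<in> Fin D one"
  shows "f \<in> Fin D one"
proof -
  define A B C Z where "A = Dom (Ver D) f" and "B = Dom (Ver D) h" and "C = Dom (Ver D) k"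
    and "Z = Cod (Ver D) k"
  have hom: "f \<in> vhom A C" "g \<in> vhom A B" "h \<in> vhom B Z" "k \<in> vhom C Z"
    using assms(2) by (auto simp: is_pullback_def A_def B_def C_def Z_def hom_def)
  note obj = V.homD(4,5)[OF hom(1)] V.homD(4,5)[OF hom(3)]
  \<comment> \<open>In this orientation f is the source leg, so p runs from C to B.\<close>
  have "beck_chevalley D f g k h (cid D (f \<cdot> k))"
    using assms(1,2) by (simp add: has_beck_chevalley_pullbacks_def beck_chevalley_pullback_def)
  then obtain p \<beta> \<gamma> where \<beta>: "cell D \<beta> (hid D A) p f g" "opcartesian_cell D \<beta>"
    and \<gamma>: "cell D \<gamma> p (hid D Z) k h" "cartesian_cell D \<gamma>"
    by (auto simp: beck_chevalley_def A_def Z_def)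
  obtain K \<eta>k ck where K: "companion k C Z K \<eta>k ck" using companion_exists[OF hom(4)] .
  obtain F \<eta>h ch where F: "conjoint h B Z F \<eta>h ch" using conjoint_exists[OF hom(3)] .
  \<comment> \<open>\<open>whisker_opcart\<close> needs a companion of the target leg of the cell
    being whiskered, which here is \<open>bng B\<close>.\<close>
  obtain G \<eta>b cb where G: "companion (bng B) B one G \<eta>b cb"
    using companion_exists[OF bang_hom[OF obj(3)]] .
  obtain P where P: "bang_companion Z P" using bang_companion_exists[OF obj(4)] .
  obtain \<kappa> where \<kappa>: "cell D \<kappa> (hid D Z) P (vid Z) (bng Z)" "opcartesian_cell D \<kappa>"
    using bang_companion_unit[OF P] .
  note K' = companionD[OF K] and F' = conjointD[OF F]
  have P': "P \<in> Obj (Hor D)" "hsrc D P = Z" "htgt D P = one" using P by (auto simp: bang_companion_def)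
  have Zi: "vid Z \<cdot> vid Z = vid Z" using V.ide_left V.ide_hom obj(4) by blast
  \<comment> \<open>Finality of \<^term>\<open>h\<close> makes the cell from the conjoint of \<^term>\<open>h\<close> to the companion of \<^term>\<open>bng Z\<close> opcartesian.\<close>
  have \<epsilon>: "cell D (ch \<bullet> \<kappa>) F P (vid Z) (bng B)"
    using cell_comp[OF F'(3) \<kappa>(1) Zi comp_bang[OF hom(3)]] .
  have "\<eta>h \<bullet> (ch \<bullet> \<kappa>) = cid D h \<bullet> \<kappa>"
    using cell_comp_assoc[OF F'(2,3) \<kappa>(1)] F'(5) by simp
  moreover have "opcartesian_cell D (cid D h \<bullet> \<kappa>)"
    using Fin_opcart[OF assms(3) hom(3) P] cell_unit_restrict[OF \<kappa>(1) hom(3)] V.ide_right[OF hom(3)]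
    by simp
  ultimately have \<epsilon>o: "opcartesian_cell D (ch \<bullet> \<kappa>)"
    using opcart_cell_cancel[OF conjoint_unit_opcart[OF F] _ F'(2) \<epsilon>] by simp
  have "cell D (ch \<bullet> \<kappa>) F P (vid (hsrc D F)) (bng B)" using \<epsilon> F'(9) by simp
  note w = whisker_opcart[OF G this \<epsilon>o K'(8), unfolded K'(9,10) F'(9), OF refl]
  note l = companion_cart[OF K F'(8,9)]
  \<comment> \<open>\<open>K \<odot> F\<close> restricts \<open>hid D Z\<close> first along h on the
    target, then along k on the source. It thus has the universal property of p and is isomorphic to
    it.\<close>
  have \<delta>: "cell D ((ck \<otimes> Hid F) \<bullet> lunit D F \<bullet> ch) (K \<odot> F) (hid D Z) k h"
    using cell_comp[OF l(1) F'(3)] V.ide_right[OF hom(4)] V.ide_left[OF hom(3)] F'(10) by simp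
  have "cartesian_cell D ((ck \<otimes> Hid F) \<bullet> lunit D F \<bullet> ch)"
    using cart_cell_comp[OF l(2) F'(4) l(1) F'(3)] .
  then obtain \<theta> where \<theta>: "globular_iso D \<theta> p (K \<odot> F)"
    using cart_cell_unique_iso[OF \<gamma>(2) _ \<gamma>(1) \<delta>] by blast
  note t = globular_isoD[OF \<theta>]
  have \<beta>\<theta>: "cell D (\<beta> \<bullet> \<theta>) (hid D A) (K \<odot> F) f g"
    using cell_comp[OF \<beta>(1) t(2)] vid_right_src[OF \<beta>(1)] vid_right_tgt[OF \<beta>(1)] by simp
  have "opcartesian_cell D (\<beta> \<bullet> \<theta>)"
    using opcart_cell_comp[OF \<beta>(2) opcart_cell_iso[OF t(1)] \<beta>(1) t(2)] .
  then have o: "opcartesian_cell D (\<beta> \<bullet> \<theta> \<bullet> (Hid K \<otimes> (ch \<bullet> \<kappa>)))"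
    using opcart_cell_comp w \<beta>\<theta> by blast
  \<comment> \<open>The composite \<open>Id A \<rightarrow> p \<cong> K \<odot> F \<rightarrow> K
    \<odot> P\<close> is the candidate witness for finality of f.\<close>
  have c: "cell D (\<beta> \<bullet> \<theta> \<bullet> (Hid K \<otimes> (ch \<bullet> \<kappa>))) (hid D A) (K \<odot> P) f (bng A)"
    using cell_comp[OF \<beta>\<theta> w(1)] V.ide_right[OF hom(1)] comp_bang[OF hom(2)] by simp
  obtain \<gamma>P where \<gamma>P: "cell D \<gamma>P P (hid D one) (bng Z) (vid one)" "cartesian_cell D \<gamma>P"
    using P by (auto simp: bang_companion_def)
  \<comment> \<open>Restricting the companion P of ! further along k gives a companion of ! on C,
    since k followed by ! is !.\<close>
  note lP = companion_cart[OF K P'(1,2)]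
  have "cell D ((ck \<otimes> Hid P) \<bullet> lunit D P \<bullet> \<gamma>P) (K \<odot> P) (hid D one) (bng C) (vid one)"
    using cell_comp[OF lP(1) \<gamma>P(1)] comp_bang[OF hom(4)] V.ide_left[OF V.ide_hom[OF one_obj]] P'(3) by simp
  moreover have "cartesian_cell D ((ck \<otimes> Hid P) \<bullet> lunit D P \<bullet> \<gamma>P)"
    using cart_cell_comp[OF lP(2) \<gamma>P(2) lP(1) \<gamma>P(1)] .
  moreover have "K \<odot> P \<in> Obj (Hor D)" "hsrc D (K \<odot> P) = C" "htgt D (K \<odot> P) = one"
    using hcomp_obj[of K P] K' P' comp_pairs_Obj by auto
  ultimately have "bang_companion C (K \<odot> P)" using obj(2) by (auto simp: bang_companion_def)
  then show ?thesis using FinI c o hom(1) by blast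
qed

end

section \<open>Orthogonal factorisation systems\<close>

text \<open>An arrow orthogonal to the other class is factored as e followed by m. Lifting it
  against the unwanted factor shows that factor to be invertible, and closure under composition with
  isomorphisms puts the arrow in its class.\<close>

lemma (in category) orthogonal_factorisation_systemI:
  assumes E: "E \<subseteq> Arr C" and M: "M \<subseteq> Arr C"
    and orth: "\<And>e m. \<lbrakk>e \<in> E; m \<in> M\<rbrakk> \<Longrightarrow> orthogonal C e m"
    and factor: "\<And>f A X. f \<in> hom C A X \<Longrightarrow>
      \<exists>e m T. e \<in> E \<and> m \<in> M \<and> e \<in> hom C A T \<and> m \<in> hom C T X \<and> e \<Zsemi> m = f"
    and E_iso: "\<And>e m A T X. \<lbrakk>e \<in> E; e \<in> hom C A T; m \<in> hom C T X; iso C m\<rbrakk> \<Longrightarrow> e \<Zsemi> m \<in> E"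
    and M_iso: "\<And>e m A T X. \<lbrakk>m \<in> M; e \<in> hom C A T; m \<in> hom C T X; iso C e\<rbrakk> \<Longrightarrow> e \<Zsemi> m \<in> M"
  shows "orthogonal_factorisation_system C E M"
  unfolding orthogonal_factorisation_system_def
proof (intro conjI)
  show "E = {e \<in> Arr C. \<forall>m \<in> M. orthogonal C e m}"
  proof (intro equalityI subsetI CollectI conjI ballI)
    fix f assume "f \<in> {e \<in> Arr C. \<forall>m \<in> M. orthogonal C e m}"
    then have f: "f \<in> Arr C" and ort: "\<And>m. m \<in> M \<Longrightarrow> orthogonal C f m" by auto
    define A X where "A = Dom C f" and "X = Cod C f"
    have fh: "f \<in> hom C A X" using f by (simp add: hom_def A_def X_def)
    obtain e m T where em: "e \<in> E" "m \<in> M" "e \<in> hom C A T" "m \<in> hom C T X" "e \<Zsemi> m = f"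
      using factor[OF fh] by blast
    note D = homD[OF em(3)] homD[OF em(4)]
    have "e \<Zsemi> m = f \<Zsemi> Ide C X" using em(5) ide_right[OF fh] by simp
    \<comment> \<open>The square with sides e and an identity yields a section d of m.\<close>
    then obtain d where d: "d \<in> hom C X T" "f \<Zsemi> d = e" "d \<Zsemi> m = Ide C X"
      using ort[OF em(2)] em(3) ide_hom[OF D(10)] D unfolding orthogonal_def A_def X_def by metis
    have md: "m \<Zsemi> d \<in> hom C T T" using comp_hom em(4) d(1) by blast
    \<comment> \<open>\<open>m \<Zsemi> d\<close> and the identity of T both fill the square from e
      to m with sides e and m, so orthogonality of e and m equates them.\<close>
    have "e \<Zsemi> (m \<Zsemi> d) = e" using comp_assoc[OF em(3,4) d(1)] em(5) d(2) by simp
    moreover have "(m \<Zsemi> d) \<Zsemi> m = m" using comp_assoc[OF em(4) d(1) em(4)] d(3) ide_right[OF em(4)] by simp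
    moreover have "e \<Zsemi> Ide C T = e" "Ide C T \<Zsemi> m = m" "Ide C T \<in> hom C T T"
      using ide_right[OF em(3)] ide_left[OF em(4)] ide_hom[OF D(5)] by auto
    ultimately have "m \<Zsemi> d = Ide C T"
      using orth[OF em(1,2)] em(3,4) md D unfolding orthogonal_def by metis
    then have "iso C m" using isoI[OF em(4) d(1)] d(3) by blast
    then show "f \<in> E" using E_iso[OF em(1,3,4)] em(5) by simp
  qed (use E orth in auto)
next
  show "M = {m \<in> Arr C. \<forall>e \<in> E. orthogonal C e m}"
  proof (intro equalityI subsetI CollectI conjI ballI)
    fix f assume "f \<in> {m \<in> Arr C. \<forall>e \<in> E. orthogonal C e m}"
    then have f: "f \<in> Arr C" and ort: "\<And>e. e \<in> E \<Longrightarrow> orthogonal C e f" by auto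
    define A X where "A = Dom C f" and "X = Cod C f"
    have fh: "f \<in> hom C A X" using f by (simp add: hom_def A_def X_def)
    obtain e m T where em: "e \<in> E" "m \<in> M" "e \<in> hom C A T" "m \<in> hom C T X" "e \<Zsemi> m = f"
      using factor[OF fh] by blast
    note D = homD[OF em(3)] homD[OF em(4)]
    have "Ide C A \<Zsemi> f = e \<Zsemi> m" using em(5) ide_left[OF fh] by simp
    \<comment> \<open>Dually, d satisfies \<open>e \<Zsemi> d = Ide C A\<close>, and the same filler
      argument on T gives the other inverse law.\<close>
    then obtain d where d: "d \<in> hom C T A" "e \<Zsemi> d = Ide C A" "d \<Zsemi> f = m"
      using ort[OF em(1)] em(4) ide_hom[OF D(4)] D unfolding orthogonal_def A_def X_def by metis
    have de: "d \<Zsemi> e \<in> hom C T T" using comp_hom em(3) d(1) by blast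
    have "e \<Zsemi> (d \<Zsemi> e) = e" using comp_assoc[OF em(3) d(1) em(3)] d(2) ide_left[OF em(3)] by simp
    moreover have "(d \<Zsemi> e) \<Zsemi> m = m" using comp_assoc[OF d(1) em(3,4)] em(5) d(3) by simp
    moreover have "e \<Zsemi> Ide C T = e" "Ide C T \<Zsemi> m = m" "Ide C T \<in> hom C T T"
      using ide_right[OF em(3)] ide_left[OF em(4)] ide_hom[OF D(5)] by auto
    ultimately have "d \<Zsemi> e = Ide C T"
      using orth[OF em(1,2)] em(3,4) de D unfolding orthogonal_def by metis
    then have "iso C e" using isoI[OF em(3) d(1)] d(2) by blast
    then show "f \<in> M" using M_iso[OF em(2-4)] em(5) by simp
  qed (use M orth in auto)
next
  show "\<forall>f \<in> Arr C. \<exists>e \<in> E. \<exists>m \<in> M. Cod C e = Dom C m \<and> e \<Zsemi> m = f"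
    using factor[OF homI] homD by metis
qed

section \<open>Comprehension schemes\<close>

locale comprehension_scheme = terminal_equipment +
  fixes M
  assumes stable: "stable_system (Ver D) M"
    and scheme: "left_sided_comprehension_scheme D one M"
begin

lemma M_arr: "M \<subseteq> Arr (Ver D)"
  using stable by (simp add: stable_system_def)

lemma M_iso: "iso (Ver D) f \<Longrightarrow> f \<in> M"
  using stable by (simp add: stable_system_def)

lemma M_comp: "\<lbrakk>f \<in> M; g \<in> M; f \<in> vhom A B; g \<in> vhom B C\<rbrakk> \<Longrightarrow> f \<cdot> g \<in> M"
  using stable by (auto simp: stable_system_def hom_def)

lemma M_tabulator:
  assumes "m \<in> M" "m \<in> vhom X Y" "cell D \<kappa> (hid D X) p m (bng X)" "opcartesian_cell D \<kappa>"
  shows "is_tabulator D one p X m \<kappa>"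
  using scheme assms V.homD(2)[OF assms(2)]
  unfolding left_sided_comprehension_scheme_def is_extension_def by blast

lemma strong_tabulator:
  assumes "p \<in> Obj (Hor D)" "htgt D p = one"
  obtains T l \<tau> where "is_tabulator D one p T l \<tau>" "opcartesian_cell D \<tau>" "l \<in> M"
  using scheme assms unfolding left_sided_comprehension_scheme_def has_strong_tabulator_def by blast

lemma tabulatorD:
  assumes "is_tabulator D one p T l \<tau>"
  shows "T \<in> Obj (Ver D)" "cell D \<tau> (hid D T) p l (bng T)" "l \<in> vhom T (hsrc D p)"
proof -
  show *: "T \<in> Obj (Ver D)" "cell D \<tau> (hid D T) p l (bng T)"
    using assms by (auto simp: is_tabulator_def)
  show "l \<in> vhom T (hsrc D p)" using cellD(7)[OF *(2)] hsrc_hid[OF *(1)] by simp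
qed

lemma tabulator_lift:
  assumes "is_tabulator D one p T l \<tau>" "cell D \<zeta> (hid D Z) p f g" "Z \<in> Obj (Ver D)"
  obtains u where "u \<in> vhom Z T" "cid D u \<bullet> \<tau> = \<zeta>" "u \<cdot> l = f"
proof -
  obtain u where u: "u \<in> vhom Z T" "cid D u \<bullet> \<tau> = \<zeta>"
    using assms cellD(1) unfolding is_tabulator_def by blast
  \<comment> \<open>The tabulator property gives an equation of cells; its source frame is the
    equation of arrows.\<close>
  have "u \<cdot> l = f"
    using cellD(2)[OF cell_unit_restrict[OF tabulatorD(2)[OF assms(1)] u(1)]] u(2) cellD(2)[OF assms(2)]
    by simp
  then show ?thesis using that u by blast
qed

lemma tabulator_unique:
  assumes "is_tabulator D one p T l \<tau>" "u \<in> vhom Z T" "u' \<in> vhom Z T" "cid D u \<bullet> \<tau> = cid D u' \<bullet> \<tau>"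
  shows "u = u'"
proof -
  have "cid D u \<bullet> \<tau> \<in> hom (Hor D) (hid D Z) p"
    using cellD(1)[OF cell_unit_restrict[OF tabulatorD(2)[OF assms(1)] assms(2)]] .
  then show ?thesis
    using assms V.homD(4)[OF assms(2)] unfolding is_tabulator_def by metis
qed

lemma cid_comp_assoc:
  assumes "f \<in> vhom A B" "g \<in> vhom B C" "cell D \<kappa> (hid D C) p u v"
  shows "cid D (f \<cdot> g) \<bullet> \<kappa> = cid D f \<bullet> (cid D g \<bullet> \<kappa>)"
  using cell_comp_assoc[OF cell_cid[OF assms(1)] cell_cid[OF assms(2)] assms(3)]
    idf.map_comp[OF assms(1,2)] by simp

section \<open>Orthogonality of final arrows to M\<close>

lemma Fin_orthogonal:
  assumes e: "e \<in> Fin D one" and m: "m \<in> M"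
  shows "orthogonal (Ver D) e m"
  unfolding orthogonal_def
proof (intro ballI impI)
  define A B X Y where "A = Dom (Ver D) e" and "B = Cod (Ver D) e" and "X = Dom (Ver D) m"
    and "Y = Cod (Ver D) m"
  have eh: "e \<in> vhom A B" and mh: "m \<in> vhom X Y"
    using e m M_arr by (auto simp: A_def B_def X_def Y_def hom_def Fin_def)
  note AB = V.homD(4,5)[OF eh]
  fix u v
  assume "u \<in> vhom (Dom (Ver D) e) (Dom (Ver D) m)" "v \<in> vhom (Cod (Ver D) e) (Cod (Ver D) m)"
    and sq: "u \<cdot> m = e \<cdot> v"
  then have u: "u \<in> vhom A X" and v: "v \<in> vhom B Y" by (auto simp: A_def B_def X_def Y_def)
  obtain p \<kappa> where \<kappa>: "cell D \<kappa> (hid D X) p m (bng X)" "opcartesian_cell D \<kappa>"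
    and p: "p \<in> Obj (Hor D)" "hsrc D p = Y" "htgt D p = one"
    using bang_extension[OF mh] .
  note tab = M_tabulator[OF m mh \<kappa>]
  \<comment> \<open>Both \<omega> and, by finality of e, \<open>cid D e \<bullet> \<omega>\<close>
    are opcartesian into q. So cells from q to p over (v, id) can be traded for cells out of
    \<open>hid D B\<close> or out of \<open>hid D A\<close>.\<close>
  obtain q where q: "bang_companion B q" using bang_companion_exists[OF AB(2)] .
  then have q': "hsrc D q = B" "htgt D q = one" by (auto simp: bang_companion_def)
  obtain \<omega> where \<omega>: "cell D \<omega> (hid D B) q (vid B) (bng B)" "opcartesian_cell D \<omega>"
    using bang_companion_unit[OF q] .
  have e\<omega>: "cell D (cid D e \<bullet> \<omega>) (hid D A) q e (bng A)"
    using cell_unit_restrict[OF \<omega>(1) eh] V.ide_right[OF eh] by simp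
  note e\<omega>o = Fin_opcart[OF e eh q e\<omega>]
  have u\<kappa>: "cell D (cid D u \<bullet> \<kappa>) (hid D A) p (e \<cdot> v) (bng A)"
    using cell_unit_restrict[OF \<kappa>(1) u] sq by simp
  have fr: "v \<in> vhom (hsrc D q) (hsrc D p)" "vid one \<in> vhom (htgt D q) (htgt D p)"
    "bng A = bng A \<cdot> vid one" "bng B = bng B \<cdot> vid one" "v = vid B \<cdot> v"
    using v q' p V.ide_hom[OF one_obj] V.ide_right[OF bang_hom] V.ide_left[OF v] AB by auto
  \<comment> \<open>The commuting square gives the cell of u the source frame
    \<open>e \<cdot> v\<close>, so it descends to q; precomposing with \<omega> then gives the cell
    classified by d.\<close>
  obtain \<rho> where \<rho>: "cell D \<rho> q p v (vid one)" "(cid D e \<bullet> \<omega>) \<bullet> \<rho> = cid D u \<bullet> \<kappa>"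
    using opcart_cell_lift[OF e\<omega>o e\<omega> u\<kappa> fr(1,2) refl fr(3)] .
  have \<delta>: "cell D (\<omega> \<bullet> \<rho>) (hid D B) p v (bng B)"
    using cell_comp[OF \<omega>(1) \<rho>(1)] fr(4,5) by simp
  obtain d where d: "d \<in> vhom B X" "cid D d \<bullet> \<kappa> = \<omega> \<bullet> \<rho>" "d \<cdot> m = v"
    using tabulator_lift[OF tab \<delta> AB(2)] .
  have "cid D (e \<cdot> d) \<bullet> \<kappa> = cid D u \<bullet> \<kappa>"
    using cid_comp_assoc[OF eh d(1) \<kappa>(1)] d(2) \<rho>(2) cell_comp_assoc[OF cell_cid[OF eh] \<omega>(1) \<rho>(1)]
    by simp
  then have ed: "e \<cdot> d = u" using tabulator_unique[OF tab V.comp_hom[OF eh d(1)] u] by simp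
  \<comment> \<open>A competitor d' also gives a cell \<rho>' on q. Preceded by
    \<open>cid D e \<bullet> \<omega>\<close>, both \<rho>' and \<rho> yield the cell of u, so they
    are equal.\<close>
  have "d' = d" if d': "d' \<in> vhom B X" "e \<cdot> d' = u" "d' \<cdot> m = v" for d'
  proof -
    have c: "cell D (cid D d' \<bullet> \<kappa>) (hid D B) p v (bng B)"
      using cell_unit_restrict[OF \<kappa>(1) d'(1)] d'(3) by simp
    obtain \<rho>' where \<rho>': "cell D \<rho>' q p v (vid one)" "\<omega> \<bullet> \<rho>' = cid D d' \<bullet> \<kappa>"
      using opcart_cell_lift[OF \<omega>(2,1) c fr(1,2,5,4)] .
    have "(cid D e \<bullet> \<omega>) \<bullet> \<rho>' = (cid D e \<bullet> \<omega>) \<bullet> \<rho>"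
      using cell_comp_assoc[OF cell_cid[OF eh] \<omega>(1) \<rho>'(1)] \<rho>'(2) cid_comp_assoc[OF eh d'(1) \<kappa>(1)]
        d'(2) \<rho>(2) by simp
    then have "\<rho>' = \<rho>" using opcart_cell_unique[OF e\<omega>o e\<omega> \<rho>'(1) \<rho>(1)] by blast
    then show ?thesis using tabulator_unique[OF tab d'(1) d(1)] \<rho>'(2) d(2) by simp
  qed
  then show "\<exists>!d. d \<in> vhom (Cod (Ver D) e) (Dom (Ver D) m) \<and> e \<cdot> d = u \<and> d \<cdot> m = v"
    using d ed unfolding A_def B_def X_def Y_def by blast
qed

section \<open>Factorisation through a tabulator\<close>

lemma Fin_M_factorisation:
  assumes f: "f \<in> vhom A X"
  shows "\<exists>e m T. e \<in> Fin D one \<and> m \<in> M \<and> e \<in> vhom A T \<and> m \<in> vhom T X \<and> e \<cdot> m = f"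
proof -
  note AX = V.homD(4,5)[OF f]
  note I1 = V.ide_hom[OF one_obj]
  obtain p \<kappa> where \<kappa>: "cell D \<kappa> (hid D A) p f (bng A)" "opcartesian_cell D \<kappa>"
    and p: "p \<in> Obj (Hor D)" "hsrc D p = X" "htgt D p = one"
    using bang_extension[OF f] .
  obtain T m \<tau> where tab: "is_tabulator D one p T m \<tau>" and \<tau>o: "opcartesian_cell D \<tau>" and m: "m \<in> M"
    using strong_tabulator[OF p(1,3)] .
  note T = tabulatorD[OF tab]
  have mh: "m \<in> vhom T X" using T(3) p(2) by simp
  obtain e where e: "e \<in> vhom A T" "cid D e \<bullet> \<tau> = \<kappa>" "e \<cdot> m = f"
    using tabulator_lift[OF tab \<kappa>(1) AX(1)] .
  obtain P where P: "bang_companion T P" using bang_companion_exists[OF T(1)] .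
  then have P': "P \<in> Obj (Hor D)" "hsrc D P = T" "htgt D P = one" by (auto simp: bang_companion_def)
  obtain \<pi> where \<pi>: "cell D \<pi> (hid D T) P (vid T) (bng T)" "opcartesian_cell D \<pi>"
    using bang_companion_unit[OF P] .
  have fr: "m \<in> vhom (hsrc D P) (hsrc D p)" "vid one \<in> vhom (htgt D P) (htgt D p)"
    "m = vid T \<cdot> m" "bng T = bng T \<cdot> vid one"
    using mh P' p I1 V.ide_left[OF mh] V.ide_right[OF bang_hom[OF T(1)]] by auto
  obtain \<rho> where \<rho>: "cell D \<rho> P p m (vid one)" "\<pi> \<bullet> \<rho> = \<tau>"
    using opcart_cell_lift[OF \<pi>(2,1) T(2) fr] .
  obtain q \<epsilon> where \<epsilon>: "cell D \<epsilon> (hid D A) q e (bng A)" "opcartesian_cell D \<epsilon>"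
    and q: "q \<in> Obj (Hor D)" "hsrc D q = T" "htgt D q = one"
    using bang_extension[OF e(1)] .
  \<comment> \<open>\<theta> compares the extension q of e with the companion of !. Finality of e
    will follow once \<theta> is opcartesian.\<close>
  obtain \<theta> where \<theta>: "cell D \<theta> q P (vid T) (vid one)"
    using bang_companion_lift[OF P q(1)] q V.ide_hom[OF T(1)] I1 by metis
  have \<epsilon>\<theta>: "cell D (\<epsilon> \<bullet> \<theta>) (hid D A) P e (bng A)"
    using cell_comp[OF \<epsilon>(1) \<theta>] V.ide_right[OF e(1)] V.ide_right[OF bang_hom[OF AX(1)]] by simp
  have e\<pi>: "cell D (cid D e \<bullet> \<pi>) (hid D A) P e (bng A)"
    using cell_unit_restrict[OF \<pi>(1) e(1)] V.ide_right[OF e(1)] by simp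
  have \<epsilon>\<theta>_eq: "\<epsilon> \<bullet> \<theta> = cid D e \<bullet> \<pi>" using bang_companion_unique[OF P \<epsilon>\<theta> e\<pi>] .
  have \<theta>\<rho>: "cell D (\<theta> \<bullet> \<rho>) q p m (vid one)"
    using cell_comp[OF \<theta> \<rho>(1)] fr(3) V.ide_left[OF I1] by simp
  \<comment> \<open>Since \<epsilon> and \<kappa> are opcartesian, so is
    \<open>\<theta> \<bullet> \<rho>\<close>; composing it with \<sigma> below turns a tabulator of
    q into an opcartesian cell into p.\<close>
  have "\<epsilon> \<bullet> (\<theta> \<bullet> \<rho>) = \<kappa>"
    using cell_comp_assoc[OF \<epsilon>(1) \<theta> \<rho>(1)] \<epsilon>\<theta>_eq cell_comp_assoc[OF cell_cid[OF e(1)] \<pi>(1) \<rho>(1)]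
      \<rho>(2) e(2) by simp
  then have \<theta>\<rho>o: "opcartesian_cell D (\<theta> \<bullet> \<rho>)"
    using opcart_cell_cancel[OF \<epsilon>(2) _ \<epsilon>(1) \<theta>\<rho>] \<kappa>(2) by simp
  obtain S s \<sigma> where tabS: "is_tabulator D one q S s \<sigma>" and \<sigma>o: "opcartesian_cell D \<sigma>" and s: "s \<in> M"
    using strong_tabulator[OF q(1,3)] .
  note S = tabulatorD[OF tabS]
  have sh: "s \<in> vhom S T" using S(3) q(2) by simp
  have s\<theta>: "cell D (\<sigma> \<bullet> \<theta>) (hid D S) P s (bng S)"
    using cell_comp[OF S(2) \<theta>] V.ide_right[OF sh] V.ide_right[OF bang_hom[OF S(1)]] by simp
  have s\<pi>: "cell D (cid D s \<bullet> \<pi>) (hid D S) P s (bng S)"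
    using cell_unit_restrict[OF \<pi>(1) sh] V.ide_right[OF sh] by simp
  have s\<theta>_eq: "\<sigma> \<bullet> \<theta> = cid D s \<bullet> \<pi>" using bang_companion_unique[OF P s\<theta> s\<pi>] .
  have "\<sigma> \<bullet> (\<theta> \<bullet> \<rho>) = cid D s \<bullet> \<tau>"
    using cell_comp_assoc[OF S(2) \<theta> \<rho>(1)] s\<theta>_eq cell_comp_assoc[OF cell_cid[OF sh] \<pi>(1) \<rho>(1)] \<rho>(2)
    by simp
  then have s\<tau>o: "opcartesian_cell D (cid D s \<bullet> \<tau>)"
    using opcart_cell_comp[OF \<sigma>o \<theta>\<rho>o S(2) \<theta>\<rho>] by simp
  \<comment> \<open>Since \<^term>\<open>s \<cdot> m \<in> M\<close>, both \<^term>\<open>S\<close> and \<^term>\<open>T\<close> tabulate \<^term>\<open>p\<close>, which makes \<^term>\<open>s\<close> invertible.\<close>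
  have tabS': "is_tabulator D one p S (s \<cdot> m) (cid D s \<bullet> \<tau>)"
    using M_tabulator[OF M_comp[OF s m sh mh] V.comp_hom[OF sh mh] cell_unit_restrict[OF T(2) sh] s\<tau>o] .
  obtain w where w: "w \<in> vhom T S" "cid D w \<bullet> (cid D s \<bullet> \<tau>) = \<tau>"
    using tabulator_lift[OF tabS' T(2,1)] .
  have "cid D (w \<cdot> s) \<bullet> \<tau> = cid D (vid T) \<bullet> \<tau>"
    using cid_comp_assoc[OF w(1) sh T(2)] w(2) cid_vid[OF T(1)] cell_Hid_left[OF T(2)] by simp
  then have ws: "w \<cdot> s = vid T"
    using tabulator_unique[OF tab V.comp_hom[OF w(1) sh] V.ide_hom[OF T(1)]] by blast
  note s\<tau> = tabulatorD(2)[OF tabS']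
  have "cid D (s \<cdot> w) \<bullet> (cid D s \<bullet> \<tau>) = cid D (vid S) \<bullet> (cid D s \<bullet> \<tau>)"
    using cid_comp_assoc[OF sh w(1) s\<tau>] w(2) cid_vid[OF S(1)] cell_Hid_left[OF s\<tau>] by simp
  then have sw: "s \<cdot> w = vid S"
    using tabulator_unique[OF tabS' V.comp_hom[OF sh w(1)] V.ide_hom[OF S(1)]] by blast
  have "iso (Ver D) s" using V.isoI[OF sh w(1) sw ws] .
  \<comment> \<open>With s invertible,
    \<open>\<sigma> \<bullet> \<theta> = cid D s \<bullet> \<pi>\<close> is opcartesian, and
    cancelling \<sigma> gives \<theta>.\<close>
  then have "opcartesian_cell D (cid D s)"
    using opcart_cell_iso functor_iso[OF functor_id category_Ver] by blast
  then have "opcartesian_cell D (\<sigma> \<bullet> \<theta>)"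
    using opcart_cell_comp[OF _ \<pi>(2) cell_cid[OF sh] \<pi>(1)] s\<theta>_eq by simp
  then have "opcartesian_cell D \<theta>" using opcart_cell_cancel[OF \<sigma>o _ S(2) \<theta>] by blast
  then have "opcartesian_cell D (\<epsilon> \<bullet> \<theta>)" using opcart_cell_comp[OF \<epsilon>(2) _ \<epsilon>(1) \<theta>] by blast
  then have "e \<in> Fin D one" using FinI[OF P \<epsilon>\<theta> _ e(1)] by blast
  then show ?thesis using m e mh by blast
qed

end

section \<open>Assembly of the factorisation system and its stability\<close>

theorem mainTheorem2:
  fixes D :: "('o, 'v, 'h, 'c) dblcat" and one :: 'o and M :: "'v set"
  assumes "equipment D"
    and "vertical_terminal D one"
    and "finitely_complete (Ver D)"
    and "stable_system (Ver D) M"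
    and "left_sided_comprehension_scheme D one M"
  shows "orthogonal_factorisation_system (Ver D) (Fin D one) M \<and>
    (has_beck_chevalley_pullbacks D \<longrightarrow> stable_under_pullback (Ver D) (Fin D one))"
proof -
  interpret double_category D using assms(1) by (simp add: equipment_def)
  interpret comprehension_scheme D one M
    using assms(1,4,5) vertical_terminal_universal[OF assms(2)]
    by unfold_locales (auto simp: equipment_def)
  have "orthogonal_factorisation_system (Ver D) (Fin D one) M"
  \<comment> \<open>The closure condition on M holds because M contains the isomorphisms and is
    closed under composition; on final arrows it is \<open>Fin_comp_iso\<close>.\<close>
  proof (rule V.orthogonal_factorisation_systemI)
    show "Fin D one \<subseteq> Arr (Ver D)" by (auto simp: Fin_def)
  qed (use M_arr M_iso M_comp Fin_orthogonal Fin_M_factorisation Fin_comp_iso in blast)+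
  then show ?thesis using Fin_pullback by (auto simp: stable_under_pullback_def)
qed

end
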